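(* Let $\mathtt{A}$ and $\mathtt{B}$ be any types. Let $\mathtt{s1}$ and $\mathtt{s2}$ be two closed terms of type $\mathtt{A}$ with $\mathtt{s1} \neq_{\beta\eta c} \mathtt{s2}$, and let $\mathtt{u1}$ and $\mathtt{u2}$ be any closed terms of type $\mathtt{B}$. Then there is a closed term $\mathtt{t}$ that is poly-typable by $\mathtt{A \to B}$ (with respect to $\mathtt{s1}$ and with respect to $\mathtt{s2}$) such that \[ \mathtt{t}\,\mathtt{s1} =_{\beta\eta c} \mathtt{u1} \quad\text{and}\quad \mathtt{t}\,\mathtt{s2} =_{\beta\eta c} \mathtt{u2}. \]
   Context: Linear $\lambda$-calculus in ML-like notation. Types: $\mathtt{A} ::= \mathtt{'a} \mid \mathtt{A1 * A2} \mid \mathtt{A1 \to A2}$, where $\mathtt{'a}$ ranges over type variables, $*$ is the tensor product and $\to$ is linear implication. Terms: $\mathtt{t} ::= \mathtt{x} \mid \mathtt{t}\,\mathtt{s} \mid \mathtt{fn\ x => t} \mid \mathtt{(s,t)} \mid \mathtt{let\ val\ (x,y)=s\ in\ t\ end}$. Typing judgements $\Gamma \vdash \mathtt{t:A}$ ($\Gamma$ a list of declarations of distinct variables) are derived by: $\mathtt{x:A}\vdash\mathtt{x:A}$; exchange of declarations in $\Gamma$; from $\mathtt{x:A},\Gamma\vdash \mathtt{t:B}$ infer $\Gamma\vdash\mathtt{fn\ x=>t : A\to B}$; from $\Gamma\vdash\mathtt{t:A\to B}$ and $\Delta\vdash\mathtt{s:A}$ infer $\Gamma,\Delta\vdash\mathtt{t\,s:B}$;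 from $\Gamma\vdash\mathtt{s:A}$ and $\Delta\vdash\mathtt{t:B}$ infer $\Gamma,\Delta\vdash\mathtt{(s,t):A*B}$; from $\Gamma\vdash\mathtt{s:A*B}$ and $\mathtt{x:A},\mathtt{y:B},\Delta\vdash\mathtt{t:C}$ infer $\Gamma,\Delta\vdash\mathtt{let\ val\ (x,y)=s\ in\ t\ end:C}$ (with $\Gamma,\Delta$ disjoint, so each variable is used exactly once). A closed term of type $\mathtt{A}$ is a term $\mathtt{t}$ with $\vdash\mathtt{t:A}$ derivable. The equality $=_{\beta\eta c}$ is the least congruence on typed terms (reflexive, symmetric, transitive, compatible with all term constructors) containing: $(\mathtt{fn\ x=>t})\,\mathtt{s} = \mathtt{t[s/x]}$; $\mathtt{let\ val\ (x,y)=(u,v)\ in\ w\ end} = \mathtt{w[u/x,v/y]}$; $\mathtt{fn\ x=>(t\ x)} = \mathtt{t}$; $\mathtt{let\ val\ (x,y)=t\ in\ (x,y)\ end} = \mathtt{t}$; and $C[\mathtt{let\ val\ (x,y)=t\ in\ u\ end}] = \mathtt{let\ val\ (x,y)=t\ in}\ C[\mathtt{u}]\ \mathtt{end}$ for every one-hole term context $C$ in which $\mathtt{x},\mathtt{y}$ are not free and whose binders capture no free variable of $\mathtt{t}$. Poly-typability: a type substitution maps type variables to types (extended homomorphically to types). The principal type $\mathrm{PT}(\mathtt{t})$ of a typable term $\mathtt{t}$ is a type $\mathtt{A}$ such that $\Gamma\vdash\mathtt{t:A}$ is derivable for some $\Gamma$ and every derivable $\Gamma'\vdash\mathtt{t:A'}$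 is a substitution instance of it. For closed terms $\mathtt{t},\mathtt{s}_1,\dots,\mathtt{s}_n$ such that $\vdash \mathtt{t : A'_1\to\cdots\to A'_n\to B'}$ is derivable for some types and $\vdash\mathtt{s}_i\mathtt{:A}_i$, the term $\mathtt{t}$ is poly-typable by $\mathtt{A_1\to\cdots\to A_n\to B}$ with respect to $\mathtt{s}_1,\dots,\mathtt{s}_n$ if there is a type substitution $\theta$ with $\theta(\mathrm{PT}(\mathtt{t})) = \mathtt{A''_1\to\cdots\to A''_n\to B}$ and $\theta(\mathrm{PT}(\mathtt{s}_i)) = \mathtt{A''_i}$ for each $i$. (This does not require $\vdash\mathtt{t : A_1\to\cdots\to A_n\to B}$.) *)

theory Defs
  imports Main
begin

type_synonym tyvar = nat
type_synonym var = nat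

datatype ty =
    TVar tyvar
  | Tensor ty ty  (infixr "\<otimes>" 75)
  | Lolli ty ty   (infixr "\<multimap>" 70)

text \<open>
  \<open>LetTup x y s t\<close> is \<open>let val (x,y) = s in t end\<close>. Terms carry names, so that plugging a term into
  a one-hole context is the usual, possibly capturing, textual operation; alpha-conversion is one
  of the generators of the equality below.
\<close>

datatype trm =
    Var var
  | App trm trm
  | Fn var trm
  | Tup trm trm
  | LetTup var var trm trm

primrec fv :: "trm \<Rightarrow> var set" where
  "fv (Var x) = {x}"
| "fv (App t s) = fv t \<union> fv s"
| "fv (Fn x t) = fv t - {x}"
| "fv (Tup s t) = fv s \<union> fv t"
| "fv (LetTup x y s t) = fv s \<union> (fv t - {x, y})"


subsection \<open>Typing\<close>

type_synonym ctx = "(var \<times> ty) list"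

definition vars_of :: "ctx \<Rightarrow> var set" where
  "vars_of \<Gamma> = fst ` set \<Gamma>"

inductive typing :: "ctx \<Rightarrow> trm \<Rightarrow> ty \<Rightarrow> bool"  ("_ \<turnstile> _ \<Colon> _" [51, 51, 51] 50) where
  ty_var: "[(x, A)] \<turnstile> Var x \<Colon> A"
| ty_exch: "\<Gamma> @ (x, A) # (y, B) # \<Delta> \<turnstile> t \<Colon> C \<Longrightarrow> \<Gamma> @ (y, B) # (x, A) # \<Delta> \<turnstile> t \<Colon> C"
| ty_fn: "(x, A) # \<Gamma> \<turnstile> t \<Colon> B \<Longrightarrow> \<Gamma> \<turnstile> Fn x t \<Colon> A \<multimap> B"
| ty_app: "\<Gamma> \<turnstile> t \<Colon> A \<multimap> B \<Longrightarrow> \<Delta> \<turnstile> s \<Colon> A \<Longrightarrow> vars_of \<Gamma> \<inter> vars_of \<Delta> = {}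
    \<Longrightarrow> \<Gamma> @ \<Delta> \<turnstile> App t s \<Colon> B"
| ty_tup: "\<Gamma> \<turnstile> s \<Colon> A \<Longrightarrow> \<Delta> \<turnstile> t \<Colon> B \<Longrightarrow> vars_of \<Gamma> \<inter> vars_of \<Delta> = {}
    \<Longrightarrow> \<Gamma> @ \<Delta> \<turnstile> Tup s t \<Colon> A \<otimes> B"
| ty_let: "\<Gamma> \<turnstile> s \<Colon> A \<otimes> B \<Longrightarrow> (x, A) # (y, B) # \<Delta> \<turnstile> t \<Colon> C \<Longrightarrow> vars_of \<Gamma> \<inter> vars_of \<Delta> = {}
    \<Longrightarrow> \<Gamma> @ \<Delta> \<turnstile> LetTup x y s t \<Colon> C"

text \<open>
  Distinctness of the declared variables is not a premise of the rules; it holds in every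
  derivable judgement, so the binders in \<open>ty_fn\<close> and \<open>ty_let\<close> are distinct from each other and
  from the rest of the context of the body.
\<close>

lemma typing_distinct: "\<Gamma> \<turnstile> t \<Colon> A \<Longrightarrow> distinct (map fst \<Gamma>)"
  by (induction rule: typing.induct) (auto simp: vars_of_def)

lemma typing_fv: "\<Gamma> \<turnstile> t \<Colon> A \<Longrightarrow> fv t = vars_of \<Gamma>"
proof (induction rule: typing.induct)
  case (ty_fn x A \<Gamma> t B)
  then show ?case using typing_distinct[OF ty_fn.hyps] by (auto simp: vars_of_def)
next
  case (ty_let \<Gamma> s A B x y \<Delta> t C)
  then show ?case using typing_distinct[OF ty_let.hyps(2)] by (auto simp: vars_of_def)
qed (auto simp: vars_of_def)


subsection \<open>Substitution and one-hole contexts\<close>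

definition fresh :: "var set \<Rightarrow> var" where
  "fresh X = (LEAST z. z \<notin> X)"

text \<open>
  Capture-avoiding simultaneous substitution in the style of Stoughton: every binder is renamed to
  a variable that is fresh for the images of the free variables of its scope, which makes the
  recursion structural.
\<close>

primrec subst :: "(var \<Rightarrow> trm) \<Rightarrow> trm \<Rightarrow> trm" where
  "subst \<sigma> (Var x) = \<sigma> x"
| "subst \<sigma> (App t s) = App (subst \<sigma> t) (subst \<sigma> s)"
| "subst \<sigma> (Fn x t) =
    (let z = fresh (\<Union>v \<in> fv t - {x}. fv (\<sigma> v))
     in Fn z (subst (\<sigma>(x := Var z)) t))"
| "subst \<sigma> (Tup s t) = Tup (subst \<sigma> s) (subst \<sigma> t)"
| "subst \<sigma> (LetTup x y s t) =
    (let X = (\<Union>v \<in> fv t - {x, y}. fv (\<sigma> v));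
         z = fresh X;
         w = fresh (insert z X)
     in LetTup z w (subst \<sigma> s) (subst (\<sigma>(x := Var z, y := Var w)) t))"

datatype tctx =
    Hole
  | AppL tctx trm
  | AppR trm tctx
  | FnC var tctx
  | TupL tctx trm
  | TupR trm tctx
  | LetL var var tctx trm
  | LetR var var trm tctx

primrec plug :: "tctx \<Rightarrow> trm \<Rightarrow> trm" where
  "plug Hole u = u"
| "plug (AppL C s) u = App (plug C u) s"
| "plug (AppR t C) u = App t (plug C u)"
| "plug (FnC x C) u = Fn x (plug C u)"
| "plug (TupL C t) u = Tup (plug C u) t"
| "plug (TupR s C) u = Tup s (plug C u)"
| "plug (LetL x y C t) u = LetTup x y (plug C u) t"
| "plug (LetR x y s C) u = LetTup x y s (plug C u)"

primrec fv_ctx :: "tctx \<Rightarrow> var set" where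
  "fv_ctx Hole = {}"
| "fv_ctx (AppL C s) = fv_ctx C \<union> fv s"
| "fv_ctx (AppR t C) = fv t \<union> fv_ctx C"
| "fv_ctx (FnC x C) = fv_ctx C - {x}"
| "fv_ctx (TupL C t) = fv_ctx C \<union> fv t"
| "fv_ctx (TupR s C) = fv s \<union> fv_ctx C"
| "fv_ctx (LetL x y C t) = fv_ctx C \<union> (fv t - {x, y})"
| "fv_ctx (LetR x y s C) = fv s \<union> (fv_ctx C - {x, y})"

text \<open>The binders whose scope contains the hole, i.e. the variables captured by plugging.\<close>

primrec binders :: "tctx \<Rightarrow> var set" where
  "binders Hole = {}"
| "binders (AppL C s) = binders C"
| "binders (AppR t C) = binders C"
| "binders (FnC x C) = insert x (binders C)"
| "binders (TupL C t) = binders C"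
| "binders (TupR s C) = binders C"
| "binders (LetL x y C t) = binders C"
| "binders (LetR x y s C) = {x, y} \<union> binders C"


subsection \<open>Equality\<close>

text \<open>
  The generating equations, on raw terms; they are used below only when both sides are typable with
  the same context and type. In \<open>ax_comm\<close> no condition is needed to keep the binders of \<open>C\<close> from
  capturing \<open>x\<close> or \<open>y\<close> in \<open>u\<close>: the right-hand side would then be untypable, as its outer \<open>x\<close> or \<open>y\<close>
  would be unused.
\<close>

inductive eq_axiom :: "trm \<Rightarrow> trm \<Rightarrow> bool" where
  ax_alpha_fn: "x' \<notin> fv (Fn x t) \<Longrightarrow> eq_axiom (Fn x t) (Fn x' (subst (Var(x := Var x')) t))"
| ax_alpha_let: "x \<noteq> y \<Longrightarrow> x' \<noteq> y' \<Longrightarrow> {x', y'} \<inter> (fv t - {x, y}) = {}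
    \<Longrightarrow> eq_axiom (LetTup x y s t) (LetTup x' y' s (subst (Var(x := Var x', y := Var y')) t))"
| ax_beta_fn: "eq_axiom (App (Fn x t) s) (subst (Var(x := s)) t)"
| ax_beta_let: "x \<noteq> y \<Longrightarrow> eq_axiom (LetTup x y (Tup u v) w) (subst (Var(x := u, y := v)) w)"
| ax_eta_fn: "x \<notin> fv t \<Longrightarrow> eq_axiom (Fn x (App t (Var x))) t"
| ax_eta_let: "x \<noteq> y \<Longrightarrow> eq_axiom (LetTup x y t (Tup (Var x) (Var y))) t"
| ax_comm: "{x, y} \<inter> fv_ctx C = {} \<Longrightarrow> binders C \<inter> fv t = {}
    \<Longrightarrow> eq_axiom (plug C (LetTup x y t u)) (LetTup x y t (plug C u))"

inductive eq_bec :: "ctx \<Rightarrow> trm \<Rightarrow> trm \<Rightarrow> ty \<Rightarrow> bool"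
  ("_ \<turnstile> _ \<simeq> _ \<Colon> _" [51, 51, 51, 51] 50) where
  eq_ax: "\<Gamma> \<turnstile> t \<Colon> A \<Longrightarrow> \<Gamma> \<turnstile> t' \<Colon> A \<Longrightarrow> eq_axiom t t' \<Longrightarrow> \<Gamma> \<turnstile> t \<simeq> t' \<Colon> A"
| eq_refl: "\<Gamma> \<turnstile> t \<Colon> A \<Longrightarrow> \<Gamma> \<turnstile> t \<simeq> t \<Colon> A"
| eq_sym: "\<Gamma> \<turnstile> t \<simeq> t' \<Colon> A \<Longrightarrow> \<Gamma> \<turnstile> t' \<simeq> t \<Colon> A"
| eq_trans: "\<Gamma> \<turnstile> t \<simeq> t' \<Colon> A \<Longrightarrow> \<Gamma> \<turnstile> t' \<simeq> t'' \<Colon> A \<Longrightarrow> \<Gamma> \<turnstile> t \<simeq> t'' \<Colon> A"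
| eq_exch: "\<Gamma> @ (x, A) # (y, B) # \<Delta> \<turnstile> t \<simeq> t' \<Colon> C \<Longrightarrow> \<Gamma> @ (y, B) # (x, A) # \<Delta> \<turnstile> t \<simeq> t' \<Colon> C"
| eq_fn: "(x, A) # \<Gamma> \<turnstile> t \<simeq> t' \<Colon> B \<Longrightarrow> \<Gamma> \<turnstile> Fn x t \<simeq> Fn x t' \<Colon> A \<multimap> B"
| eq_app: "\<Gamma> \<turnstile> t \<simeq> t' \<Colon> A \<multimap> B \<Longrightarrow> \<Delta> \<turnstile> s \<simeq> s' \<Colon> A \<Longrightarrow> vars_of \<Gamma> \<inter> vars_of \<Delta> = {}
    \<Longrightarrow> \<Gamma> @ \<Delta> \<turnstile> App t s \<simeq> App t' s' \<Colon> B"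
| eq_tup: "\<Gamma> \<turnstile> s \<simeq> s' \<Colon> A \<Longrightarrow> \<Delta> \<turnstile> t \<simeq> t' \<Colon> B \<Longrightarrow> vars_of \<Gamma> \<inter> vars_of \<Delta> = {}
    \<Longrightarrow> \<Gamma> @ \<Delta> \<turnstile> Tup s t \<simeq> Tup s' t' \<Colon> A \<otimes> B"
| eq_let: "\<Gamma> \<turnstile> s \<simeq> s' \<Colon> A \<otimes> B \<Longrightarrow> (x, A) # (y, B) # \<Delta> \<turnstile> t \<simeq> t' \<Colon> C
    \<Longrightarrow> vars_of \<Gamma> \<inter> vars_of \<Delta> = {} \<Longrightarrow> \<Gamma> @ \<Delta> \<turnstile> LetTup x y s t \<simeq> LetTup x y s' t' \<Colon> C"

lemma eq_bec_typed: "\<Gamma> \<turnstile> t \<simeq> t' \<Colon> A \<Longrightarrow> \<Gamma> \<turnstile> t \<Colon> A \<and> \<Gamma> \<turnstile> t' \<Colon> A"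
  by (induction rule: eq_bec.induct) (auto intro: typing.intros)


subsection \<open>Principal types and poly-typability\<close>

primrec tsubst :: "(tyvar \<Rightarrow> ty) \<Rightarrow> ty \<Rightarrow> ty" where
  "tsubst \<theta> (TVar a) = \<theta> a"
| "tsubst \<theta> (A \<otimes> B) = tsubst \<theta> A \<otimes> tsubst \<theta> B"
| "tsubst \<theta> (A \<multimap> B) = tsubst \<theta> A \<multimap> tsubst \<theta> B"

definition principal_type :: "trm \<Rightarrow> ty \<Rightarrow> bool" where
  "principal_type t P \<longleftrightarrow>
    (\<exists>\<Gamma>. \<Gamma> \<turnstile> t \<Colon> P) \<and> (\<forall>\<Gamma>' A'. \<Gamma>' \<turnstile> t \<Colon> A' \<longrightarrow> (\<exists>\<theta>. A' = tsubst \<theta> P))"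

definition lollis :: "ty list \<Rightarrow> ty \<Rightarrow> ty" where
  "lollis As B = foldr (\<multimap>) As B"

text \<open>
  \<open>poly_typable t As B ss\<close>: \<open>t\<close> is poly-typable by \<open>A1 \<multimap> \<dots> \<multimap> An \<multimap> B\<close> with respect to \<open>ss\<close>. A
  principal type is determined only up to renaming of type variables, and one substitution acts on
  the principal types of \<open>t\<close> and of all \<open>ss\<close>; the representatives are therefore quantified
  existentially, so that their type variables can be taken apart. (With fixed representatives
  sharing variables, the identity would not be applicable to itself.)
\<close>

definition poly_typable :: "trm \<Rightarrow> ty list \<Rightarrow> ty \<Rightarrow> trm list \<Rightarrow> bool" where
  "poly_typable t As B ss \<longleftrightarrow>
    (\<exists>As' B'. length As' = length As \<and> [] \<turnstile> t \<Colon> lollis As' B') \<and>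
    list_all2 (\<lambda>s A. [] \<turnstile> s \<Colon> A) ss As \<and>
    (\<exists>P Ps \<theta>. principal_type t P \<and> list_all2 principal_type ss Ps \<and>
       tsubst \<theta> P = lollis (map (tsubst \<theta>) Ps) B)"

end

theory Submission
  imports Defs "HOL-Library.Countable" "HOL-Library.Multiset"
begin

text \<open>
  Linear beta-reduction satisfies subject expansion, so typing \<open>t s1 : B\<close> and \<open>t s2 : B\<close>, possibly
  with different types of \<open>t\<close>, reduces to untyped computations that end in \<open>u1\<close> and \<open>u2\<close>; poly-typability
  then only needs the existence of principal types, which follows from the closure of typability
  under anti-unification.

  Give the atoms of \<open>A\<close> pairwise distinct labels. A cut-free proof of \<open>A\<close> links its negative and
  positive atoms, and the links determine the term up to the equality (coherence), so that \<open>s1\<close> and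
  \<open>s2\<close> have different links. Interpreting every atom as a type of functions \<open>D \<multimap> D\<close> and marking the
  atom labelled \<open>i\<close> with a function \<open>c i\<close>, a closed term \<open>s\<close> is fed with generic arguments and the
  results are composed; this yields a composition of all \<open>c i\<close>, each used once, in which linked labels
  are adjacent. Different links thus give different permutations of the labels, and some \<open>i\<close>, \<open>j\<close> occur in
  opposite orders. Let \<open>c i\<close> and \<open>c j\<close> be \<open>fn z => z u1\<close> and \<open>fn z => z u2\<close>, and all other marks the
  identity. Applied to \<open>k\<close>, the composition becomes \<open>k u2 u1\<close> for \<open>s1\<close> and \<open>k u1 u2\<close> for \<open>s2\<close>. The same test
  for \<open>B\<close> with all marks equal to the identity turns any closed term of type \<open>B\<close> into the identity, so
  \<open>k\<close> can erase its first argument and return the second.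
\<close>

subsection \<open>Substitution, linearity and typing\<close>

text \<open>\<open>\<preceq>\<close> is directed because of eta: an expanded term has only some of
  the types of the original, so \<open>s \<preceq> t\<close> asks for a typed equation at the types
  of \<open>t\<close> alone. That is enough, since every computation ends in a term whose type is
  known, and the type then travels back to its start. Normalization and coherence are carried out
  for sequent proofs, because commuting conversions become permutations of left rules there. Two of
  the rules branch, and a second proof with the same links could a priori divide the free variables
  between the premises in another way. Hence the labels are cut into two sets that no link crosses,
  and connectedness of each premise forces the division. Distinct labels are what makes such a cut
  available. A closed term of type \<open>A\<close> is normalized with the type variables of
  \<open>A\<close> as labels. Only the resulting proof is read over distinct labels, where axioms
  join different labels; the terms have a common type again after the labels are identified by the
  map \<open>r\<close> that recovers \<open>A\<close>.\<close>

lemma finite_fv [simp]: "finite (fv t)"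
  by (induction t) auto

lemma fresh_notin: "finite X \<Longrightarrow> fresh X \<notin> X"
  unfolding fresh_def by (rule LeastI_ex) (rule ex_new_if_finite[OF infinite_UNIV_nat])

lemma fv_subst [simp]: "fv (subst \<sigma> t) = (\<Union>v\<in>fv t. fv (\<sigma> v))"
proof (induction t arbitrary: \<sigma>)
  case (Fn x t)
  define z where "z = fresh (\<Union>v\<in>fv t - {x}. fv (\<sigma> v))"
  have "z \<notin> (\<Union>v\<in>fv t - {x}. fv (\<sigma> v))"
    unfolding z_def by (rule fresh_notin) auto
  then show ?case using Fn by (auto simp: z_def[symmetric] split: if_splits)
next
  case (LetTup x y s t)
  let ?X = "\<Union>v\<in>fv t - {x, y}. fv (\<sigma> v)"
  define z where "z = fresh ?X"
  define w where "w = fresh (insert z ?X)"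
  have z: "z \<notin> ?X" unfolding z_def by (rule fresh_notin) auto
  have w: "w \<notin> insert z ?X" unfolding w_def by (rule fresh_notin) auto
  show ?case using LetTup z w by (auto simp: Let_def z_def[symmetric] w_def[symmetric] split: if_splits)
qed auto

text \<open>An equation of raw terms, not merely up to renaming: the binder chosen by
  \<open>subst\<close> depends only on the set of free variables of the images, and that set is the
  same for \<open>\<sigma>\<close> and \<open>\<tau>\<close>.\<close>

lemma subst_cong: "(\<And>v. v \<in> fv t \<Longrightarrow> \<sigma> v = \<tau> v) \<Longrightarrow> subst \<sigma> t = subst \<tau> t"
proof (induction t arbitrary: \<sigma> \<tau>)
  case (Fn x t)
  have X: "(\<Union>v\<in>fv t - {x}. fv (\<sigma> v)) = (\<Union>v\<in>fv t - {x}. fv (\<tau> v))"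
    using Fn.prems by auto
  show ?case using Fn.prems by (auto simp: X Let_def intro!: Fn.IH)
next
  case (LetTup x y s t)
  have X: "(\<Union>v\<in>fv t - {x, y}. fv (\<sigma> v)) = (\<Union>v\<in>fv t - {x, y}. fv (\<tau> v))"
    using LetTup.prems by auto
  show ?case using LetTup.prems by (auto simp: X Let_def intro!: LetTup.IH)
next
  case (App t s)
  then show ?case by (metis UnI1 UnI2 fv.simps(2) subst.simps(2))
next
  case (Tup t s)
  then show ?case by (metis UnI1 UnI2 fv.simps(4) subst.simps(4))
qed auto

declare subst.simps(3,5) [simp del]

text \<open>Packages the binder clause so that \<open>fresh\<close> stays folded. Most uses need
  only that \<open>z\<close> avoids the images; its exact value matters when two substitutions must
  choose the same binder.\<close>

lemma subst_fn_obtain: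
  obtains z where "z \<notin> (\<Union>v\<in>fv t - {x}. fv (\<sigma> v))"
    and "z = fresh (\<Union>v\<in>fv t - {x}. fv (\<sigma> v))"
    and "subst \<sigma> (Fn x t) = Fn z (subst (\<sigma>(x := Var z)) t)"
proof -
  have "fresh (\<Union>v\<in>fv t - {x}. fv (\<sigma> v)) \<notin> (\<Union>v\<in>fv t - {x}. fv (\<sigma> v))"
    by (rule fresh_notin) auto
  then show thesis by (rule that) (auto simp: subst.simps Let_def)
qed

lemma subst_let_obtain:
  obtains z w where "z \<notin> (\<Union>v\<in>fv t - {x, y}. fv (\<sigma> v))" and "w \<notin> (\<Union>v\<in>fv t - {x, y}. fv (\<sigma> v))"
    and "z \<noteq> w" and "z = fresh (\<Union>v\<in>fv t - {x, y}. fv (\<sigma> v))"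
    and "w = fresh (insert z (\<Union>v\<in>fv t - {x, y}. fv (\<sigma> v)))"
    and "subst \<sigma> (LetTup x y s t) = LetTup z w (subst \<sigma> s) (subst (\<sigma>(x := Var z, y := Var w)) t)"
proof -
  let ?X = "\<Union>v\<in>fv t - {x, y}. fv (\<sigma> v)"
  have "fresh ?X \<notin> ?X" by (rule fresh_notin) auto
  moreover have "fresh (insert (fresh ?X) ?X) \<notin> insert (fresh ?X) ?X" by (rule fresh_notin) auto
  ultimately show thesis by (intro that[of "fresh ?X" "fresh (insert (fresh ?X) ?X)"]) (auto simp: subst.simps Let_def)
qed

text \<open>Holds on the nose because every substitution renames every binder: the choice of the
  inner one is forgotten, and the choice of the outer one depends on a set that composition leaves
  unchanged.\<close>

lemma subst_subst: "subst \<tau> (subst \<sigma> t) = subst (\<lambda>v. subst \<tau> (\<sigma> v)) t"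
proof (induction t arbitrary: \<sigma> \<tau>)
  case (Fn x t)
  obtain z where z: "z \<notin> (\<Union>v\<in>fv t - {x}. fv (\<sigma> v))"
    "subst \<sigma> (Fn x t) = Fn z (subst (\<sigma>(x := Var z)) t)"
    by (rule subst_fn_obtain)
  let ?t = "subst (\<sigma>(x := Var z)) t"
  have "fv ?t - {z} = (\<Union>v\<in>fv t - {x}. fv (\<sigma> v))"
    using z by (auto split: if_splits)
  \<comment> \<open>Both sides therefore pick the same final binder \<open>z'\<close>.\<close>
  then have X: "(\<Union>v\<in>fv ?t - {z}. fv (\<tau> v)) = (\<Union>v\<in>fv t - {x}. fv (subst \<tau> (\<sigma> v)))"
    by auto
  define z' where "z' = fresh (\<Union>v\<in>fv t - {x}. fv (subst \<tau> (\<sigma> v)))"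
  have "subst \<tau> (Fn z ?t) = Fn z' (subst (\<tau>(z := Var z')) ?t)"
    by (simp only: subst.simps X z'_def Let_def)
  also have "subst (\<tau>(z := Var z')) ?t = subst ((\<lambda>v. subst \<tau> (\<sigma> v))(x := Var z')) t"
    unfolding Fn.IH by (rule subst_cong) (use z in \<open>auto intro!: subst_cong\<close>)
  also have "Fn z' \<dots> = subst (\<lambda>v. subst \<tau> (\<sigma> v)) (Fn x t)"
    by (simp only: subst.simps z'_def Let_def)
  finally show ?case unfolding z(2) .
next
  case (LetTup x y s t)
  obtain z w where z: "z \<notin> (\<Union>v\<in>fv t - {x, y}. fv (\<sigma> v))" "w \<notin> (\<Union>v\<in>fv t - {x, y}. fv (\<sigma> v))" "z \<noteq> w"
    "subst \<sigma> (LetTup x y s t) = LetTup z w (subst \<sigma> s) (subst (\<sigma>(x := Var z, y := Var w)) t)"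
    by (rule subst_let_obtain)
  let ?t = "subst (\<sigma>(x := Var z, y := Var w)) t"
  have "fv ?t - {z, w} = (\<Union>v\<in>fv t - {x, y}. fv (\<sigma> v))"
    using z by (auto split: if_splits)
  then have X: "(\<Union>v\<in>fv ?t - {z, w}. fv (\<tau> v)) = (\<Union>v\<in>fv t - {x, y}. fv (subst \<tau> (\<sigma> v)))"
    by auto
  define z' where "z' = fresh (\<Union>v\<in>fv t - {x, y}. fv (subst \<tau> (\<sigma> v)))"
  define w' where "w' = fresh (insert z' (\<Union>v\<in>fv t - {x, y}. fv (subst \<tau> (\<sigma> v))))"
  have "subst \<tau> (LetTup z w (subst \<sigma> s) ?t)
      = LetTup z' w' (subst \<tau> (subst \<sigma> s)) (subst (\<tau>(z := Var z', w := Var w')) ?t)"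
    by (simp only: subst.simps X z'_def w'_def Let_def)
  also have "subst (\<tau>(z := Var z', w := Var w')) ?t
      = subst ((\<lambda>v. subst \<tau> (\<sigma> v))(x := Var z', y := Var w')) t"
    unfolding LetTup.IH by (rule subst_cong) (use z in \<open>auto intro!: subst_cong\<close>)
  also have "LetTup z' w' (subst \<tau> (subst \<sigma> s)) \<dots> = subst (\<lambda>v. subst \<tau> (\<sigma> v)) (LetTup x y s t)"
    by (simp only: subst.simps z'_def w'_def Let_def LetTup.IH)
  finally show ?case unfolding z(4) .
qed auto

section \<open>Linear raw terms and typing by environments\<close>

primrec lin :: "trm \<Rightarrow> bool" where
  "lin (Var x) = True"
| "lin (App t s) = (lin t \<and> lin s \<and> fv t \<inter> fv s = {})"
| "lin (Fn x t) = (lin t \<and> x \<in> fv t)"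
| "lin (Tup s t) = (lin s \<and> lin t \<and> fv s \<inter> fv t = {})"
| "lin (LetTup x y s t) = (lin s \<and> lin t \<and> x \<in> fv t \<and> y \<in> fv t \<and> x \<noteq> y \<and> fv s \<inter> (fv t - {x, y}) = {})"

text \<open>Typing with linearity split off: environments replace contexts, so that exchange and the
  division of contexts become invisible. Together with \<open>lin\<close> it recovers the given
  judgement, see \<open>typing_styp\<close> and \<open>styp_typing\<close>.\<close>

primrec styp :: "(var \<Rightarrow> ty) \<Rightarrow> trm \<Rightarrow> ty \<Rightarrow> bool" where
  "styp e (Var x) A = (e x = A)"
| "styp e (App t s) B = (\<exists>A. styp e t (A \<multimap> B) \<and> styp e s A)"
| "styp e (Fn x t) C = (\<exists>A B. C = A \<multimap> B \<and> styp (e(x := A)) t B)"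
| "styp e (Tup s t) C = (\<exists>A B. C = A \<otimes> B \<and> styp e s A \<and> styp e t B)"
| "styp e (LetTup x y s t) C = (\<exists>A B. styp e s (A \<otimes> B) \<and> styp (e(x := A, y := B)) t C)"

lemma styp_cong: "(\<And>v. v \<in> fv t \<Longrightarrow> e v = e' v) \<Longrightarrow> styp e t A = styp e' t A"
proof (induction t arbitrary: e e' A)
  case (App t s)
  have "styp e t B = styp e' t B" for B by (rule App.IH) (use App.prems in auto)
  moreover have "styp e s B = styp e' s B" for B by (rule App.IH) (use App.prems in auto)
  ultimately show ?case by simp
next
  case (Tup t s)
  have "styp e t B = styp e' t B" for B by (rule Tup.IH) (use Tup.prems in auto)
  moreover have "styp e s B = styp e' s B" for B by (rule Tup.IH) (use Tup.prems in auto)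
  ultimately show ?case by simp
next
  case (Fn x t)
  have "styp (e(x := C)) t B = styp (e'(x := C)) t B" for B C
    using Fn.prems by (intro Fn.IH) auto
  then show ?case by simp
next
  case (LetTup x y s t)
  have "styp e s B = styp e' s B" "styp (e(x := C, y := D)) t B = styp (e'(x := C, y := D)) t B" for B C D
    using LetTup.prems by (auto intro!: LetTup.IH)
  then show ?case by simp
qed auto

lemma styp_upd [simp]: "x \<notin> fv t \<Longrightarrow> styp (e(x := A)) t B = styp e t B"
  by (rule styp_cong) auto

text \<open>The condition under which substitution into a linear term stays linear, see
  \<open>lin_subst\<close>.\<close>

definition disjoint_lin :: "var set \<Rightarrow> (var \<Rightarrow> trm) \<Rightarrow> bool" where
  "disjoint_lin X \<sigma> \<longleftrightarrow> (\<forall>v\<in>X. lin (\<sigma> v)) \<and> (\<forall>v\<in>X. \<forall>w\<in>X. v \<noteq> w \<longrightarrow> fv (\<sigma> v) \<inter> fv (\<sigma> w) = {})"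

lemma disjoint_lin_subset: "disjoint_lin X \<sigma> \<Longrightarrow> Y \<subseteq> X \<Longrightarrow> disjoint_lin Y \<sigma>"
  unfolding disjoint_lin_def by blast

lemma disjoint_lin_disjoint: "disjoint_lin X \<sigma> \<Longrightarrow> Y \<subseteq> X \<Longrightarrow> Z \<subseteq> X \<Longrightarrow> Y \<inter> Z = {}
    \<Longrightarrow> (\<Union>v\<in>Y. fv (\<sigma> v)) \<inter> (\<Union>v\<in>Z. fv (\<sigma> v)) = {}"
  unfolding disjoint_lin_def by (auto; metis disjoint_iff subsetD)

lemma disjoint_lin_upd: "disjoint_lin (X - {x}) \<sigma> \<Longrightarrow> lin u \<Longrightarrow> fv u \<inter> (\<Union>v\<in>X - {x}. fv (\<sigma> v)) = {} \<Longrightarrow> disjoint_lin X (\<sigma>(x := u))"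
  unfolding disjoint_lin_def by (auto; blast)

lemma disjoint_lin_upd2: "disjoint_lin (X - {x, y}) \<sigma> \<Longrightarrow> lin u \<Longrightarrow> lin v \<Longrightarrow> fv u \<inter> (\<Union>v\<in>X - {x, y}. fv (\<sigma> v)) = {}
   \<Longrightarrow> fv v \<inter> (\<Union>v\<in>X - {x, y}. fv (\<sigma> v)) = {} \<Longrightarrow> fv u \<inter> fv v = {} \<Longrightarrow> disjoint_lin X (\<sigma>(x := u, y := v))"
  unfolding disjoint_lin_def by (auto; blast)

lemma disjoint_lin_Var [simp]: "disjoint_lin X Var"
  unfolding disjoint_lin_def by auto

lemma lin_subst: "lin t \<Longrightarrow> disjoint_lin (fv t) \<sigma> \<Longrightarrow> lin (subst \<sigma> t)"
proof (induction t arbitrary: \<sigma>)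
  case (Var x)
  then show ?case by (auto simp: disjoint_lin_def)
next
  case (App t s)
  then have "lin (subst \<sigma> t)" "lin (subst \<sigma> s)" by (auto intro: disjoint_lin_subset)
  moreover have "(\<Union>v\<in>fv t. fv (\<sigma> v)) \<inter> (\<Union>v\<in>fv s. fv (\<sigma> v)) = {}"
    using App.prems by (intro disjoint_lin_disjoint) auto
  ultimately show ?case by simp
next
  case (Tup t s)
  then have "lin (subst \<sigma> t)" "lin (subst \<sigma> s)" by (auto intro: disjoint_lin_subset)
  moreover have "(\<Union>v\<in>fv t. fv (\<sigma> v)) \<inter> (\<Union>v\<in>fv s. fv (\<sigma> v)) = {}"
    using Tup.prems by (intro disjoint_lin_disjoint) auto
  ultimately show ?case by simp
next
  case (Fn x t)
  obtain z where z: "z \<notin> (\<Union>v\<in>fv t - {x}. fv (\<sigma> v))"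
    "subst \<sigma> (Fn x t) = Fn z (subst (\<sigma>(x := Var z)) t)"
    by (rule subst_fn_obtain)
  have "lin (subst (\<sigma>(x := Var z)) t)"
    using Fn.prems z by (intro Fn.IH disjoint_lin_upd) auto
  then show ?case using z Fn.prems by auto
next
  case (LetTup x y s t)
  obtain z w where z: "z \<notin> (\<Union>v\<in>fv t - {x, y}. fv (\<sigma> v))" "w \<notin> (\<Union>v\<in>fv t - {x, y}. fv (\<sigma> v))" "z \<noteq> w"
    "subst \<sigma> (LetTup x y s t) = LetTup z w (subst \<sigma> s) (subst (\<sigma>(x := Var z, y := Var w)) t)"
    by (rule subst_let_obtain)
  have disjoint_lin: "disjoint_lin (fv t - {x, y}) \<sigma>" "disjoint_lin (fv s) \<sigma>"
    using LetTup.prems by (auto intro: disjoint_lin_subset)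
  have l: "lin (subst \<sigma> s)" "lin (subst (\<sigma>(x := Var z, y := Var w)) t)"
    using LetTup.prems disjoint_lin z by (auto intro!: LetTup.IH disjoint_lin_upd2)
  have "(\<Union>v\<in>fv s. fv (\<sigma> v)) \<inter> (\<Union>v\<in>fv t - {x, y}. fv (\<sigma> v)) = {}"
    using LetTup.prems by (intro disjoint_lin_disjoint[of "fv s \<union> (fv t - {x, y})"]) auto
  moreover have "fv (subst (\<sigma>(x := Var z, y := Var w)) t) - {z, w} = (\<Union>v\<in>fv t - {x, y}. fv (\<sigma> v))"
    using z by (auto split: if_splits)
  moreover have "z \<in> fv (subst (\<sigma>(x := Var z, y := Var w)) t)" "w \<in> fv (subst (\<sigma>(x := Var z, y := Var w)) t)"
    using LetTup.prems by (auto intro: bexI[of _ x] bexI[of _ y])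
  ultimately show ?case unfolding z(4) using l z(3) by simp
qed

text \<open>The direction from left to right is subject expansion; it needs linearity, as a variable
  that occurs twice could be replaced at two different types.\<close>

lemma styp_subst:
  "lin t \<Longrightarrow> styp e (subst \<sigma> t) A \<longleftrightarrow> (\<exists>e'. styp e' t A \<and> (\<forall>v\<in>fv t. styp e (\<sigma> v) (e' v)))"
proof (induction t arbitrary: e \<sigma> A)
  case (Var x)
  then show ?case by (auto intro: exI[of _ "\<lambda>_. A"])
next
  case (App t s)
  show ?case (is "?l = ?r")
  proof
    assume ?l
    then obtain B e1 e2 where *: "styp e1 t (B \<multimap> A)" "\<forall>v\<in>fv t. styp e (\<sigma> v) (e1 v)"
       "styp e2 s B" "\<forall>v\<in>fv s. styp e (\<sigma> v) (e2 v)"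
      using App by auto
    \<comment> \<open>The two induction hypotheses return unrelated environments. They can be glued
      because linearity makes the free variables of \<open>t\<close> and \<open>s\<close>
      disjoint.\<close>
    let ?e = "\<lambda>v. if v \<in> fv t then e1 v else e2 v"
    have "styp ?e t (B \<multimap> A)" using *(1) by (subst styp_cong[of _ _ e1]) auto
    moreover have "styp ?e s B" using *(3) App.prems by (subst styp_cong[of _ _ e2]) auto
    ultimately show ?r using * by (intro exI[of _ ?e]) auto
  next
    assume ?r
    then obtain B e' where *: "styp e' t (B \<multimap> A)" "styp e' s B" "\<forall>v\<in>fv t \<union> fv s. styp e (\<sigma> v) (e' v)"
      by auto
    then have "styp e (subst \<sigma> t) (B \<multimap> A)" "styp e (subst \<sigma> s) B" using App by auto
    then show ?l by auto
  qed
next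
  case (Tup t s)
  show ?case (is "?l = ?r")
  proof
    assume ?l
    then obtain B C e1 e2 where *: "A = B \<otimes> C" "styp e1 t B" "\<forall>v\<in>fv t. styp e (\<sigma> v) (e1 v)"
       "styp e2 s C" "\<forall>v\<in>fv s. styp e (\<sigma> v) (e2 v)"
      using Tup by auto
    let ?e = "\<lambda>v. if v \<in> fv t then e1 v else e2 v"
    have "styp ?e t B" using * by (subst styp_cong[of _ _ e1]) auto
    moreover have "styp ?e s C" using * Tup.prems by (subst styp_cong[of _ _ e2]) auto
    ultimately show ?r using * by (intro exI[of _ ?e]) auto
  next
    assume ?r
    then obtain B C e' where *: "A = B \<otimes> C" "styp e' t B" "styp e' s C" "\<forall>v\<in>fv t \<union> fv s. styp e (\<sigma> v) (e' v)"
      by auto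
    then have "styp e (subst \<sigma> t) B" "styp e (subst \<sigma> s) C" using Tup by auto
    then show ?l using * by auto
  qed
next
  case (Fn x t)
  obtain z where z: "z \<notin> (\<Union>v\<in>fv t - {x}. fv (\<sigma> v))"
    "subst \<sigma> (Fn x t) = Fn z (subst (\<sigma>(x := Var z)) t)"
    by (rule subst_fn_obtain)
  have IH: "styp (e(z := B)) (subst (\<sigma>(x := Var z)) t) C \<longleftrightarrow>
     (\<exists>e'. styp e' t C \<and> (\<forall>v\<in>fv t. styp (e(z := B)) ((\<sigma>(x := Var z)) v) (e' v)))" for B C
    using Fn by auto
  \<comment> \<open>\<open>x\<close> is mapped to \<open>Var z\<close>, whose type in the updated
    environment is \<open>B\<close>; the other images avoid \<open>z\<close>.\<close>
  have 1: "(\<forall>v\<in>fv t. styp (e(z := B)) ((\<sigma>(x := Var z)) v) (e' v)) \<longleftrightarrow>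
     e' x = B \<and> (\<forall>v\<in>fv t - {x}. styp e (\<sigma> v) (e' v))" for e' B
    using z Fn.prems by auto
  have "styp e (subst \<sigma> (Fn x t)) A \<longleftrightarrow>
     (\<exists>B C e'. A = B \<multimap> C \<and> styp e' t C \<and> e' x = B \<and> (\<forall>v\<in>fv t - {x}. styp e (\<sigma> v) (e' v)))"
    unfolding z(2) styp.simps IH 1 by auto
  also have "\<dots> \<longleftrightarrow> (\<exists>e'. styp e' (Fn x t) A \<and> (\<forall>v\<in>fv t - {x}. styp e (\<sigma> v) (e' v)))" (is "?l = ?r")
  proof
    assume ?l
    then obtain B C e' where *: "A = B \<multimap> C" "styp e' t C" "e' x = B" "\<forall>v\<in>fv t - {x}. styp e (\<sigma> v) (e' v)" by blast
    then have "styp e' (Fn x t) A" by (auto simp: fun_upd_idem)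
    then show ?r using * by blast
  next
    assume ?r
    then obtain e' B C where *: "A = B \<multimap> C" "styp (e'(x := B)) t C" "\<forall>v\<in>fv t - {x}. styp e (\<sigma> v) (e' v)" by auto
    then show ?l by (intro exI[of _ B] exI[of _ C] exI[of _ "e'(x := B)"]) auto
  qed
  finally show ?case by simp
next
  case (LetTup x y s t)
  obtain z w where z: "z \<notin> (\<Union>v\<in>fv t - {x, y}. fv (\<sigma> v))" "w \<notin> (\<Union>v\<in>fv t - {x, y}. fv (\<sigma> v))" "z \<noteq> w"
    "subst \<sigma> (LetTup x y s t) = LetTup z w (subst \<sigma> s) (subst (\<sigma>(x := Var z, y := Var w)) t)"
    by (rule subst_let_obtain)
  have IH: "styp (e(z := B, w := C)) (subst (\<sigma>(x := Var z, y := Var w)) t) A \<longleftrightarrow>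
     (\<exists>e'. styp e' t A \<and> (\<forall>v\<in>fv t. styp (e(z := B, w := C)) ((\<sigma>(x := Var z, y := Var w)) v) (e' v)))"
     "styp e (subst \<sigma> s) B = (\<exists>e'. styp e' s B \<and> (\<forall>v\<in>fv s. styp e (\<sigma> v) (e' v)))" for B C
    using LetTup by auto
  have 1: "(\<forall>v\<in>fv t. styp (e(z := B, w := C)) ((\<sigma>(x := Var z, y := Var w)) v) (e' v)) \<longleftrightarrow>
     e' x = B \<and> e' y = C \<and> (\<forall>v\<in>fv t - {x, y}. styp e (\<sigma> v) (e' v))" for e' B C
    using z LetTup.prems by auto
  show ?case (is "?l = ?r")
  proof
    assume ?l
    then obtain B C e1 e2 where *: "styp e1 s (B \<otimes> C)" "\<forall>v\<in>fv s. styp e (\<sigma> v) (e1 v)"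
       "styp e2 t A" "e2 x = B" "e2 y = C" "\<forall>v\<in>fv t - {x, y}. styp e (\<sigma> v) (e2 v)"
      unfolding z(4) styp.simps IH 1 by auto
    let ?e = "\<lambda>v. if v \<in> fv s then e1 v else e2 v"
    have "styp ?e s (B \<otimes> C)" using *(1) by (subst styp_cong[of _ _ e1]) auto
    moreover have "styp (?e(x := B, y := C)) t A"
      using *(3,4,5) LetTup.prems by (subst styp_cong[of _ _ e2]) auto
    ultimately show ?r using * by (intro exI[of _ ?e]) auto
  next
    assume ?r
    then obtain e' B C where *: "styp e' s (B \<otimes> C)" "styp (e'(x := B, y := C)) t A"
      "\<forall>v\<in>fv s \<union> (fv t - {x, y}). styp e (\<sigma> v) (e' v)" by auto
    show ?l unfolding z(4) styp.simps IH 1 using LetTup.prems *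
      by (intro exI[of _ B] exI[of _ C] conjI exI[of _ e'] exI[of _ "e'(x := B, y := C)"]) auto
  qed
qed

subsection \<open>Typing and equality in terms of environments\<close>

text \<open>Adjacent swaps generate all permutations: \<open>front\<close> carries an element to the
  front below a fixed prefix. An arbitrary predicate is used so that typing and equality share the
  argument.\<close>

lemma swap_closed_perm:
  assumes swap: "\<And>xs a b ys. P (xs @ a # b # ys) \<Longrightarrow> P (xs @ b # a # ys)"
  shows "mset xs = mset ys \<Longrightarrow> P xs \<Longrightarrow> P ys"
proof -
  have front: "P (pre @ l @ y # r) \<Longrightarrow> P (pre @ y # l @ r)" for pre l y r
  proof (induction l arbitrary: r rule: rev_induct)
    case (snoc a l)
    have "P ((pre @ l) @ y # a # r)" by (rule swap) (use snoc.prems in simp)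
    then show ?case using snoc.IH[of "a # r"] by simp
  qed simp
  have "mset xs = mset ys \<Longrightarrow> P (pre @ xs) \<Longrightarrow> P (pre @ ys)" for pre
  proof (induction ys arbitrary: pre xs)
    case (Cons y ys)
    then have "y \<in> set xs" by (metis list.set_intros(1) set_mset_mset)
    then obtain l r where xs: "xs = l @ y # r" by (meson split_list)
    then have "mset (l @ r) = mset ys" using Cons.prems(1) by simp
    moreover have "P ((pre @ [y]) @ l @ r)" using front Cons.prems(2) xs by simp
    ultimately have "P ((pre @ [y]) @ ys)" by (rule Cons.IH)
    then show ?case by simp
  qed simp
  from this[of "[]"] show "mset xs = mset ys \<Longrightarrow> P xs \<Longrightarrow> P ys" by simp
qed

lemma typing_perm: "\<Gamma> \<turnstile> t \<Colon> A \<Longrightarrow> mset \<Gamma> = mset \<Delta> \<Longrightarrow> \<Delta> \<turnstile> t \<Colon> A"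
  by (rule swap_closed_perm[where P = "\<lambda>\<Gamma>. \<Gamma> \<turnstile> t \<Colon> A"]) (auto intro: ty_exch)

lemma eq_bec_perm: "\<Gamma> \<turnstile> t \<simeq> t' \<Colon> A \<Longrightarrow> mset \<Gamma> = mset \<Delta> \<Longrightarrow> \<Delta> \<turnstile> t \<simeq> t' \<Colon> A"
  by (rule swap_closed_perm[where P = "\<lambda>\<Gamma>. \<Gamma> \<turnstile> t \<simeq> t' \<Colon> A"]) (auto intro: eq_exch)

text \<open>Sorting makes the context a function of the environment and a set of variables;
  \<open>typing_perm\<close> and \<open>eq_bec_perm\<close> absorb every other order.\<close>

definition ctx_of :: "(var \<Rightarrow> ty) \<Rightarrow> var set \<Rightarrow> ctx" where
  "ctx_of e X = map (\<lambda>x. (x, e x)) (sorted_list_of_set X)"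

lemma mset_ctx_of: "mset (ctx_of e X) = image_mset (\<lambda>x. (x, e x)) (mset_set X)"
  by (simp add: ctx_of_def flip: sorted_list_of_mset_set)

lemma ctx_of_empty [simp]: "ctx_of e {} = []"
  by (simp add: ctx_of_def)

lemma vars_of_ctx_of [simp]: "finite X \<Longrightarrow> vars_of (ctx_of e X) = X"
  by (simp add: vars_of_def ctx_of_def image_image)

lemma ctx_of_cong: "(\<And>x. x \<in> X \<Longrightarrow> e x = e' x) \<Longrightarrow> ctx_of e X = ctx_of e' X"
  by (cases "finite X") (auto simp: ctx_of_def)

lemma mset_ctx_of_Un: "finite X \<Longrightarrow> finite Y \<Longrightarrow> X \<inter> Y = {} \<Longrightarrow> mset (ctx_of e X @ ctx_of e Y) = mset (ctx_of e (X \<union> Y))"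
  by (simp add: mset_ctx_of mset_set_Union)

lemma mset_ctx_of_remove:
  assumes "finite X" "x \<in> X"
  shows "mset (ctx_of (e(x := A)) X) = mset ((x, A) # ctx_of e (X - {x}))"
proof -
  have "mset_set X = add_mset x (mset_set (X - {x}))" using assms by (rule mset_set.remove)
  moreover have "ctx_of (e(x := A)) (X - {x}) = ctx_of e (X - {x})" by (rule ctx_of_cong) auto
  moreover have "mset (ctx_of (e(x := A)) X) = add_mset (x, A) (mset (ctx_of (e(x := A)) (X - {x})))"
    using calculation(1) by (simp add: mset_ctx_of)
  ultimately show ?thesis by simp
qed

lemma mset_ctx_of_remove2:
  assumes "finite X" "x \<in> X" "y \<in> X" "x \<noteq> y"
  shows "mset (ctx_of (e(x := A, y := B)) X) = mset ((x, A) # (y, B) # ctx_of e (X - {x, y}))"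
proof -
  have "mset (ctx_of (e(x := A, y := B)) X) = add_mset (y, B) (mset (ctx_of (e(x := A)) (X - {y})))"
    using assms mset_ctx_of_remove[of X y "e(x := A)" B] by simp
  also have "mset (ctx_of (e(x := A)) (X - {y})) = mset ((x, A) # ctx_of e (X - {y} - {x}))"
    using assms by (intro mset_ctx_of_remove) auto
  also have "X - {y} - {x} = X - {x, y}" by blast
  finally show ?thesis by (simp only: mset.simps add_mset_commute)
qed

lemma typing_lin: "\<Gamma> \<turnstile> t \<Colon> A \<Longrightarrow> lin t"
proof (induction rule: typing.induct)
  case (ty_fn x A \<Gamma> t B)
  then show ?case using typing_fv[OF ty_fn.hyps] by (auto simp: vars_of_def)
next
  case (ty_app \<Gamma> t A B \<Delta> s)
  then show ?case using typing_fv by simp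
next
  case (ty_tup \<Gamma> s A \<Delta> t B)
  then show ?case using typing_fv by simp
next
  case (ty_let \<Gamma> s A B x y \<Delta> t C)
  then show ?case using typing_fv[OF ty_let.hyps(1)] typing_fv[OF ty_let.hyps(2)]
      typing_distinct[OF ty_let.hyps(2)] by (auto simp: vars_of_def)
qed auto

lemma typing_styp: "\<Gamma> \<turnstile> t \<Colon> A \<Longrightarrow> (\<And>x B. (x, B) \<in> set \<Gamma> \<Longrightarrow> e x = B) \<Longrightarrow> styp e t A"
proof (induction arbitrary: e rule: typing.induct)
  case (ty_exch \<Gamma> x A y B \<Delta> t C)
  then show ?case by auto
next
  case (ty_fn x A \<Gamma> t B)
  have "styp (e(x := A)) t B"
    by (rule ty_fn.IH) (use ty_fn.prems typing_distinct[OF ty_fn.hyps] in \<open>force\<close>)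
  then show ?case by simp
next
  case (ty_app \<Gamma> t A B \<Delta> s)
  have "styp e t (A \<multimap> B)" "styp e s A" using ty_app by auto
  then show ?case by auto
next
  case (ty_let \<Gamma> s A B x y \<Delta> t C)
  have "styp e s (A \<otimes> B)" using ty_let by auto
  moreover have "styp (e(x := A, y := B)) t C"
    by (rule ty_let.IH) (use ty_let.prems typing_distinct[OF ty_let.hyps(2)] in \<open>force\<close>)
  ultimately show ?case by auto
qed auto

lemma styp_typing: "lin t \<Longrightarrow> styp e t A \<Longrightarrow> ctx_of e (fv t) \<turnstile> t \<Colon> A"
proof (induction t arbitrary: e A)
  case (Var x)
  then show ?case by (simp add: ctx_of_def ty_var)
next
  case (App t s)
  then obtain B where "styp e t (B \<multimap> A)" "styp e s B" by auto
  then have "ctx_of e (fv t) \<turnstile> t \<Colon> B \<multimap> A" "ctx_of e (fv s) \<turnstile> s \<Colon> B" using App by auto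
  then have "ctx_of e (fv t) @ ctx_of e (fv s) \<turnstile> App t s \<Colon> A"
    using App.prems by (intro ty_app) auto
  then show ?case by (rule typing_perm) (use App.prems in \<open>simp add: mset_ctx_of_Un del: mset_append\<close>)
next
  case (Tup t s)
  then obtain B C where A: "A = B \<otimes> C" "ctx_of e (fv t) \<turnstile> t \<Colon> B" "ctx_of e (fv s) \<turnstile> s \<Colon> C" by auto
  then have "ctx_of e (fv t) @ ctx_of e (fv s) \<turnstile> Tup t s \<Colon> A"
    using Tup.prems by (auto intro!: ty_tup)
  then show ?case by (rule typing_perm) (use Tup.prems in \<open>simp add: mset_ctx_of_Un del: mset_append\<close>)
next
  case (Fn x t)
  then obtain B C where A: "A = B \<multimap> C" "ctx_of (e(x := B)) (fv t) \<turnstile> t \<Colon> C" by auto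
  then have "(x, B) # ctx_of e (fv t - {x}) \<turnstile> t \<Colon> C"
    using Fn.prems by (elim typing_perm) (simp add: mset_ctx_of_remove)
  then show ?case using A by (simp add: ty_fn)
next
  case (LetTup x y s t)
  then obtain B C where "styp e s (B \<otimes> C)" "styp (e(x := B, y := C)) t A" by auto
  then have A: "ctx_of e (fv s) \<turnstile> s \<Colon> B \<otimes> C" "ctx_of (e(x := B, y := C)) (fv t) \<turnstile> t \<Colon> A"
    using LetTup by auto
  then have "(x, B) # (y, C) # ctx_of e (fv t - {x, y}) \<turnstile> t \<Colon> A"
    using LetTup.prems by (elim typing_perm) (simp add: mset_ctx_of_remove2)
  then have "ctx_of e (fv s) @ ctx_of e (fv t - {x, y}) \<turnstile> LetTup x y s t \<Colon> A"
    using LetTup.prems A by (intro ty_let) auto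
  then show ?case by (rule typing_perm) (use LetTup.prems in \<open>simp add: mset_ctx_of_Un del: mset_append\<close>)
qed

lemma typing_ctx_of_styp: "ctx_of e (fv t) \<turnstile> t \<Colon> A \<Longrightarrow> styp e t A"
  by (erule typing_styp) (auto simp: ctx_of_def)

section \<open>Equality relative to an environment, and refinement\<close>

definition eqv :: "(var \<Rightarrow> ty) \<Rightarrow> trm \<Rightarrow> trm \<Rightarrow> ty \<Rightarrow> bool" where
  "eqv e s t A \<longleftrightarrow> ctx_of e (fv s) \<turnstile> s \<simeq> t \<Colon> A"

text \<open>The context in \<open>eqv\<close> mentions only the left term, but linear typing uses
  exactly the declared variables, so it is the context of the right term as well.\<close>

lemma eqv_fv: "eqv e s t A \<Longrightarrow> fv s = fv t"
  unfolding eqv_def using eq_bec_typed typing_fv by metis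

lemma eqv_styp: "eqv e s t A \<Longrightarrow> styp e s A \<and> styp e t A"
  using eqv_fv[of e s t A] unfolding eqv_def by (metis eq_bec_typed typing_ctx_of_styp)

lemma eqv_refl: "lin t \<Longrightarrow> styp e t A \<Longrightarrow> eqv e t t A"
  unfolding eqv_def by (intro eq_refl styp_typing)

lemma eqv_sym: "eqv e s t A \<Longrightarrow> eqv e t s A"
  using eqv_fv[of e s t A] unfolding eqv_def by (simp add: eq_sym)

lemma eqv_trans: "eqv e s t A \<Longrightarrow> eqv e t u A \<Longrightarrow> eqv e s u A"
  using eqv_fv[of e s t A] unfolding eqv_def by (auto intro: eq_trans)

lemma eqv_ax: "eq_axiom s t \<Longrightarrow> lin s \<Longrightarrow> lin t \<Longrightarrow> fv s = fv t \<Longrightarrow> styp e s A \<Longrightarrow> styp e t A \<Longrightarrow> eqv e s t A"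
  unfolding eqv_def by (rule eq_ax) (auto intro: styp_typing, metis styp_typing)

lemma eqv_App:
  assumes "eqv e t t' (A \<multimap> B)" "eqv e s s' A" "fv t \<inter> fv s = {}"
  shows "eqv e (App t s) (App t' s') B"
proof -
  have "ctx_of e (fv t) @ ctx_of e (fv s) \<turnstile> App t s \<simeq> App t' s' \<Colon> B"
    using assms unfolding eqv_def by (intro eq_app) auto
  then show ?thesis
    unfolding eqv_def by (rule eq_bec_perm) (use assms in \<open>simp add: mset_ctx_of_Un del: mset_append\<close>)
qed

lemma eqv_Tup:
  assumes "eqv e t t' A" "eqv e s s' B" "fv t \<inter> fv s = {}"
  shows "eqv e (Tup t s) (Tup t' s') (A \<otimes> B)"
proof -
  have "ctx_of e (fv t) @ ctx_of e (fv s) \<turnstile> Tup t s \<simeq> Tup t' s' \<Colon> A \<otimes> B"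
    using assms unfolding eqv_def by (intro eq_tup) auto
  then show ?thesis
    unfolding eqv_def by (rule eq_bec_perm) (use assms in \<open>simp add: mset_ctx_of_Un del: mset_append\<close>)
qed

lemma eqv_Fn: "eqv (e(x := A)) t t' B \<Longrightarrow> x \<in> fv t \<Longrightarrow> eqv e (Fn x t) (Fn x t') (A \<multimap> B)"
  unfolding eqv_def fv.simps
  by (rule eq_fn, erule eq_bec_perm) (simp add: mset_ctx_of_remove)

lemma eqv_LetTup:
  assumes "eqv e s s' (A \<otimes> B)" "eqv (e(x := A, y := B)) t t' C" "lin (LetTup x y s t)"
  shows "eqv e (LetTup x y s t) (LetTup x y s' t') C"
proof -
  have "(x, A) # (y, B) # ctx_of e (fv t - {x, y}) \<turnstile> t \<simeq> t' \<Colon> C"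
    using assms(2) unfolding eqv_def by (rule eq_bec_perm) (use assms in \<open>simp add: mset_ctx_of_remove2\<close>)
  then have "ctx_of e (fv s) @ ctx_of e (fv t - {x, y}) \<turnstile> LetTup x y s t \<simeq> LetTup x y s' t' \<Colon> C"
    using assms unfolding eqv_def by (intro eq_let) auto
  then show ?thesis
    unfolding eqv_def by (rule eq_bec_perm) (use assms in \<open>simp add: mset_ctx_of_Un del: mset_append\<close>)
qed

text \<open>Linear beta and commuting conversions satisfy \<open>s \<preceq> t\<close> in both directions, eta-expansion only
  from left to right.\<close>

definition ref :: "trm \<Rightarrow> trm \<Rightarrow> bool"  (infix "\<preceq>" 50) where
  "s \<preceq> t \<longleftrightarrow> lin s \<and> lin t \<and> fv s = fv t \<and> (\<forall>e A. styp e t A \<longrightarrow> eqv e s t A)"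

definition conv :: "trm \<Rightarrow> trm \<Rightarrow> bool"  (infix "\<approx>" 50) where
  "s \<approx> t \<longleftrightarrow> s \<preceq> t \<and> t \<preceq> s"

lemma refD: "s \<preceq> t \<Longrightarrow> lin s" "s \<preceq> t \<Longrightarrow> lin t" "s \<preceq> t \<Longrightarrow> fv s = fv t"
  "s \<preceq> t \<Longrightarrow> styp e t A \<Longrightarrow> eqv e s t A" "s \<preceq> t \<Longrightarrow> styp e t A \<Longrightarrow> styp e s A"
  unfolding ref_def using eqv_styp by blast+

lemma ref_refl [simp]: "lin t \<Longrightarrow> t \<preceq> t"
  unfolding ref_def by (auto intro: eqv_refl)

lemma ref_trans [trans]: "s \<preceq> t \<Longrightarrow> t \<preceq> u \<Longrightarrow> s \<preceq> u"
  unfolding ref_def by (metis eqv_styp eqv_trans)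

lemma conv_sym: "s \<approx> t \<Longrightarrow> t \<approx> s"
  unfolding conv_def by auto

lemma convD: "s \<approx> t \<Longrightarrow> s \<preceq> t" "s \<approx> t \<Longrightarrow> t \<preceq> s"
  unfolding conv_def by auto

lemma conv_refl [simp]: "lin t \<Longrightarrow> t \<approx> t"
  unfolding conv_def by auto

lemma conv_trans [trans]: "s \<approx> t \<Longrightarrow> t \<approx> u \<Longrightarrow> s \<approx> u"
  unfolding conv_def by (auto intro: ref_trans)

lemma ref_conv_trans [trans]: "s \<preceq> t \<Longrightarrow> t \<approx> u \<Longrightarrow> s \<preceq> u" "s \<approx> t \<Longrightarrow> t \<preceq> u \<Longrightarrow> s \<preceq> u"
  unfolding conv_def by (auto intro: ref_trans)

text \<open>The equality of types in every environment is subject reduction and subject expansion at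
  once; this is the place where they enter for each conversion.\<close>

lemma conv_ax:
  assumes "eq_axiom s t" "lin s" "lin t" "fv s = fv t" "\<And>e A. styp e s A = styp e t A"
  shows "s \<approx> t"
proof -
  have "eqv e s t A" if "styp e s A" for e A
    using assms that by (intro eqv_ax) auto
  then show ?thesis using assms unfolding conv_def ref_def by (auto intro: eqv_sym)
qed

lemma ref_App:
  assumes "t \<preceq> t'" "s \<preceq> s'" "fv t \<inter> fv s = {}"
  shows "App t s \<preceq> App t' s'"
proof -
  have "eqv e (App t s) (App t' s') B" if *: "styp e t' (A \<multimap> B)" "styp e s' A" for e A B
    using refD(4)[OF assms(1) *(1)] refD(4)[OF assms(2) *(2)] assms(3) by (rule eqv_App)
  then show ?thesis using assms unfolding ref_def by auto
qed

lemma ref_Tup: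
  assumes "t \<preceq> t'" "s \<preceq> s'" "fv t \<inter> fv s = {}"
  shows "Tup t s \<preceq> Tup t' s'"
proof -
  have "eqv e (Tup t s) (Tup t' s') (A \<otimes> B)" if *: "styp e t' A" "styp e s' B" for e A B
    using refD(4)[OF assms(1) *(1)] refD(4)[OF assms(2) *(2)] assms(3) by (rule eqv_Tup)
  then show ?thesis using assms unfolding ref_def by auto
qed

lemma ref_Fn: "t \<preceq> t' \<Longrightarrow> x \<in> fv t \<Longrightarrow> Fn x t \<preceq> Fn x t'"
  unfolding ref_def by (auto intro: eqv_Fn)

lemma ref_LetTup:
  assumes "s \<preceq> s'" "t \<preceq> t'" "lin (LetTup x y s t)"
  shows "LetTup x y s t \<preceq> LetTup x y s' t'"
proof -
  have "eqv e (LetTup x y s t) (LetTup x y s' t') C"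
    if *: "styp e s' (A \<otimes> B)" "styp (e(x := A, y := B)) t' C" for e A B C
    using refD(4)[OF assms(1) *(1)] refD(4)[OF assms(2) *(2)] assms(3) by (rule eqv_LetTup)
  then show ?thesis using assms unfolding ref_def by auto
qed

lemma conv_fv: "s \<approx> t \<Longrightarrow> fv s = fv t" and conv_lin: "s \<approx> t \<Longrightarrow> lin s" "s \<approx> t \<Longrightarrow> lin t"
  unfolding conv_def by (auto dest: refD)

lemma conv_App:
  assumes "t \<approx> t'" "s \<approx> s'" "fv t \<inter> fv s = {}"
  shows "App t s \<approx> App t' s'"
proof -
  have "fv t' \<inter> fv s' = {}" using assms(3) conv_fv[OF assms(1)] conv_fv[OF assms(2)] by simp
  then show ?thesis using assms(3) convD[OF assms(1)] convD[OF assms(2)] unfolding conv_def by (intro conjI ref_App)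
qed

lemma conv_Tup:
  assumes "t \<approx> t'" "s \<approx> s'" "fv t \<inter> fv s = {}"
  shows "Tup t s \<approx> Tup t' s'"
proof -
  have "fv t' \<inter> fv s' = {}" using assms(3) conv_fv[OF assms(1)] conv_fv[OF assms(2)] by simp
  then show ?thesis using assms(3) convD[OF assms(1)] convD[OF assms(2)] unfolding conv_def by (intro conjI ref_Tup)
qed

lemma conv_Fn:
  assumes "t \<approx> t'" "x \<in> fv t"
  shows "Fn x t \<approx> Fn x t'"
proof -
  have "x \<in> fv t'" using assms(2) conv_fv[OF assms(1)] by simp
  then show ?thesis using assms(2) convD[OF assms(1)] unfolding conv_def by (intro conjI ref_Fn)
qed

lemma conv_LetTup:
  assumes "s \<approx> s'" "t \<approx> t'" "lin (LetTup x y s t)"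
  shows "LetTup x y s t \<approx> LetTup x y s' t'"
proof -
  have "lin (LetTup x y s' t')"
    using assms(3) conv_lin[OF assms(1)] conv_lin[OF assms(2)] conv_fv[OF assms(1)] conv_fv[OF assms(2)] by simp
  then show ?thesis using assms(3) convD[OF assms(1)] convD[OF assms(2)] unfolding conv_def
    by (intro conjI ref_LetTup)
qed

subsection \<open>Conversions\<close>

text \<open>Both directions of the typing equivalence come from \<open>styp_subst\<close>. For
  expansion, its environment \<open>e'\<close> gives the argument the type \<open>e' x\<close> and
  agrees with \<open>e\<close> elsewhere, as every other variable stands for itself.\<close>

lemma conv_beta:
  assumes "lin (App (Fn x t) s)"
  shows "App (Fn x t) s \<approx> subst (Var(x := s)) t"
proof (rule conv_ax)
  show "eq_axiom (App (Fn x t) s) (subst (Var(x := s)) t)" by (rule ax_beta_fn)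
  show "lin (subst (Var(x := s)) t)"
    using assms by (intro lin_subst disjoint_lin_upd) auto
  show "fv (App (Fn x t) s) = fv (subst (Var(x := s)) t)"
    using assms by (auto split: if_splits)
  fix e A
  show "styp e (App (Fn x t) s) A = styp e (subst (Var(x := s)) t) A" (is "?l = ?r")
  proof
    assume ?l
    then obtain B where "styp (e(x := B)) t A" "styp e s B" by auto
    then show ?r using assms by (subst styp_subst) (auto intro!: exI[of _ "e(x := B)"])
  next
    assume ?r
    then obtain e' where *: "styp e' t A" "\<forall>v\<in>fv t. styp e ((Var(x := s)) v) (e' v)"
      using assms by (subst (asm) styp_subst) auto
    have "e v = e' v" if "v \<in> fv t" "v \<noteq> x" for v using * that by force
    then have "styp (e(x := e' x)) t A" using *(1) by (subst styp_cong[of _ _ e']) auto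
    moreover have "styp e s (e' x)" using * assms by force
    ultimately show ?l by auto
  qed
qed (use assms in auto)

lemma conv_beta_let:
  assumes "lin (LetTup x y (Tup u v) t)"
  shows "LetTup x y (Tup u v) t \<approx> subst (Var(x := u, y := v)) t"
proof (rule conv_ax)
  show "eq_axiom (LetTup x y (Tup u v) t) (subst (Var(x := u, y := v)) t)"
    using assms by (intro ax_beta_let) auto
  show "lin (subst (Var(x := u, y := v)) t)"
    using assms by (intro lin_subst disjoint_lin_upd2) auto
  show "fv (LetTup x y (Tup u v) t) = fv (subst (Var(x := u, y := v)) t)"
    using assms by (auto split: if_splits)
  fix e A
  show "styp e (LetTup x y (Tup u v) t) A = styp e (subst (Var(x := u, y := v)) t) A" (is "?l = ?r")
  proof
    assume ?l
    then obtain B C where "styp (e(x := B, y := C)) t A" "styp e u B" "styp e v C" by auto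
    then show ?r using assms by (subst styp_subst) (auto intro!: exI[of _ "e(x := B, y := C)"])
  next
    assume ?r
    then obtain e' where *: "styp e' t A" "\<forall>w\<in>fv t. styp e ((Var(x := u, y := v)) w) (e' w)"
      using assms by (subst (asm) styp_subst) auto
    have "e v = e' v" if "v \<in> fv t" "v \<noteq> x" "v \<noteq> y" for v using * that by force
    then have "styp (e(x := e' x, y := e' y)) t A" using *(1) by (subst styp_cong[of _ _ e']) auto
    moreover have "styp e u (e' x)" "styp e v (e' y)" using * assms by force+
    ultimately show ?l by auto
  qed
qed (use assms in auto)

lemma conv_alpha_fn:
  assumes "lin (Fn x t)" "x' \<notin> fv t - {x}"
  shows "Fn x t \<approx> Fn x' (subst (Var(x := Var x')) t)"
proof (rule conv_ax)
  show "eq_axiom (Fn x t) (Fn x' (subst (Var(x := Var x')) t))"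
    by (rule ax_alpha_fn) (use assms in auto)
  have "lin (subst (Var(x := Var x')) t)"
    using assms by (intro lin_subst disjoint_lin_upd) auto
  then show "lin (Fn x' (subst (Var(x := Var x')) t))" using assms by auto
  show "fv (Fn x t) = fv (Fn x' (subst (Var(x := Var x')) t))"
    using assms by (auto split: if_splits)
  fix e A
  have "styp (e(x := B)) t C = styp (e(x' := B)) (subst (Var(x := Var x')) t) C" (is "?l = ?r") for B C
  proof
    assume ?l
    moreover have "styp (e(x' := B)) ((Var(x := Var x')) v) ((e(x := B)) v)" if "v \<in> fv t" for v
      using assms(2) that by auto
    moreover have "lin t" using assms by simp
    ultimately show ?r using styp_subst by blast
  next
    assume ?r
    then obtain e' where *: "styp e' t C" "\<forall>v\<in>fv t. styp (e(x' := B)) ((Var(x := Var x')) v) (e' v)"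
      using assms by (subst (asm) styp_subst) auto
    have "(e(x := B)) v = e' v" if "v \<in> fv t" for v using *(2)[rule_format, OF that] that assms by (auto split: if_splits)
    then show ?l using *(1) by (subst styp_cong[of _ _ e']) auto
  qed
  then show "styp e (Fn x t) A = styp e (Fn x' (subst (Var(x := Var x')) t)) A" by simp
qed (use assms in auto)

lemma conv_alpha_let:
  assumes "lin (LetTup x y s t)" "x' \<noteq> y'" "{x', y'} \<inter> (fv t - {x, y}) = {}"
  shows "LetTup x y s t \<approx> LetTup x' y' s (subst (Var(x := Var x', y := Var y')) t)"
proof (rule conv_ax)
  let ?t = "subst (Var(x := Var x', y := Var y')) t"
  show "eq_axiom (LetTup x y s t) (LetTup x' y' s ?t)"
    by (rule ax_alpha_let) (use assms in auto)
  have l: "lin ?t"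
    using assms by (intro lin_subst disjoint_lin_upd2) auto
  have f: "fv ?t = {x', y'} \<union> (fv t - {x, y})"
    using assms by (auto split: if_splits)
  show "lin (LetTup x' y' s ?t)" using assms l unfolding lin.simps f by auto
  show "fv (LetTup x y s t) = fv (LetTup x' y' s ?t)"
    using assms unfolding fv.simps f by auto
  fix e A
  have "styp (e(x := B, y := D)) t C = styp (e(x' := B, y' := D)) ?t C" (is "?l = ?r") for B C D
  proof
    assume ?l
    then show ?r using assms by (subst styp_subst) (auto intro!: exI[of _ "e(x := B, y := D)"])
  next
    assume ?r
    then obtain e' where *: "styp e' t C"
      "\<forall>v\<in>fv t. styp (e(x' := B, y' := D)) ((Var(x := Var x', y := Var y')) v) (e' v)"
      using assms by (subst (asm) styp_subst) auto
    have "(e(x := B, y := D)) v = e' v" if "v \<in> fv t" for v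
      using *(2)[rule_format, OF that] that assms by (auto split: if_splits)
    then show ?l using *(1) by (subst styp_cong[of _ _ e']) auto
  qed
  then show "styp e (LetTup x y s t) A = styp e (LetTup x' y' s ?t) A" by simp
qed (use assms in auto)

text \<open>The expansion is typable only at arrow types, where the eta axiom applies.
  \<open>t\<close> may have further types, so the converse refinement can fail.\<close>

lemma ref_eta:
  assumes "lin t" "x \<notin> fv t"
  shows "t \<preceq> Fn x (App t (Var x))"
proof -
  have "eqv e t (Fn x (App t (Var x))) A" if "styp e (Fn x (App t (Var x))) A" for e A
    by (rule eqv_sym, rule eqv_ax) (use assms that in \<open>auto intro: ax_eta_fn\<close>)
  then show ?thesis using assms unfolding ref_def by auto
qed

lemma ref_eta_let:
  assumes "lin t" "x \<noteq> y"
  shows "t \<preceq> LetTup x y t (Tup (Var x) (Var y))"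
proof -
  have "eqv e t (LetTup x y t (Tup (Var x) (Var y))) A" if "styp e (LetTup x y t (Tup (Var x) (Var y))) A" for e A
    by (rule eqv_sym, rule eqv_ax) (use assms that in \<open>auto intro: ax_eta_let\<close>)
  then show ?thesis using assms unfolding ref_def by auto
qed

section \<open>Laws of substitution up to conversion\<close>

lemma ref_subst_cong:
  "lin t \<Longrightarrow> disjoint_lin (fv t) \<sigma> \<Longrightarrow> (\<And>v. v \<in> fv t \<Longrightarrow> \<sigma> v \<preceq> \<tau> v) \<Longrightarrow> subst \<sigma> t \<preceq> subst \<tau> t"
proof (induction t arbitrary: \<sigma> \<tau>)
  case (App t s)
  have "subst \<sigma> t \<preceq> subst \<tau> t" "subst \<sigma> s \<preceq> subst \<tau> s"
    using App.prems by (auto intro!: App.IH intro: disjoint_lin_subset)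
  moreover have "lin (subst \<sigma> (App t s))" by (rule lin_subst[OF App.prems(1,2)])
  ultimately show ?case by (simp add: ref_App del: fv_subst)
next
  case (Tup t s)
  have "subst \<sigma> t \<preceq> subst \<tau> t" "subst \<sigma> s \<preceq> subst \<tau> s"
    using Tup.prems by (auto intro!: Tup.IH intro: disjoint_lin_subset)
  moreover have "lin (subst \<sigma> (Tup t s))" by (rule lin_subst[OF Tup.prems(1,2)])
  ultimately show ?case by (simp add: ref_Tup del: fv_subst)
next
  case (Fn x t)
  \<comment> \<open>Related terms have the same free variables, so both substitutions choose the
    same binder.\<close>
  have X: "(\<Union>v\<in>fv t - {x}. fv (\<tau> v)) = (\<Union>v\<in>fv t - {x}. fv (\<sigma> v))"
    using refD(3)[OF Fn.prems(3)] by (intro SUP_cong) auto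
  obtain z where z: "z \<notin> (\<Union>v\<in>fv t - {x}. fv (\<sigma> v))" "z = fresh (\<Union>v\<in>fv t - {x}. fv (\<sigma> v))"
    "subst \<sigma> (Fn x t) = Fn z (subst (\<sigma>(x := Var z)) t)"
    by (rule subst_fn_obtain)
  have \<tau>: "subst \<tau> (Fn x t) = Fn z (subst (\<tau>(x := Var z)) t)"
    unfolding subst.simps Let_def X z(2) ..
  have "subst (\<sigma>(x := Var z)) t \<preceq> subst (\<tau>(x := Var z)) t"
    using Fn.prems z(1) by (intro Fn.IH disjoint_lin_upd) auto
  moreover have "lin (subst \<sigma> (Fn x t))" by (rule lin_subst[OF Fn.prems(1,2)])
  ultimately show ?case unfolding z(3) \<tau> by (intro ref_Fn) (auto simp del: fv_subst)
next
  case (LetTup x y s t)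
  have X: "(\<Union>v\<in>fv t - {x, y}. fv (\<tau> v)) = (\<Union>v\<in>fv t - {x, y}. fv (\<sigma> v))"
    using refD(3)[OF LetTup.prems(3)] by (intro SUP_cong) auto
  obtain z w where z: "z \<notin> (\<Union>v\<in>fv t - {x, y}. fv (\<sigma> v))" "w \<notin> (\<Union>v\<in>fv t - {x, y}. fv (\<sigma> v))" "z \<noteq> w"
    "z = fresh (\<Union>v\<in>fv t - {x, y}. fv (\<sigma> v))"
    "w = fresh (insert z (\<Union>v\<in>fv t - {x, y}. fv (\<sigma> v)))"
    "subst \<sigma> (LetTup x y s t) = LetTup z w (subst \<sigma> s) (subst (\<sigma>(x := Var z, y := Var w)) t)"
    by (rule subst_let_obtain)
  have \<tau>: "subst \<tau> (LetTup x y s t) = LetTup z w (subst \<tau> s) (subst (\<tau>(x := Var z, y := Var w)) t)"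
    unfolding subst.simps Let_def X z(4,5) ..
  have "disjoint_lin (fv t - {x, y}) \<sigma>" using LetTup.prems(2) by (rule disjoint_lin_subset) auto
  then have "subst (\<sigma>(x := Var z, y := Var w)) t \<preceq> subst (\<tau>(x := Var z, y := Var w)) t"
    using LetTup.prems z by (intro LetTup.IH disjoint_lin_upd2) auto
  moreover have "subst \<sigma> s \<preceq> subst \<tau> s"
    using LetTup.prems by (intro LetTup.IH) (auto intro: disjoint_lin_subset)
  moreover have "lin (subst \<sigma> (LetTup x y s t))" by (rule lin_subst[OF LetTup.prems(1,2)])
  ultimately show ?case unfolding z(6) \<tau> by (intro ref_LetTup)
qed auto

lemma disjoint_lin_conv: "disjoint_lin X \<sigma> \<Longrightarrow> (\<And>v. v \<in> X \<Longrightarrow> \<sigma> v \<approx> \<tau> v) \<Longrightarrow> disjoint_lin X \<tau>"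
  unfolding disjoint_lin_def by (metis conv_fv conv_lin(2))

lemma conv_subst_cong:
  assumes "lin t" "disjoint_lin (fv t) \<sigma>" "\<And>v. v \<in> fv t \<Longrightarrow> \<sigma> v \<approx> \<tau> v"
  shows "subst \<sigma> t \<approx> subst \<tau> t"
  using assms disjoint_lin_conv[OF assms(2,3)] unfolding conv_def by (auto intro!: ref_subst_cong)

text \<open>\<open>subst Var\<close> still renames all binders, so it is the identity only up to
  alpha-conversion.\<close>

lemma subst_Var: "lin t \<Longrightarrow> subst Var t \<approx> t"
proof (induction t)
  case (Fn x t)
  obtain z where z: "z \<notin> (\<Union>v\<in>fv t - {x}. fv (Var v))"
    "subst Var (Fn x t) = Fn z (subst (Var(x := Var z)) t)"
    by (rule subst_fn_obtain)
  show ?case unfolding z(2)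
    by (rule conv_sym, rule conv_alpha_fn) (use Fn.prems z in auto)
next
  case (LetTup x y s t)
  obtain z w where z: "z \<notin> (\<Union>v\<in>fv t - {x, y}. fv (Var v))" "w \<notin> (\<Union>v\<in>fv t - {x, y}. fv (Var v))" "z \<noteq> w"
    "subst Var (LetTup x y s t) = LetTup z w (subst Var s) (subst (Var(x := Var z, y := Var w)) t)"
    by (rule subst_let_obtain)
  have "LetTup x y s t \<approx> LetTup z w s (subst (Var(x := Var z, y := Var w)) t)"
    by (rule conv_alpha_let) (use LetTup.prems z in auto)
  also have "\<dots> \<approx> LetTup z w (subst Var s) (subst (Var(x := Var z, y := Var w)) t)"
    using conv_lin(2)[OF calculation] LetTup by (intro conv_LetTup conv_refl) (auto intro: conv_sym)
  finally show ?case unfolding z(4) by (rule conv_sym)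
qed (auto intro!: conv_App conv_Tup)

lemma subst_id: "lin t \<Longrightarrow> (\<And>v. v \<in> fv t \<Longrightarrow> \<sigma> v = Var v) \<Longrightarrow> subst \<sigma> t \<approx> t"
  using subst_cong[of t \<sigma> Var] subst_Var by simp

lemma conv_subst_subst:
  assumes "lin t" "disjoint_lin (fv t) (\<lambda>v. subst \<tau> (\<sigma> v))" "\<And>v. v \<in> fv t \<Longrightarrow> subst \<tau> (\<sigma> v) \<approx> \<rho> v"
  shows "subst \<tau> (subst \<sigma> t) \<approx> subst \<rho> t"
  unfolding subst_subst using assms by (rule conv_subst_cong)

lemma conv_subst_subst':
  assumes "lin t" "disjoint_lin (fv t) \<rho>" "\<And>v. v \<in> fv t \<Longrightarrow> subst \<tau> (\<sigma> v) \<approx> \<rho> v"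
  shows "subst \<tau> (subst \<sigma> t) \<approx> subst \<rho> t"
  using assms by (intro conv_subst_subst disjoint_lin_conv[OF assms(2)]) (auto intro: conv_sym)

text \<open>Up to conversion the new binder may be any variable that captures nothing, not just the
  one delivered by \<open>fresh\<close>.\<close>

lemma conv_subst_fn:
  assumes "lin (Fn x t)" "disjoint_lin (fv t - {x}) \<sigma>" "z \<notin> (\<Union>v\<in>fv t - {x}. fv (\<sigma> v))"
  shows "subst \<sigma> (Fn x t) \<approx> Fn z (subst (\<sigma>(x := Var z)) t)"
proof -
  obtain z0 where z0: "z0 \<notin> (\<Union>v\<in>fv t - {x}. fv (\<sigma> v))"
    "subst \<sigma> (Fn x t) = Fn z0 (subst (\<sigma>(x := Var z0)) t)"
    by (rule subst_fn_obtain)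
  let ?t = "subst (\<sigma>(x := Var z0)) t"
  have l: "lin (Fn z0 ?t)" using lin_subst[of "Fn x t" \<sigma>] assms z0(2) by simp
  have f: "fv ?t - {z0} = (\<Union>v\<in>fv t - {x}. fv (\<sigma> v))" using z0 by (auto split: if_splits)
  have "Fn z0 ?t \<approx> Fn z (subst (Var(z0 := Var z)) ?t)"
    by (rule conv_alpha_fn[OF l]) (use assms f in auto)
  also have "\<dots> \<approx> Fn z (subst (\<sigma>(x := Var z)) t)"
  proof (rule conv_Fn)
    show "subst (Var(z0 := Var z)) ?t \<approx> subst (\<sigma>(x := Var z)) t"
    proof (rule conv_subst_subst')
      show "disjoint_lin (fv t) (\<sigma>(x := Var z))" using assms by (intro disjoint_lin_upd) auto
      fix v assume "v \<in> fv t"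
      then show "subst (Var(z0 := Var z)) ((\<sigma>(x := Var z0)) v) \<approx> (\<sigma>(x := Var z)) v"
        using assms(2) z0(1) by (auto simp: disjoint_lin_def intro!: subst_id)
    qed (use assms in auto)
    show "z \<in> fv (subst (Var(z0 := Var z)) ?t)" using conv_lin(2)[OF calculation] by simp
  qed
  finally show ?thesis using z0(2) by simp
qed

lemma conv_subst_let:
  assumes "lin (LetTup x y s t)" "disjoint_lin (fv (LetTup x y s t)) \<sigma>"
    "z \<notin> (\<Union>v\<in>fv t - {x, y}. fv (\<sigma> v))" "w \<notin> (\<Union>v\<in>fv t - {x, y}. fv (\<sigma> v))" "z \<noteq> w"
  shows "subst \<sigma> (LetTup x y s t) \<approx> LetTup z w (subst \<sigma> s) (subst (\<sigma>(x := Var z, y := Var w)) t)"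
proof -
  obtain z0 w0 where z0: "z0 \<notin> (\<Union>v\<in>fv t - {x, y}. fv (\<sigma> v))" "w0 \<notin> (\<Union>v\<in>fv t - {x, y}. fv (\<sigma> v))" "z0 \<noteq> w0"
    "subst \<sigma> (LetTup x y s t) = LetTup z0 w0 (subst \<sigma> s) (subst (\<sigma>(x := Var z0, y := Var w0)) t)"
    by (rule subst_let_obtain)
  let ?t = "subst (\<sigma>(x := Var z0, y := Var w0)) t"
  have l: "lin (LetTup z0 w0 (subst \<sigma> s) ?t)" using lin_subst[of "LetTup x y s t" \<sigma>] assms z0(4) by simp
  have f: "fv ?t - {z0, w0} = (\<Union>v\<in>fv t - {x, y}. fv (\<sigma> v))" using z0 by (auto split: if_splits)
  have disjoint_lin: "disjoint_lin (fv t - {x, y}) \<sigma>" using assms(2) by (rule disjoint_lin_subset) auto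
  have "LetTup z0 w0 (subst \<sigma> s) ?t \<approx> LetTup z w (subst \<sigma> s) (subst (Var(z0 := Var z, w0 := Var w)) ?t)"
    by (rule conv_alpha_let[OF l]) (use assms f in auto)
  also have "\<dots> \<approx> LetTup z w (subst \<sigma> s) (subst (\<sigma>(x := Var z, y := Var w)) t)"
  proof (rule conv_LetTup[OF conv_refl _ conv_lin(2)[OF calculation]])
    show "subst (Var(z0 := Var z, w0 := Var w)) ?t \<approx> subst (\<sigma>(x := Var z, y := Var w)) t"
    proof (rule conv_subst_subst')
      show "disjoint_lin (fv t) (\<sigma>(x := Var z, y := Var w))" using assms disjoint_lin by (intro disjoint_lin_upd2) auto
      fix v assume "v \<in> fv t"
      then show "subst (Var(z0 := Var z, w0 := Var w)) ((\<sigma>(x := Var z0, y := Var w0)) v) \<approx> (\<sigma>(x := Var z, y := Var w)) v"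
        using disjoint_lin z0 by (auto simp: disjoint_lin_def intro!: subst_id)
    qed (use assms in auto)
    show "lin (subst \<sigma> s)" using l by simp
  qed
  finally show ?thesis using z0(4) by simp
qed

text \<open>Contracting a redex whose function has been substituted into fuses the two
  substitutions. The argument must be disjoint from the other images for the result to be
  linear.\<close>

lemma conv_beta_subst:
  assumes "lin (Fn x t)" "disjoint_lin (fv t - {x}) \<sigma>" "lin u" "fv u \<inter> (\<Union>v\<in>fv t - {x}. fv (\<sigma> v)) = {}"
  shows "App (subst \<sigma> (Fn x t)) u \<approx> subst (\<sigma>(x := u)) t"
proof -
  obtain z where z: "z \<notin> (\<Union>v\<in>fv t - {x}. fv (\<sigma> v))"
    "subst \<sigma> (Fn x t) = Fn z (subst (\<sigma>(x := Var z)) t)"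
    by (rule subst_fn_obtain)
  have "lin (subst \<sigma> (Fn x t))" "fv (subst \<sigma> (Fn x t)) \<inter> fv u = {}"
    using assms by (auto intro!: lin_subst)
  then have "App (subst \<sigma> (Fn x t)) u \<approx> subst (Var(z := u)) (subst (\<sigma>(x := Var z)) t)"
    unfolding z(2) using assms by (intro conv_beta) auto
  also have "\<dots> \<approx> subst (\<sigma>(x := u)) t"
  proof (rule conv_subst_subst')
    show "disjoint_lin (fv t) (\<sigma>(x := u))" using assms by (intro disjoint_lin_upd) auto
    fix v assume "v \<in> fv t"
    then show "subst (Var(z := u)) ((\<sigma>(x := Var z)) v) \<approx> (\<sigma>(x := u)) v"
      using assms z(1) by (auto simp: disjoint_lin_def intro!: subst_id)
  qed (use assms in auto)
  finally show ?thesis .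
qed

lemma ref_beta_let_subst:
  assumes "lin (LetTup x y s t)" "disjoint_lin (fv (LetTup x y s t)) \<sigma>" "subst \<sigma> s \<preceq> Tup u v"
  shows "subst \<sigma> (LetTup x y s t) \<preceq> subst (\<sigma>(x := u, y := v)) t"
proof -
  obtain z w where z: "z \<notin> (\<Union>v\<in>fv t - {x, y}. fv (\<sigma> v))" "w \<notin> (\<Union>v\<in>fv t - {x, y}. fv (\<sigma> v))" "z \<noteq> w"
    "subst \<sigma> (LetTup x y s t) = LetTup z w (subst \<sigma> s) (subst (\<sigma>(x := Var z, y := Var w)) t)"
    by (rule subst_let_obtain)
  let ?t = "subst (\<sigma>(x := Var z, y := Var w)) t"
  have disjoint_lin: "disjoint_lin (fv t - {x, y}) \<sigma>" using assms(2) by (rule disjoint_lin_subset) auto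
  have uv: "lin u" "lin v" "fv u \<inter> fv v = {}" using refD(2)[OF assms(3)] by auto
  have f: "fv u \<union> fv v = (\<Union>v\<in>fv s. fv (\<sigma> v))" using refD(3)[OF assms(3)] by auto
  have "(\<Union>v\<in>fv s. fv (\<sigma> v)) \<inter> (\<Union>v\<in>fv t - {x, y}. fv (\<sigma> v)) = {}"
    using assms(1) by (intro disjoint_lin_disjoint[OF assms(2)]) auto
  then have d: "fv u \<inter> (\<Union>v\<in>fv t - {x, y}. fv (\<sigma> v)) = {}" "fv v \<inter> (\<Union>v\<in>fv t - {x, y}. fv (\<sigma> v)) = {}"
    using f by blast+
  have l: "lin (LetTup z w (subst \<sigma> s) ?t)" using lin_subst[OF assms(1,2)] z(4) by simp
  then have "LetTup z w (subst \<sigma> s) ?t \<preceq> LetTup z w (Tup u v) ?t"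
    using assms(3) by (intro ref_LetTup) auto
  also have "\<dots> \<approx> subst (Var(z := u, w := v)) ?t"
    by (rule conv_beta_let) (rule refD(2)[OF calculation])
  also have "\<dots> \<approx> subst (\<sigma>(x := u, y := v)) t"
  proof (rule conv_subst_subst')
    show "disjoint_lin (fv t) (\<sigma>(x := u, y := v))" using disjoint_lin uv d by (intro disjoint_lin_upd2) auto
    fix a assume "a \<in> fv t"
    then show "subst (Var(z := u, w := v)) ((\<sigma>(x := Var z, y := Var w)) a) \<approx> (\<sigma>(x := u, y := v)) a"
      using disjoint_lin z uv by (auto simp: disjoint_lin_def intro!: subst_id)
  qed (use assms in auto)
  finally show ?thesis using z(4) by simp
qed

subsection \<open>Commuting conversions\<close>

lemma fv_plug: "fv (plug C t) = fv_ctx C \<union> (fv t - binders C)"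
  by (induction C) auto

lemma lin_plugD: "lin (plug C t) \<Longrightarrow> lin t"
  by (induction C) auto

text \<open>The captured variables must be used alike by both fillings, and variables that are new
  in \<open>u\<close> must not clash with the context; otherwise a binder of \<open>C\<close> could
  become vacuous or a variable be used twice.\<close>

lemma lin_plug:
  "lin (plug C t) \<Longrightarrow> lin u \<Longrightarrow> (\<And>z. z \<in> binders C \<Longrightarrow> z \<in> fv t \<longleftrightarrow> z \<in> fv u)
    \<Longrightarrow> (fv u - fv t) \<inter> fv_ctx C = {} \<Longrightarrow> lin (plug C u)"
  by (induction C) (auto simp: fv_plug)

lemma ref_plug:
  assumes "s \<preceq> s'"
  shows "lin (plug C s) \<Longrightarrow> plug C s \<preceq> plug C s'"
proof (induction C)
  case Hole
  then show ?case using assms by simp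
qed (auto intro!: ref_App ref_Fn ref_Tup ref_LetTup)

lemma conv_plug:
  assumes "s \<approx> s'"
  shows "lin (plug C s) \<Longrightarrow> plug C s \<approx> plug C s'"
proof (induction C)
  case Hole
  then show ?case using assms by simp
qed (auto intro!: conv_App conv_Fn conv_Tup conv_LetTup)

text \<open>\<open>y\<close> can occur only in the hole, so a substitution for it passes through
  \<open>C\<close>; the binders of \<open>C\<close> can be kept because they capture nothing in
  \<open>r\<close>.\<close>

lemma subst_plug:
  "lin (plug C t) \<Longrightarrow> lin r \<Longrightarrow> y \<notin> fv_ctx C \<Longrightarrow> y \<notin> binders C \<Longrightarrow> binders C \<inter> fv r = {}
    \<Longrightarrow> fv r \<inter> (fv (plug C t) - {y}) = {} \<Longrightarrow> subst (Var(y := r)) (plug C t) \<approx> plug C (subst (Var(y := r)) t)"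
proof (induction C)
  case Hole
  have "lin (subst (Var(y := r)) t)" using Hole by (intro lin_subst disjoint_lin_upd) auto
  then show ?case by (simp only: plug.simps conv_refl)
next
  case (AppL C s)
  have "subst (Var(y := r)) (plug C t) \<approx> plug C (subst (Var(y := r)) t)"
    using AppL.prems by (intro AppL.IH) auto
  moreover have "subst (Var(y := r)) s \<approx> s" using AppL.prems by (intro subst_id) auto
  moreover have "lin (subst (Var(y := r)) (plug (AppL C s) t))"
    using AppL.prems by (intro lin_subst disjoint_lin_upd) auto
  ultimately show ?case by (simp add: conv_App del: fv_subst fun_upd_apply)
next
  case (AppR s C)
  have "subst (Var(y := r)) (plug C t) \<approx> plug C (subst (Var(y := r)) t)"
    using AppR.prems by (intro AppR.IH) auto
  moreover have "subst (Var(y := r)) s \<approx> s" using AppR.prems by (intro subst_id) auto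
  moreover have "lin (subst (Var(y := r)) (plug (AppR s C) t))"
    using AppR.prems by (intro lin_subst disjoint_lin_upd) auto
  ultimately show ?case by (simp add: conv_App del: fv_subst fun_upd_apply)
next
  case (TupL C s)
  have "subst (Var(y := r)) (plug C t) \<approx> plug C (subst (Var(y := r)) t)"
    using TupL.prems by (intro TupL.IH) auto
  moreover have "subst (Var(y := r)) s \<approx> s" using TupL.prems by (intro subst_id) auto
  moreover have "lin (subst (Var(y := r)) (plug (TupL C s) t))"
    using TupL.prems by (intro lin_subst disjoint_lin_upd) auto
  ultimately show ?case by (simp add: conv_Tup del: fv_subst fun_upd_apply)
next
  case (TupR s C)
  have "subst (Var(y := r)) (plug C t) \<approx> plug C (subst (Var(y := r)) t)"
    using TupR.prems by (intro TupR.IH) auto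
  moreover have "subst (Var(y := r)) s \<approx> s" using TupR.prems by (intro subst_id) auto
  moreover have "lin (subst (Var(y := r)) (plug (TupR s C) t))"
    using TupR.prems by (intro lin_subst disjoint_lin_upd) auto
  ultimately show ?case by (simp add: conv_Tup del: fv_subst fun_upd_apply)
next
  case (FnC z C)
  have "subst (Var(y := r)) (Fn z (plug C t)) \<approx> Fn z (subst (Var(y := r, z := Var z)) (plug C t))"
    using FnC.prems by (intro conv_subst_fn disjoint_lin_upd) (auto split: if_splits)
  also have "Var(y := r, z := Var z) = Var(y := r)" using FnC.prems by auto
  also have "Fn z (subst (Var(y := r)) (plug C t)) \<approx> Fn z (plug C (subst (Var(y := r)) t))"
    using FnC.prems calculation by (intro conv_Fn FnC.IH) (auto dest!: conv_lin(2))
  finally show ?case by (simp only: plug.simps)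
next
  case (LetR a b s C)
  have disjoint_lin: "disjoint_lin (fv (LetTup a b s (plug C t))) (Var(y := r))"
    using LetR.prems by (intro disjoint_lin_upd) auto
  have "subst (Var(y := r)) (LetTup a b s (plug C t))
     \<approx> LetTup a b (subst (Var(y := r)) s) (subst (Var(y := r, a := Var a, b := Var b)) (plug C t))"
    using LetR.prems disjoint_lin by (intro conv_subst_let) (auto split: if_splits)
  also have "Var(y := r, a := Var a, b := Var b) = Var(y := r)" using LetR.prems by auto
  also have "LetTup a b (subst (Var(y := r)) s) (subst (Var(y := r)) (plug C t))
      \<approx> LetTup a b s (plug C (subst (Var(y := r)) t))"
  proof (rule conv_LetTup)
    show "subst (Var(y := r)) s \<approx> s" using LetR.prems by (intro subst_id) auto
    show "subst (Var(y := r)) (plug C t) \<approx> plug C (subst (Var(y := r)) t)"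
    proof (rule LetR.IH)
      have "fv r \<inter> (fv s \<union> (fv (plug C t) - {a, b}) - {y}) = {}" "a \<notin> fv r" "b \<notin> fv r"
        using LetR.prems by simp_all
      then show "fv r \<inter> (fv (plug C t) - {y}) = {}" by blast
    qed (use LetR.prems in simp_all)
  qed (use conv_lin(2)[OF calculation] \<open>Var(y := r, a := Var a, b := Var b) = Var(y := r)\<close> in \<open>simp only:\<close>)
  finally show ?case by (simp only: plug.simps)
next
  case (LetL a b C s)
  have y: "y \<notin> fv s - {a, b}" using LetL.prems by auto
  have disjoint_lin: "disjoint_lin (fv (LetTup a b (plug C t) s)) (Var(y := r))"
    using LetL.prems by (intro disjoint_lin_upd) auto
  have "subst (Var(y := r)) (LetTup a b (plug C t) s)
     \<approx> LetTup a b (subst (Var(y := r)) (plug C t)) (subst (Var(y := r, a := Var a, b := Var b)) s)"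
    using LetL.prems disjoint_lin y by (intro conv_subst_let) (auto split: if_splits)
  also have "\<dots> \<approx> LetTup a b (plug C (subst (Var(y := r)) t)) s"
  proof (rule conv_LetTup)
    show "subst (Var(y := r)) (plug C t) \<approx> plug C (subst (Var(y := r)) t)"
      by (rule LetL.IH) (use LetL.prems in auto)
    show "subst (Var(y := r, a := Var a, b := Var b)) s \<approx> s"
      using LetL.prems y by (intro subst_id) auto
  qed (rule conv_lin(2)[OF calculation])
  finally show ?case by (simp only: plug.simps)
qed

text \<open>A redex on \<open>Fn y t\<close> acts as a \<open>let\<close> for a single variable. Its
  commuting conversion is derived: contract the redex in the hole, move the substitution out past
  \<open>C\<close>, and expand again.\<close>

lemma conv_comm_fn:
  assumes "lin (plug C (App (Fn y t) r))" "y \<notin> fv_ctx C" "y \<notin> binders C" "binders C \<inter> fv r = {}"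
  shows "plug C (App (Fn y t) r) \<approx> App (Fn y (plug C t)) r"
proof -
  have l: "lin (App (Fn y t) r)" using lin_plugD[OF assms(1)] .
  have "fv r \<inter> fv_ctx C = {}"
    using assms(1,4) by (induction C) (auto simp: fv_plug)
  then have fr: "fv r \<inter> (fv (plug C t) - {y}) = {}"
    using l by (auto simp: fv_plug)
  have l2: "lin (plug C t)"
    by (rule lin_plug[OF assms(1)]) (use assms l in \<open>auto\<close>)
  have "plug C (App (Fn y t) r) \<approx> plug C (subst (Var(y := r)) t)"
    by (rule conv_plug[OF conv_beta[OF l] assms(1)])
  also have "\<dots> \<approx> subst (Var(y := r)) (plug C t)"
    by (rule conv_sym, rule subst_plug) (use l l2 fr assms in auto)
  also have "\<dots> \<approx> App (Fn y (plug C t)) r"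
    by (rule conv_sym, rule conv_beta) (use l l2 fr assms in \<open>auto simp: fv_plug\<close>)
  finally show ?thesis .
qed

text \<open>Supplies the typing equivalence that \<open>conv_ax\<close> asks for in the case of
  \<open>ax_comm\<close>. Updates of the environment at the binders of \<open>C\<close> and at
  \<open>x\<close>, \<open>y\<close> commute, as these variables differ.\<close>

lemma styp_plug_let:
  "x \<noteq> y \<Longrightarrow> binders C \<inter> fv s = {} \<Longrightarrow> {x, y} \<inter> fv_ctx C = {} \<Longrightarrow> {x, y} \<inter> binders C = {}
   \<Longrightarrow> styp e (plug C (LetTup x y s u)) A \<longleftrightarrow> (\<exists>D E. styp e s (D \<otimes> E) \<and> styp (e(x := D, y := E)) (plug C u) A)"
proof (induction C arbitrary: e A)
  case (FnC z C)
  have IH: "styp (e(z := B)) (plug C (LetTup x y s u)) F \<longleftrightarrow>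
     (\<exists>D E. styp e s (D \<otimes> E) \<and> styp (e(x := D, y := E, z := B)) (plug C u) F)" for B F
  proof -
    have "e(z := B, x := D, y := E) = e(x := D, y := E, z := B)" for D E
      using FnC.prems by auto
    moreover have "styp (e(z := B)) (plug C (LetTup x y s u)) F \<longleftrightarrow>
       (\<exists>D E. styp (e(z := B)) s (D \<otimes> E) \<and> styp (e(z := B, x := D, y := E)) (plug C u) F)"
      by (rule FnC.IH) (use FnC.prems in auto)
    moreover have "z \<notin> fv s" using FnC.prems by auto
    ultimately show ?thesis by simp
  qed
  show ?case unfolding plug.simps styp.simps IH by blast
next
  case (LetR a b r C)
  have IH: "styp (e(a := B, b := B')) (plug C (LetTup x y s u)) F \<longleftrightarrow>
     (\<exists>D E. styp e s (D \<otimes> E) \<and> styp (e(x := D, y := E, a := B, b := B')) (plug C u) F)" for B B' F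
  proof -
    have "e(a := B, b := B', x := D, y := E) = e(x := D, y := E, a := B, b := B')" for D E
      using LetR.prems by auto
    moreover have "styp (e(a := B, b := B')) (plug C (LetTup x y s u)) F \<longleftrightarrow>
       (\<exists>D E. styp (e(a := B, b := B')) s (D \<otimes> E) \<and> styp (e(a := B, b := B', x := D, y := E)) (plug C u) F)"
      by (rule LetR.IH) (use LetR.prems in auto)
    moreover have "a \<notin> fv s" "b \<notin> fv s" using LetR.prems by auto
    ultimately show ?thesis by simp
  qed
  have "styp (e(x := D, y := E)) r F = styp e r F" for D E F
    using LetR.prems by (intro styp_cong) auto
  then show ?case unfolding plug.simps styp.simps IH by auto
next
  case (LetL a b C r)
  have IH: "styp e (plug C (LetTup x y s u)) F \<longleftrightarrow>
     (\<exists>D E. styp e s (D \<otimes> E) \<and> styp (e(x := D, y := E)) (plug C u) F)" for F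
    by (rule LetL.IH) (use LetL.prems in auto)
  have "styp (e(x := D, y := E, a := B, b := B')) r F = styp (e(a := B, b := B')) r F" for D E F B B'
    using LetL.prems by (intro styp_cong) auto
  then show ?case unfolding plug.simps styp.simps IH by auto
next
  case (AppL C r)
  have IH: "styp e (plug C (LetTup x y s u)) F \<longleftrightarrow>
     (\<exists>D E. styp e s (D \<otimes> E) \<and> styp (e(x := D, y := E)) (plug C u) F)" for F
    by (rule AppL.IH) (use AppL.prems in auto)
  have "styp (e(x := D, y := E)) r F = styp e r F" for D E F
    using AppL.prems by (intro styp_cong) auto
  then show ?case unfolding plug.simps styp.simps IH by auto
next
  case (AppR r C)
  have IH: "styp e (plug C (LetTup x y s u)) F \<longleftrightarrow>
     (\<exists>D E. styp e s (D \<otimes> E) \<and> styp (e(x := D, y := E)) (plug C u) F)" for F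
    by (rule AppR.IH) (use AppR.prems in auto)
  have "styp (e(x := D, y := E)) r F = styp e r F" for D E F
    using AppR.prems by (intro styp_cong) auto
  then show ?case unfolding plug.simps styp.simps IH by auto
next
  case (TupL C r)
  have IH: "styp e (plug C (LetTup x y s u)) F \<longleftrightarrow>
     (\<exists>D E. styp e s (D \<otimes> E) \<and> styp (e(x := D, y := E)) (plug C u) F)" for F
    by (rule TupL.IH) (use TupL.prems in auto)
  have "styp (e(x := D, y := E)) r F = styp e r F" for D E F
    using TupL.prems by (intro styp_cong) auto
  then show ?case unfolding plug.simps styp.simps IH by auto
next
  case (TupR r C)
  have IH: "styp e (plug C (LetTup x y s u)) F \<longleftrightarrow>
     (\<exists>D E. styp e s (D \<otimes> E) \<and> styp (e(x := D, y := E)) (plug C u) F)" for F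
    by (rule TupR.IH) (use TupR.prems in auto)
  have "styp (e(x := D, y := E)) r F = styp e r F" for D E F
    using TupR.prems by (intro styp_cong) auto
  then show ?case unfolding plug.simps styp.simps IH by auto
qed simp

lemma conv_comm_let:
  assumes "lin (plug C (LetTup x y s u))" "{x, y} \<inter> fv_ctx C = {}" "{x, y} \<inter> binders C = {}"
    "binders C \<inter> fv s = {}"
  shows "plug C (LetTup x y s u) \<approx> LetTup x y s (plug C u)"
proof (rule conv_ax)
  have l: "lin (LetTup x y s u)" using lin_plugD[OF assms(1)] .
  have fr: "fv s \<inter> fv_ctx C = {}"
    using assms(1,4) by (induction C) (auto simp: fv_plug)
  have l2: "lin (plug C u)"
    by (rule lin_plug[OF assms(1)]) (use assms l in \<open>auto\<close>)
  show "eq_axiom (plug C (LetTup x y s u)) (LetTup x y s (plug C u))"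
    by (rule ax_comm) (use assms in auto)
  show "lin (LetTup x y s (plug C u))"
    using l2 l fr assms by (auto simp: fv_plug)
  show "fv (plug C (LetTup x y s u)) = fv (LetTup x y s (plug C u))"
    using assms by (auto simp: fv_plug)
  show "styp e (plug C (LetTup x y s u)) A = styp e (LetTup x y s (plug C u)) A" for e A
    using l assms by (subst styp_plug_let) auto
qed (rule assms)

subsection \<open>Cut-free terms and their axiom links\<close>

text \<open>Outward move of a binding through a context; \<open>ref_comm_fn'\<close> and
  \<open>ref_comm_let'\<close> are the inward moves.\<close>

lemma ref_comm_fn:
  assumes "t0 \<preceq> App (Fn y t) r" "lin (plug C t0)" "y \<notin> fv_ctx C" "y \<notin> binders C" "binders C \<inter> fv r = {}"
  shows "plug C t0 \<preceq> App (Fn y (plug C t)) r"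
proof -
  have "plug C t0 \<preceq> plug C (App (Fn y t) r)" by (rule ref_plug[OF assms(1,2)])
  also have "\<dots> \<approx> App (Fn y (plug C t)) r" by (rule conv_comm_fn[OF refD(2)[OF calculation] assms(3-5)])
  finally show ?thesis .
qed

lemma ref_comm_let:
  assumes "t0 \<preceq> LetTup x y s t" "lin (plug C t0)" "{x, y} \<inter> fv_ctx C = {}" "{x, y} \<inter> binders C = {}"
    "binders C \<inter> fv s = {}"
  shows "plug C t0 \<preceq> LetTup x y s (plug C t)"
proof -
  have "plug C t0 \<preceq> plug C (LetTup x y s t)" by (rule ref_plug[OF assms(1,2)])
  also have "\<dots> \<approx> LetTup x y s (plug C t)" by (rule conv_comm_let[OF refD(2)[OF calculation] assms(3-5)])
  finally show ?thesis .
qed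

lemma lin_plug_disjoint: "lin (plug C t) \<Longrightarrow> (fv t - binders C) \<inter> fv_ctx C = {}"
  by (induction C) (auto simp: fv_plug)

text \<open>As \<open>y\<close> occurs in the hole, linearity excludes it from the rest of
  \<open>C\<close>, and the binding can follow its variable into the context.\<close>

lemma ref_comm_fn':
  assumes "t0 \<preceq> plug C u" "lin (App (Fn y t0) r)" "y \<in> fv u" "y \<notin> binders C" "binders C \<inter> fv r = {}"
  shows "App (Fn y t0) r \<preceq> plug C (App (Fn y u) r)"
proof -
  have l: "lin (plug C u)" and f: "fv t0 = fv (plug C u)" using refD[OF assms(1)] by auto
  note lin_plugD[OF l] and d = lin_plug_disjoint[OF l]
  have r: "fv r \<inter> (fv_ctx C - {y}) = {}" "fv r \<inter> (fv u - {y}) = {}"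
    using assms(2,5) f by (auto simp: fv_plug)
  have yc: "y \<notin> fv_ctx C" using d assms(3,4) by auto
  have "lin (App (Fn y u) r)" using assms r \<open>lin u\<close> by auto
  then have l2: "lin (plug C (App (Fn y u) r))"
    by (rule lin_plug[OF l]) (use assms r yc in \<open>auto\<close>)
  have "App (Fn y t0) r \<preceq> App (Fn y (plug C u)) r"
    using assms by (intro ref_App ref_Fn) auto
  also have "\<dots> \<approx> plug C (App (Fn y u) r)"
    by (rule conv_sym, rule conv_comm_fn[OF l2 yc assms(4,5)])
  finally show ?thesis .
qed

lemma ref_comm_let':
  assumes "t0 \<preceq> plug C u" "lin (LetTup x y s t0)" "x \<in> fv u" "y \<in> fv u" "{x, y} \<inter> binders C = {}"
    "binders C \<inter> fv s = {}"
  shows "LetTup x y s t0 \<preceq> plug C (LetTup x y s u)"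
proof -
  have l: "lin (plug C u)" and f: "fv t0 = fv (plug C u)" using refD[OF assms(1)] by auto
  note lin_plugD[OF l] and d = lin_plug_disjoint[OF l]
  have r: "fv s \<inter> (fv_ctx C - {x, y}) = {}" "fv s \<inter> (fv u - {x, y}) = {}"
    using assms(2,6) f by (auto simp: fv_plug)
  have yc: "{x, y} \<inter> fv_ctx C = {}" using d assms(3-5) by auto
  have "lin (LetTup x y s u)" using assms r \<open>lin u\<close> by auto
  then have l2: "lin (plug C (LetTup x y s u))"
    by (rule lin_plug[OF l]) (use assms r yc in \<open>auto\<close>)
  have "LetTup x y s t0 \<preceq> LetTup x y s (plug C u)"
    using assms by (intro ref_LetTup) auto
  also have "\<dots> \<approx> plug C (LetTup x y s u)"
    by (rule conv_sym, rule conv_comm_let[OF l2 yc assms(5,6)])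
  finally show ?thesis .
qed

text \<open>Cut-free sequent proofs as raw terms. The left rule for \<open>\<multimap>\<close> leaves the redex
  \<open>(fn y => t) (z u)\<close> in place of \<open>t[z u/y]\<close>, so that no substitution enters the syntax. The last
  argument collects the axiom links, as pairs of a negative and a positive label.\<close>

inductive cut_free :: "(var \<Rightarrow> ty) \<Rightarrow> ty \<Rightarrow> trm \<Rightarrow> (nat \<times> nat) set \<Rightarrow> bool" where
  cut_free_ax: "e x = TVar i \<Longrightarrow> cut_free e (TVar j) (Var x) {(i, j)}"
| cut_free_fn: "cut_free (e(x := A)) B s L \<Longrightarrow> x \<in> fv s \<Longrightarrow> cut_free e (A \<multimap> B) (Fn x s) L"
| cut_free_tup: "cut_free e A s L \<Longrightarrow> cut_free e B t L' \<Longrightarrow> fv s \<inter> fv t = {} \<Longrightarrow> cut_free e (A \<otimes> B) (Tup s t) (L \<union> L')"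
| cut_free_let: "e z = X \<otimes> Y \<Longrightarrow> cut_free (e(x := X, y := Y)) C t L \<Longrightarrow> x \<in> fv t \<Longrightarrow> y \<in> fv t \<Longrightarrow> x \<noteq> y
    \<Longrightarrow> z \<notin> fv t - {x, y} \<Longrightarrow> cut_free e C (LetTup x y (Var z) t) L"
| cut_free_app: "e z = U \<multimap> R \<Longrightarrow> cut_free e U u L \<Longrightarrow> cut_free (e(y := R)) C t L' \<Longrightarrow> y \<in> fv t \<Longrightarrow> z \<notin> fv u
    \<Longrightarrow> z \<notin> fv t - {y} \<Longrightarrow> fv u \<inter> (fv t - {y}) = {} \<Longrightarrow> cut_free e C (App (Fn y t) (App (Var z) u)) (L \<union> L')"

lemma cut_free_lin: "cut_free e A s L \<Longrightarrow> lin s"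
  by (induction rule: cut_free.induct) auto

lemma cut_free_cong: "cut_free e A s L \<Longrightarrow> (\<And>x. x \<in> fv s \<Longrightarrow> e x = e' x) \<Longrightarrow> cut_free e' A s L"
proof (induction arbitrary: e' rule: cut_free.induct)
  case (cut_free_fn e x A B s L)
  have "cut_free (e'(x := A)) B s L" by (rule cut_free_fn.IH) (use cut_free_fn.prems in auto)
  then show ?case using cut_free_fn.hyps by (intro cut_free.cut_free_fn)
next
  case (cut_free_let e z X Y x y C t L)
  have "cut_free (e'(x := X, y := Y)) C t L" by (rule cut_free_let.IH) (use cut_free_let.prems in auto)
  moreover have "e' z = X \<otimes> Y" using cut_free_let by auto
  ultimately show ?case using cut_free_let.hyps by (intro cut_free.cut_free_let)
next
  case (cut_free_app e z U R u L y C t L')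
  have "cut_free (e'(y := R)) C t L'" by (rule cut_free_app.IH) (use cut_free_app.prems in auto)
  moreover have "cut_free e' U u L" by (rule cut_free_app.IH) (use cut_free_app.prems in auto)
  moreover have "e' z = U \<multimap> R" using cut_free_app by auto
  ultimately show ?case using cut_free_app.hyps by (intro cut_free.cut_free_app)
next
  case (cut_free_tup e A s L B t L')
  have "cut_free e' A s L" by (rule cut_free_tup.IH) (use cut_free_tup.prems in auto)
  moreover have "cut_free e' B t L'" by (rule cut_free_tup.IH) (use cut_free_tup.prems in auto)
  ultimately show ?case using cut_free_tup.hyps by (intro cut_free.cut_free_tup)
qed (auto intro: cut_free.intros)

lemma inj_on_upd: "inj_on \<pi> (X - {x}) \<Longrightarrow> z \<notin> \<pi> ` (X - {x}) \<Longrightarrow> inj_on (\<pi>(x := z)) X"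
  by (auto simp: inj_on_def)

lemma inj_on_upd2:
  assumes "inj_on \<pi> (X - {x, y})" "a \<notin> \<pi> ` (X - {x, y})" "b \<notin> \<pi> ` (X - {x, y})" "a \<noteq> b"
  shows "inj_on (\<pi>(x := a, y := b)) X"
proof (rule inj_on_upd)
  have X: "X - {y} - {x} = X - {x, y}" by auto
  show "inj_on (\<pi>(x := a)) (X - {y})" by (rule inj_on_upd) (use assms X in auto)
  show "b \<notin> (\<pi>(x := a)) ` (X - {y})" using assms(3,4) by auto
qed

lemma UN_fv_upd2:
  assumes "x \<in> X" "y \<in> X" "x \<noteq> y"
  shows "(\<Union>v\<in>X. fv ((\<sigma>(x := Var a, y := Var b)) v)) = {a, b} \<union> (\<Union>v\<in>X - {x, y}. fv (\<sigma> v))"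
proof -
  have "(\<Union>v\<in>insert x (insert y (X - {x, y})). fv ((\<sigma>(x := Var a, y := Var b)) v))
      = {a, b} \<union> (\<Union>v\<in>X - {x, y}. fv ((\<sigma>(x := Var a, y := Var b)) v))"
    using assms(3) by auto
  also have "(\<Union>v\<in>X - {x, y}. fv ((\<sigma>(x := Var a, y := Var b)) v)) = (\<Union>v\<in>X - {x, y}. fv (\<sigma> v))"
    by (rule SUP_cong) auto
  also have "insert x (insert y (X - {x, y})) = X" using assms by auto
  finally show ?thesis .
qed

text \<open>Injectivity on the free variables keeps the renamed term linear. The links survive
  because labels sit in the types, not in the names.\<close>

lemma cut_free_rename:
  "cut_free e A s L \<Longrightarrow> inj_on \<pi> (fv s) \<Longrightarrow> (\<And>x. x \<in> fv s \<Longrightarrow> e' (\<pi> x) = e x) \<Longrightarrow> cut_free e' A (subst (\<lambda>v. Var (\<pi> v)) s) L"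
proof (induction arbitrary: e' \<pi> rule: cut_free.induct)
  case (cut_free_ax e x i j)
  then show ?case by (auto intro: cut_free.cut_free_ax)
next
  case (cut_free_fn e x A B s L)
  obtain z where z: "z \<notin> (\<Union>v\<in>fv s - {x}. fv (Var (\<pi> v)))"
    "subst (\<lambda>v. Var (\<pi> v)) (Fn x s) = Fn z (subst ((\<lambda>v. Var (\<pi> v))(x := Var z)) s)"
    by (rule subst_fn_obtain)
  have eq: "(\<lambda>v. Var (\<pi> v))(x := Var z) = (\<lambda>v. Var ((\<pi>(x := z)) v))" by auto
  have "cut_free (e'(z := A)) B (subst (\<lambda>v. Var ((\<pi>(x := z)) v)) s) L"
  proof (rule cut_free_fn.IH)
    have "inj_on \<pi> (fv s - {x})" using cut_free_fn.prems(1) by simp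
    then show "inj_on (\<pi>(x := z)) (fv s)" using z(1) by (auto simp: inj_on_def)
  qed (use cut_free_fn.prems z(1) in auto)
  then show ?case unfolding z(2) eq using cut_free_fn.hyps by (intro cut_free.cut_free_fn) auto
next
  case (cut_free_tup e A s L B t L')
  have "inj_on \<pi> (fv s)" "inj_on \<pi> (fv t)" using cut_free_tup.prems(1) by (auto intro: inj_on_subset)
  then have "cut_free e' A (subst (\<lambda>v. Var (\<pi> v)) s) L" "cut_free e' B (subst (\<lambda>v. Var (\<pi> v)) t) L'"
    using cut_free_tup.prems by (auto intro!: cut_free_tup.IH)
  moreover have "\<pi> ` fv s \<inter> \<pi> ` fv t = {}"
    using cut_free_tup.prems(1) cut_free_tup.hyps by (auto simp: inj_on_def)
  then have "fv (subst (\<lambda>v. Var (\<pi> v)) s) \<inter> fv (subst (\<lambda>v. Var (\<pi> v)) t) = {}" by auto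
  ultimately show ?case unfolding subst.simps by (intro cut_free.cut_free_tup)
next
  case (cut_free_let e z X Y x y C t L)
  obtain a b where z: "a \<notin> (\<Union>v\<in>fv t - {x, y}. fv (Var (\<pi> v)))" "b \<notin> (\<Union>v\<in>fv t - {x, y}. fv (Var (\<pi> v)))" "a \<noteq> b"
    "subst (\<lambda>v. Var (\<pi> v)) (LetTup x y (Var z) t)
      = LetTup a b (subst (\<lambda>v. Var (\<pi> v)) (Var z)) (subst ((\<lambda>v. Var (\<pi> v))(x := Var a, y := Var b)) t)"
    by (rule subst_let_obtain)
  have eq: "(\<lambda>v. Var (\<pi> v))(x := Var a, y := Var b) = (\<lambda>v. Var ((\<pi>(x := a, y := b)) v))" by auto
  have "cut_free (e'(a := X, b := Y)) C (subst (\<lambda>v. Var ((\<pi>(x := a, y := b)) v)) t) L"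
  proof (rule cut_free_let.IH)
    have "inj_on \<pi> (fv t - {x, y})" using cut_free_let.prems(1) by (auto intro: inj_on_subset)
    then show "inj_on (\<pi>(x := a, y := b)) (fv t)"
      by (rule inj_on_upd2) (use z in auto)
  qed (use cut_free_let.prems z(1-3) in auto)
  moreover have "e' (\<pi> z) = X \<otimes> Y" using cut_free_let.prems(2)[of z] cut_free_let.hyps(1) by simp
  moreover have "\<pi> z \<notin> \<pi> ` (fv t - {x, y})"
  proof
    assume "\<pi> z \<in> \<pi> ` (fv t - {x, y})"
    then obtain v where v: "v \<in> fv t - {x, y}" "\<pi> z = \<pi> v" by blast
    have "z = v" by (rule inj_onD[OF cut_free_let.prems(1) v(2)]) (use v(1) in simp_all)
    then show False using v cut_free_let.hyps by blast
  qed
  moreover have f: "fv (subst (\<lambda>v. Var ((\<pi>(x := a, y := b)) v)) t) = {a, b} \<union> \<pi> ` (fv t - {x, y})"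
    unfolding eq[symmetric] fv_subst UN_fv_upd2[OF cut_free_let.hyps(3-5)] by auto
  ultimately show ?case unfolding z(4) eq subst.simps(1) using cut_free_let.hyps z(3)
    by (intro cut_free.cut_free_let) auto
next
  case (cut_free_app e z U R u L y C t L')
  obtain a where a: "a \<notin> (\<Union>v\<in>fv t - {y}. fv (Var (\<pi> v)))"
    "subst (\<lambda>v. Var (\<pi> v)) (Fn y t) = Fn a (subst ((\<lambda>v. Var (\<pi> v))(y := Var a)) t)"
    by (rule subst_fn_obtain)
  have eq: "(\<lambda>v. Var (\<pi> v))(y := Var a) = (\<lambda>v. Var ((\<pi>(y := a)) v))" by auto
  have "inj_on \<pi> (fv u)" using cut_free_app.prems(1) by (auto intro: inj_on_subset)
  then have "cut_free e' U (subst (\<lambda>v. Var (\<pi> v)) u) L"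
    using cut_free_app.prems by (auto intro!: cut_free_app.IH)
  moreover have "cut_free (e'(a := R)) C (subst (\<lambda>v. Var ((\<pi>(y := a)) v)) t) L'"
  proof (rule cut_free_app.IH)
    have "inj_on \<pi> (fv t - {y})" using cut_free_app.prems(1) by (auto intro: inj_on_subset)
    then show "inj_on (\<pi>(y := a)) (fv t)" using a(1) by (auto simp: inj_on_def)
  qed (use cut_free_app.prems a(1) in auto)
  moreover have "e' (\<pi> z) = U \<multimap> R" using cut_free_app by auto
  moreover have "\<pi> z \<notin> \<pi> ` (fv t - {y})" "\<pi> z \<notin> \<pi> ` fv u" "\<pi> ` fv u \<inter> \<pi> ` (fv t - {y}) = {}"
    using cut_free_app.prems(1) cut_free_app.hyps unfolding inj_on_def by (simp_all; blast)+
  then have "\<pi> z \<notin> fv (subst (\<lambda>v. Var ((\<pi>(y := a)) v)) t) - {a}" "\<pi> z \<notin> fv (subst (\<lambda>v. Var (\<pi> v)) u)"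
    "fv (subst (\<lambda>v. Var (\<pi> v)) u) \<inter> (fv (subst (\<lambda>v. Var ((\<pi>(y := a)) v)) t) - {a}) = {}"
    by (auto split: if_splits)
  moreover have "a \<in> fv (subst (\<lambda>v. Var ((\<pi>(y := a)) v)) t)" using cut_free_app.hyps by auto
  ultimately show ?case unfolding subst.simps(1,2) a(2) eq
    by (intro cut_free.cut_free_app)
qed

text \<open>Lets the next induction rule run on the size: its premises concern renamed bodies, which
  are not subterms.\<close>

lemma size_rename: "size (subst (\<lambda>v. Var (\<pi> v)) s) = size s"
proof (induction s arbitrary: \<pi>)
  case (Fn x s)
  obtain z where z: 
    "subst (\<lambda>v. Var (\<pi> v)) (Fn x s) = Fn z (subst ((\<lambda>v. Var (\<pi> v))(x := Var z)) s)"
    by (rule subst_fn_obtain)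
  have eq: "(\<lambda>v. Var (\<pi> v))(x := Var z) = (\<lambda>v. Var ((\<pi>(x := z)) v))" by auto
  show ?case unfolding z eq trm.size Fn ..
next
  case (LetTup x y s t)
  obtain a b where z: "subst (\<lambda>v. Var (\<pi> v)) (LetTup x y s t)
      = LetTup a b (subst (\<lambda>v. Var (\<pi> v)) s) (subst ((\<lambda>v. Var (\<pi> v))(x := Var a, y := Var b)) t)"
    by (rule subst_let_obtain)
  have eq: "(\<lambda>v. Var (\<pi> v))(x := Var a, y := Var b) = (\<lambda>v. Var ((\<pi>(x := a, y := b)) v))" by auto
  show ?case unfolding z eq trm.size LetTup ..
qed auto

lemma cut_free_rename1:
  assumes "cut_free (e(x := A)) B s L" "x \<in> fv s" "z \<notin> fv s - {x}"
  shows "cut_free (e(z := A)) B (subst (Var(x := Var z)) s) L" "z \<in> fv (subst (Var(x := Var z)) s)"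
    "size (subst (Var(x := Var z)) s) = size s" "Fn x s \<approx> Fn z (subst (Var(x := Var z)) s)"
    "fv (subst (Var(x := Var z)) s) - {z} = fv s - {x}"
proof -
  have eq: "Var(x := Var z) = (\<lambda>v. Var ((id(x := z)) v))" by auto
  show "cut_free (e(z := A)) B (subst (Var(x := Var z)) s) L"
    unfolding eq by (rule cut_free_rename[OF assms(1)]) (use assms in \<open>auto simp: inj_on_def\<close>)
  show "size (subst (Var(x := Var z)) s) = size s" unfolding eq by (rule size_rename)
  show "Fn x s \<approx> Fn z (subst (Var(x := Var z)) s)"
    by (rule conv_alpha_fn) (use assms cut_free_lin in auto)
qed (use assms in \<open>auto split: if_splits\<close>)

lemma cut_free_rename2:
  assumes "cut_free (e(x := A, y := B)) C s L" "x \<in> fv s" "y \<in> fv s" "x \<noteq> y"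
    "{a, b} \<inter> (fv s - {x, y}) = {}" "a \<noteq> b" "z \<notin> fv s - {x, y}"
  shows "cut_free (e(a := A, b := B)) C (subst (Var(x := Var a, y := Var b)) s) L"
    "a \<in> fv (subst (Var(x := Var a, y := Var b)) s)" "b \<in> fv (subst (Var(x := Var a, y := Var b)) s)"
    "size (subst (Var(x := Var a, y := Var b)) s) = size s"
    "LetTup x y (Var z) s \<approx> LetTup a b (Var z) (subst (Var(x := Var a, y := Var b)) s)"
    "fv (subst (Var(x := Var a, y := Var b)) s) - {a, b} = fv s - {x, y}"
proof -
  have eq: "Var(x := Var a, y := Var b) = (\<lambda>v. Var ((id(x := a, y := b)) v))" by auto
  show "cut_free (e(a := A, b := B)) C (subst (Var(x := Var a, y := Var b)) s) L"
    unfolding eq by (rule cut_free_rename[OF assms(1)]) (use assms in \<open>auto simp: inj_on_def\<close>)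
  show "size (subst (Var(x := Var a, y := Var b)) s) = size s" unfolding eq by (rule size_rename)
  show "LetTup x y (Var z) s \<approx> LetTup a b (Var z) (subst (Var(x := Var a, y := Var b)) s)"
    by (rule conv_alpha_let) (use assms cut_free_lin in auto)
  have f: "fv (subst (Var(x := Var a, y := Var b)) s) = {a, b} \<union> (fv s - {x, y})"
    unfolding fv_subst UN_fv_upd2[OF assms(2-4)] by auto
  show "a \<in> fv (subst (Var(x := Var a, y := Var b)) s)" "b \<in> fv (subst (Var(x := Var a, y := Var b)) s)"
    "fv (subst (Var(x := Var a, y := Var b)) s) - {a, b} = fv s - {x, y}"
    unfolding f using assms(5) by auto
qed

text \<open>A variable convention for \<open>cut_free\<close>: binders may be assumed to avoid a
  finite set \<open>F\<close>, and bodies to avoid the other variables of the rule. The price is the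
  case \<open>conv\<close>, which asks for invariance of \<open>P\<close> under conversion.\<close>

lemma cut_free_strong_induct [consumes 2, case_names conv ax fn tup letc app]:
  assumes "cut_free e A s L" "finite F"
    and conv: "\<And>e A s s' L. P e A s' L \<Longrightarrow> s \<approx> s' \<Longrightarrow> P e A s L"
    and ax: "\<And>e x i j. e x = TVar i \<Longrightarrow> P e (TVar j) (Var x) {(i, j)}"
    and fn: "\<And>e x A B s L. cut_free (e(x := A)) B s L \<Longrightarrow> P (e(x := A)) B s L \<Longrightarrow> x \<in> fv s \<Longrightarrow> x \<notin> F
       \<Longrightarrow> P e (A \<multimap> B) (Fn x s) L"
    and tup: "\<And>e A B s t L L'. cut_free e A s L \<Longrightarrow> cut_free e B t L' \<Longrightarrow> P e A s L \<Longrightarrow> P e B t L' \<Longrightarrow> fv s \<inter> fv t = {}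
       \<Longrightarrow> P e (A \<otimes> B) (Tup s t) (L \<union> L')"
    and letc: "\<And>e z X Y x y C t L. e z = X \<otimes> Y \<Longrightarrow> cut_free (e(x := X, y := Y)) C t L \<Longrightarrow> P (e(x := X, y := Y)) C t L
       \<Longrightarrow> x \<in> fv t \<Longrightarrow> y \<in> fv t \<Longrightarrow> x \<noteq> y \<Longrightarrow> z \<notin> fv t \<Longrightarrow> x \<notin> F \<Longrightarrow> y \<notin> F
       \<Longrightarrow> P e C (LetTup x y (Var z) t) L"
    and app: "\<And>e z U R u L y C t L'. e z = U \<multimap> R \<Longrightarrow> cut_free e U u L \<Longrightarrow> P e U u L \<Longrightarrow> cut_free (e(y := R)) C t L'
       \<Longrightarrow> P (e(y := R)) C t L' \<Longrightarrow> y \<in> fv t \<Longrightarrow> z \<notin> fv u \<Longrightarrow> z \<notin> fv t \<Longrightarrow> fv u \<inter> fv t = {}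
       \<Longrightarrow> y \<notin> F \<Longrightarrow> P e C (App (Fn y t) (App (Var z) u)) (L \<union> L')"
  shows "P e A s L"
  using assms(1)
proof (induction "size s" arbitrary: e A s L rule: less_induct)
  case less
  from less.prems show ?case
  proof cases
    case (cut_free_ax x i j)
    then show ?thesis using ax by simp
  next
    case (cut_free_fn x A B t)
    obtain z where "z \<notin> F \<union> fv t" using \<open>finite F\<close> by (metis ex_new_if_finite finite_UnI finite_fv infinite_UNIV_nat)
    then have z: "z \<notin> F" "z \<notin> fv t - {x}" by auto
    note r = cut_free_rename1[OF cut_free_fn(3,4) z(2)]
    have "P e (A \<multimap> B) (Fn z (subst (Var(x := Var z)) t)) L"
      by (rule fn[OF r(1) less.hyps r(2) z(1)]) (use r cut_free_fn in auto)
    then show ?thesis using r(4) cut_free_fn conv by blast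
  next
    case (cut_free_tup A s1 L1 B s2 L2)
    have "P e A s1 L1" "P e B s2 L2" by (rule less.hyps; use cut_free_tup in simp)+
    then show ?thesis unfolding cut_free_tup(1,2,3) using cut_free_tup(4-6) by (intro tup)
  next
    case (cut_free_let z X Y x y t)
    have "finite (F \<union> fv t \<union> {z})" using \<open>finite F\<close> by simp
    then obtain a where a: "a \<notin> F \<union> fv t \<union> {z}" by (metis ex_new_if_finite infinite_UNIV_nat)
    have "finite (insert a (F \<union> fv t \<union> {z}))" using \<open>finite F\<close> by simp
    then obtain b where b: "b \<notin> insert a (F \<union> fv t \<union> {z})" by (metis ex_new_if_finite infinite_UNIV_nat)
    have ab: "{a, b} \<inter> (fv t - {x, y}) = {}" "a \<noteq> b" using a b by auto
    note r = cut_free_rename2[OF cut_free_let(3-6) ab cut_free_let(7)]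
    have zf: "z \<notin> fv (subst (Var(x := Var a, y := Var b)) t)" using r(6) cut_free_let(7) a b by blast
    have "P e A (LetTup a b (Var z) (subst (Var(x := Var a, y := Var b)) t)) L"
      by (rule letc[OF cut_free_let(2) r(1) less.hyps r(2,3) ab(2) zf]) (use r a b cut_free_let in auto)
    then show ?thesis using r(5) cut_free_let conv by blast
  next
    case (cut_free_app z U R u L1 y t L2)
    have "finite (F \<union> fv t \<union> {z} \<union> fv u)" using \<open>finite F\<close> by simp
    then obtain a where a: "a \<notin> F \<union> fv t \<union> {z} \<union> fv u" by (metis ex_new_if_finite infinite_UNIV_nat)
    then have a': "a \<notin> fv t - {y}" by auto
    note r = cut_free_rename1[OF cut_free_app(5,6) a']
    let ?t = "subst (Var(y := Var a)) t"
    have zf: "z \<notin> fv ?t" "fv u \<inter> fv ?t = {}" using r(5) cut_free_app a by blast+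
    have "P e A (App (Fn a ?t) (App (Var z) u)) (L1 \<union> L2)"
      by (rule app[OF cut_free_app(3,4) less.hyps r(1) less.hyps r(2) cut_free_app(7) zf]) (use r a cut_free_app in auto)
    moreover have "s \<approx> App (Fn a ?t) (App (Var z) u)"
      unfolding cut_free_app using r(4) cut_free_app cut_free_lin[OF less.prems] by (intro conv_App) auto
    ultimately show ?thesis using cut_free_app conv by blast
  qed
qed

subsection \<open>Coherence: the links determine the term\<close>

primrec labs :: "ty \<Rightarrow> nat set" where
  "labs (TVar a) = {a}"
| "labs (A \<otimes> B) = labs A \<union> labs B"
| "labs (A \<multimap> B) = labs A \<union> labs B"

primrec distinct_labs :: "ty \<Rightarrow> bool" where
  "distinct_labs (TVar a) = True"
| "distinct_labs (A \<otimes> B) = (distinct_labs A \<and> distinct_labs B \<and> labs A \<inter> labs B = {})"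
| "distinct_labs (A \<multimap> B) = (distinct_labs A \<and> distinct_labs B \<and> labs A \<inter> labs B = {})"

lemma labs_nonempty [simp]: "labs A \<noteq> {}"
  by (induction A) auto

section \<open>Bipartitions of the labels that no link crosses\<close>

definition pure :: "nat set \<Rightarrow> ty \<Rightarrow> bool" where
  "pure S A \<longleftrightarrow> labs A \<subseteq> S \<or> labs A \<inter> S = {}"

definition resp :: "nat set \<Rightarrow> (nat \<times> nat) set \<Rightarrow> bool" where
  "resp S L \<longleftrightarrow> (\<forall>(i, j)\<in>L. i \<in> S \<longleftrightarrow> j \<in> S)"

lemma pure_compl [simp]: "pure (- S) A = pure S A"
  unfolding pure_def by auto

lemma resp_compl [simp]: "resp (- S) L = resp S L"
  unfolding resp_def by auto

lemma resp_Un [simp]: "resp S (L \<union> L') \<longleftrightarrow> resp S L \<and> resp S L'"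
  unfolding resp_def by auto

lemma pure_components: "pure S (A \<otimes> B) \<Longrightarrow> pure S A \<and> pure S B" "pure S (A \<multimap> B) \<Longrightarrow> pure S A \<and> pure S B"
  unfolding pure_def by auto

lemma not_subset_disjoint: "labs A \<subseteq> S \<Longrightarrow> labs A \<inter> S \<noteq> {}"
  using labs_nonempty[of A] by (simp add: Int_absorb2)

lemma disjoint_by_labs:
  assumes "\<And>x. x \<in> X \<Longrightarrow> labs (e x) \<subseteq> S" "\<And>x. x \<in> Y \<Longrightarrow> labs (e x) \<inter> S = {}"
  shows "X \<inter> Y = {}"
  using assms not_subset_disjoint by blast

lemma cut_free_labs: "cut_free e A s L \<Longrightarrow> (i, j) \<in> L \<Longrightarrow> {i, j} \<subseteq> labs A \<union> (\<Union>x\<in>fv s. labs (e x))"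
proof (induction rule: cut_free.induct)
  case (cut_free_fn e x A B s L)
  then have "{i, j} \<subseteq> labs B \<union> (\<Union>v\<in>fv s. labs ((e(x := A)) v))" by blast
  also have "\<dots> \<subseteq> labs B \<union> (labs A \<union> (\<Union>v\<in>fv s - {x}. labs (e v)))" by (auto split: if_splits)
  finally show ?case by auto
next
  case (cut_free_let e z X Y x y C t L)
  then have "{i, j} \<subseteq> labs C \<union> (\<Union>v\<in>fv t. labs ((e(x := X, y := Y)) v))" by blast
  also have "\<dots> \<subseteq> labs C \<union> (labs (e z) \<union> (\<Union>v\<in>fv t - {x, y}. labs (e v)))" using cut_free_let.hyps by (auto split: if_splits)
  finally show ?case by auto
next
  case (cut_free_app e z U R u L y C t L')
  have *: "(\<Union>v\<in>fv t. labs ((e(y := R)) v)) \<subseteq> labs R \<union> (\<Union>v\<in>fv t - {y}. labs (e v))"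
    by (auto split: if_splits)
  from cut_free_app.prems have "{i, j} \<subseteq> labs U \<union> (\<Union>v\<in>fv u. labs (e v)) \<or> {i, j} \<subseteq> labs C \<union> (\<Union>v\<in>fv t. labs ((e(y := R)) v))"
    using cut_free_app.IH by blast
  then have "{i, j} \<subseteq> labs U \<union> (\<Union>v\<in>fv u. labs (e v)) \<union> labs C \<union> labs R \<union> (\<Union>v\<in>fv t - {y}. labs (e v))"
    using * by blast
  then show ?case using cut_free_app.hyps(1) by auto
qed auto

text \<open>No provable sequent splits into two link-closed parts, because every rule but the axiom
  has a principal formula, all of whose labels lie on one side.\<close>

lemma cut_free_connected:
  "cut_free e A s L \<Longrightarrow> resp S L \<Longrightarrow> (\<And>x. x \<in> fv s \<Longrightarrow> pure S (e x)) \<Longrightarrow> pure S A \<Longrightarrow> labs A \<subseteq> S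
    \<Longrightarrow> x \<in> fv s \<Longrightarrow> labs (e x) \<subseteq> S"
proof (induction arbitrary: x rule: cut_free.induct)
  case (cut_free_ax e x i j)
  then show ?case by (auto simp: resp_def)
next
  case (cut_free_fn e v A B s L)
  have "labs ((e(v := A)) x) \<subseteq> S"
  proof (rule cut_free_fn.IH)
    show "pure S ((e(v := A)) w)" if "w \<in> fv s" for w
      using cut_free_fn.prems pure_components(2)[of S A B] that by auto
  qed (use cut_free_fn.prems pure_components(2)[of S A B] in auto)
  then show ?case using cut_free_fn.prems by auto
next
  case (cut_free_tup e A s L B t L')
  then show ?case using pure_components(1)[of S A B] by auto
next
  case (cut_free_let e z X Y x' y' C t L)
  have z: "pure S (X \<otimes> Y)" using cut_free_let.prems(2)[of z] cut_free_let.hyps(1) by simp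
  have *: "labs ((e(x' := X, y' := Y)) w) \<subseteq> S" if "w \<in> fv t" for w
  proof (rule cut_free_let.IH)
    show "pure S ((e(x' := X, y' := Y)) w)" if "w \<in> fv t" for w
      using cut_free_let.prems(2) pure_components(1)[OF z] that by auto
  qed (use cut_free_let.prems that in auto)
  show ?case
  proof (cases "x = z")
    case True
    have "labs X \<subseteq> S" "labs Y \<subseteq> S" using *[of x'] *[of y'] cut_free_let.hyps by auto
    then show ?thesis using True cut_free_let.hyps(1) by simp
  next
    case False
    then show ?thesis using cut_free_let.prems(5) *[of x] by auto
  qed
next
  case (cut_free_app e z U R u L y C t L')
  have z: "pure S (U \<multimap> R)" using cut_free_app.prems(2)[of z] cut_free_app.hyps(1) by simp
  have *: "labs ((e(y := R)) w) \<subseteq> S" if "w \<in> fv t" for w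
  proof (rule cut_free_app.IH(2))
    show "pure S ((e(y := R)) w)" if "w \<in> fv t" for w
      using cut_free_app.prems(2) pure_components(2)[OF z] that by auto
  qed (use cut_free_app.prems that in auto)
  have "labs R \<subseteq> S" using *[of y] cut_free_app.hyps by auto
  \<comment> \<open>Purity carries the side of \<open>R\<close> over to \<open>U\<close>; now the
    goal of the argument \<open>u\<close> lies in \<open>S\<close>, and the hypothesis on
    \<open>u\<close> applies.\<close>
  then have U: "labs (U \<multimap> R) \<subseteq> S" using z not_subset_disjoint[of R S] unfolding pure_def by auto
  have "labs (e w) \<subseteq> S" if "w \<in> fv u" for w
    by (rule cut_free_app.IH(1)) (use cut_free_app.prems that U pure_components(2)[OF z] in auto)
  moreover have "labs (e x) \<subseteq> S" if "x \<in> fv t - {y}"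
    using *[of x] that by simp
  ultimately show ?case using cut_free_app.prems(5) cut_free_app.hyps(1) U by (cases "x = z") auto
qed

text \<open>\<open>cut_free_connected\<close> for the complement of \<open>S\<close>.\<close>

lemma cut_free_disconnected:
  assumes "cut_free e A s L" "resp S L" "\<And>x. x \<in> fv s \<Longrightarrow> pure S (e x)" "labs A \<inter> S = {}" "x \<in> fv s"
  shows "labs (e x) \<inter> S = {}"
  using cut_free_connected[of e A s L "- S" x] assms unfolding pure_compl resp_compl pure_def by blast

text \<open>The right rule of \<open>\<otimes>\<close> is not invertible in general, but links that
  respect a cut between \<open>A\<close> and \<open>B\<close> make it so. A left rule at the end of
  the proof is moved into the component that contains its bound variables. These cannot be spread
  over both components, because connectedness puts the labels of one component inside
  \<open>S\<close> and those of the other outside.\<close>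

lemma split_tup:
  assumes "cut_free e T s L" "T = A \<otimes> B" "resp S L" "labs A \<subseteq> S" "labs B \<inter> S = {}"
    "\<And>x. x \<in> fv s \<Longrightarrow> pure S (e x)"
  shows "\<exists>s' s'' L' L''. s \<preceq> Tup s' s'' \<and> cut_free e A s' L' \<and> cut_free e B s'' L'' \<and> L = L' \<union> L''"
  using assms
proof (induction rule: cut_free.induct)
  case (cut_free_tup e A' s L' B' t L'')
  have "lin (Tup s t)" using cut_free_tup.hyps cut_free_lin by auto
  then have "Tup s t \<preceq> Tup s t" by (rule ref_refl)
  moreover have "A' = A" "B' = B" using cut_free_tup.prems(1) by auto
  ultimately show ?case using cut_free_tup.hyps(1,2) by blast
next
  case (cut_free_let e z X Y x y C t L)
  let ?e = "e(x := X, y := Y)"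
  have z: "pure S (X \<otimes> Y)" using cut_free_let.prems(5)[of z] cut_free_let.hyps(1) by simp
  have p: "pure S (?e v)" if "v \<in> fv t" for v
    using cut_free_let.prems(5) pure_components(1)[OF z] that by auto
  then obtain t1 t2 L1 L2 where t: "t \<preceq> Tup t1 t2" "cut_free ?e A t1 L1" "cut_free ?e B t2 L2" "L = L1 \<union> L2"
    using cut_free_let.IH cut_free_let.prems by blast
  have r: "resp S L1" "resp S L2" using cut_free_let.prems(2) t(4) by auto
  have f: "fv t = fv t1 \<union> fv t2" "fv t1 \<inter> fv t2 = {}" using refD[OF t(1)] by auto
  have S1: "labs (?e v) \<subseteq> S" if "v \<in> fv t1" for v
    by (rule cut_free_connected[OF t(2)]) (use r p f cut_free_let.prems(3) that in \<open>auto simp: pure_def\<close>)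
  have S2: "labs (?e v) \<inter> S = {}" if "v \<in> fv t2" for v
    by (rule cut_free_disconnected[OF t(3)]) (use r p f cut_free_let.prems(4) that in \<open>auto simp: pure_def\<close>)
  have l: "lin (LetTup x y (Var z) t)" using cut_free_lin[OF cut_free_let.hyps(2)] cut_free_let.hyps by auto
  \<comment> \<open>Purity of the principal formula keeps \<open>x\<close> and \<open>y\<close> on
    the same side, hence in the same component.\<close>
  have "labs X \<subseteq> S \<and> labs Y \<subseteq> S \<or> labs X \<inter> S = {} \<and> labs Y \<inter> S = {}"
    using z unfolding pure_def by auto
  then show ?case
  proof
    assume "labs X \<subseteq> S \<and> labs Y \<subseteq> S"
    then have "x \<notin> fv t2" "y \<notin> fv t2" using S2[of x] S2[of y] cut_free_let.hyps(5) not_subset_disjoint by auto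
    then have xy: "x \<in> fv t1" "y \<in> fv t1" "x \<notin> fv t2" "y \<notin> fv t2" using f cut_free_let.hyps by auto
    have "LetTup x y (Var z) t \<preceq> plug (TupL Hole t2) (LetTup x y (Var z) t1)"
      using t(1) l xy by (intro ref_comm_let') auto
    moreover have "cut_free e A (LetTup x y (Var z) t1) L1"
      using cut_free_let.hyps xy f t(2) by (intro cut_free.cut_free_let) auto
    moreover have "cut_free e B t2 L2" using t(3) by (rule cut_free_cong) (use xy in auto)
    ultimately show ?thesis using t(4) by auto
  next
    assume "labs X \<inter> S = {} \<and> labs Y \<inter> S = {}"
    then have "x \<notin> fv t1" "y \<notin> fv t1" using S1[of x] S1[of y] cut_free_let.hyps(5) not_subset_disjoint by auto
    then have xy: "x \<in> fv t2" "y \<in> fv t2" "x \<notin> fv t1" "y \<notin> fv t1" using f cut_free_let.hyps by auto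
    have "LetTup x y (Var z) t \<preceq> plug (TupR t1 Hole) (LetTup x y (Var z) t2)"
      using t(1) l xy by (intro ref_comm_let') auto
    moreover have "cut_free e B (LetTup x y (Var z) t2) L2"
      using cut_free_let.hyps xy f t(3) by (intro cut_free.cut_free_let) auto
    moreover have "cut_free e A t1 L1" using t(2) by (rule cut_free_cong) (use xy in auto)
    ultimately show ?thesis using t(4) by auto
  qed
next
  case (cut_free_app e z U R u L y C t L')
  let ?e = "e(y := R)"
  have z: "pure S (U \<multimap> R)" using cut_free_app.prems(5)[of z] cut_free_app.hyps(1) by simp
  have p: "pure S (?e v)" if "v \<in> fv t" for v
    using cut_free_app.prems(5) pure_components(2)[OF z] that by auto
  have "resp S L'" using cut_free_app.prems(2) by simp
  from cut_free_app.IH(2)[OF cut_free_app.prems(1) this cut_free_app.prems(3,4) p]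
  obtain t1 t2 L1 L2 where t: "t \<preceq> Tup t1 t2" "cut_free ?e A t1 L1" "cut_free ?e B t2 L2" "L' = L1 \<union> L2"
    by blast
  have r: "resp S L1" "resp S L2" using cut_free_app.prems(2) t(4) by auto
  have f: "fv t = fv t1 \<union> fv t2" "fv t1 \<inter> fv t2 = {}" using refD[OF t(1)] by auto
  have l: "lin (App (Fn y t) (App (Var z) u))"
    using cut_free_lin[OF cut_free_app.hyps(2)] cut_free_lin[OF cut_free_app.hyps(3)] cut_free_app.hyps by auto
  \<comment> \<open>A single variable is bound here, and the whole argument
    \<open>App (Var z) u\<close> follows it.\<close>
  show ?case
  proof (cases "y \<in> fv t1")
    case True
    then have xy: "y \<in> fv t1" "y \<notin> fv t2" using f by auto
    have "App (Fn y t) (App (Var z) u) \<preceq> plug (TupL Hole t2) (App (Fn y t1) (App (Var z) u))"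
      using t(1) l xy by (intro ref_comm_fn') auto
    moreover have "cut_free e A (App (Fn y t1) (App (Var z) u)) (L \<union> L1)"
      using cut_free_app.hyps xy f t(2) by (intro cut_free.cut_free_app) auto
    moreover have "cut_free e B t2 L2" using t(3) by (rule cut_free_cong) (use xy in auto)
    ultimately show ?thesis using t(4) by (metis plug.simps(1,5) sup_assoc)
  next
    case False
    then have xy: "y \<in> fv t2" "y \<notin> fv t1" using f cut_free_app.hyps by auto
    have "App (Fn y t) (App (Var z) u) \<preceq> plug (TupR t1 Hole) (App (Fn y t2) (App (Var z) u))"
      using t(1) l xy by (intro ref_comm_fn') auto
    moreover have "cut_free e B (App (Fn y t2) (App (Var z) u)) (L \<union> L2)"
      using cut_free_app.hyps xy f t(3) by (intro cut_free.cut_free_app) auto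
    moreover have "cut_free e A t1 L1" using t(2) by (rule cut_free_cong) (use xy in auto)
    ultimately show ?thesis using t(4) by (metis plug.simps(1,6) sup_left_commute)
  qed
qed auto

text \<open>The right rule of \<open>\<multimap>\<close> is invertible: each left rule at the end of
  the proof permutes above it. The bound name \<open>x\<close> is prescribed, so that two proofs can
  be given the same binder.\<close>

lemma inv_fn:
  assumes "cut_free e T s L" "T = A \<multimap> B" "x \<notin> fv s"
  shows "\<exists>t. s \<preceq> Fn x t \<and> cut_free (e(x := A)) B t L"
proof -
  have "finite {x}" by simp
  from assms(1) this show ?thesis using assms(2,3)
  proof (induction rule: cut_free_strong_induct)
    case (conv e T s s' L)
    then show ?case by (metis conv_fv ref_conv_trans(2))
  next
    case (fn e x' A' B' s L)
    have x: "x \<notin> fv s - {x'}" using fn.prems by simp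
    note r = cut_free_rename1[OF fn.hyps(1,2) x]
    have "A' = A" "B' = B" using fn.prems(1) by auto
    then show ?case using r(1) convD(1)[OF r(4)] by blast
  next
    case (letc e z X Y x' y' C t L)
    then have x: "x \<noteq> x'" "x \<noteq> y'" "x \<noteq> z" "x \<notin> fv t" by auto
    have "\<exists>t'. t \<preceq> Fn x t' \<and> cut_free (e(x' := X, y' := Y, x := A)) B t' L"
      by (rule letc.IH) (use x letc.prems in auto)
    then obtain t' where t': "t \<preceq> Fn x t'" "cut_free (e(x' := X, y' := Y, x := A)) B t' L" by blast
    have f: "fv t = fv t' - {x}" "x \<in> fv t'" using refD[OF t'(1)] by auto
    have "LetTup x' y' (Var z) t \<preceq> plug (FnC x Hole) (LetTup x' y' (Var z) t')"
      using t'(1) letc.hyps cut_free_lin[OF letc.hyps(2)] x f by (intro ref_comm_let') auto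
    moreover have "cut_free (e(x := A)) B (LetTup x' y' (Var z) t') L"
    proof (rule cut_free.cut_free_let)
      show "cut_free (e(x := A, x' := X, y' := Y)) B t' L" using t'(2) by (rule cut_free_cong) (use x in auto)
    qed (use letc.hyps x f in auto)
    ultimately show ?case unfolding plug.simps by blast
  next
    case (app e z U R u L y C t L')
    then have x: "x \<noteq> y" "x \<noteq> z" "x \<notin> fv t" "x \<notin> fv u" by auto
    have "\<exists>t'. t \<preceq> Fn x t' \<and> cut_free (e(y := R, x := A)) B t' L'"
      by (rule app.IH(2)) (use x app.prems in auto)
    then obtain t' where t': "t \<preceq> Fn x t'" "cut_free (e(y := R, x := A)) B t' L'" by blast
    have f: "fv t = fv t' - {x}" "x \<in> fv t'" using refD[OF t'(1)] by auto
    have "App (Fn y t) (App (Var z) u) \<preceq> plug (FnC x Hole) (App (Fn y t') (App (Var z) u))"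
      using t'(1) app.hyps cut_free_lin[OF app.hyps(2)] cut_free_lin[OF app.hyps(3)] x f by (intro ref_comm_fn') auto
    moreover have "cut_free (e(x := A)) B (App (Fn y t') (App (Var z) u)) (L \<union> L')"
    proof (rule cut_free.cut_free_app)
      show "cut_free (e(x := A, y := R)) B t' L'" using t'(2) by (rule cut_free_cong) (use x in auto)
      show "cut_free (e(x := A)) U u L" using app.hyps(2) by (rule cut_free_cong) (use x in auto)
    qed (use app.hyps x f in auto)
    ultimately show ?case unfolding plug.simps by blast
  qed auto
qed


text \<open>The left rule of \<open>\<otimes>\<close> is invertible: the elimination of
  \<open>z\<close> is pulled outward through whatever rule comes last, with prescribed bound
  names.\<close>

lemma inv_let:
  assumes "cut_free e C s L" "e z = X \<otimes> Y" "z \<in> fv s" "x \<notin> fv s" "y \<notin> fv s" "x \<noteq> y"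
  shows "\<exists>t. s \<preceq> LetTup x y (Var z) t \<and> cut_free (e(x := X, y := Y)) C t L"
proof -
  have "finite {x, y, z}" by simp
  from assms(1) this show ?thesis using assms(2-5)
  proof (induction rule: cut_free_strong_induct)
    case (conv e T s s' L)
    then show ?case by (metis conv_fv ref_conv_trans(2))
  next
    case (fn e a A B s L)
    then have a: "a \<noteq> x" "a \<noteq> y" "a \<noteq> z" "x \<notin> fv s" "y \<notin> fv s" "z \<in> fv s" by auto
    have "\<exists>t. s \<preceq> LetTup x y (Var z) t \<and> cut_free (e(a := A, x := X, y := Y)) B t L"
      by (rule fn.IH) (use a fn.prems in auto)
    then obtain t where t: "s \<preceq> LetTup x y (Var z) t" "cut_free (e(a := A, x := X, y := Y)) B t L"
      by blast
    have "plug (FnC a Hole) s \<preceq> LetTup x y (Var z) (plug (FnC a Hole) t)"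
      by (rule ref_comm_let[OF t(1)]) (use fn.hyps cut_free_lin[OF fn.hyps(1)] a in auto)
    moreover have "cut_free (e(x := X, y := Y)) (A \<multimap> B) (Fn a t) L"
    proof (rule cut_free.cut_free_fn)
      show "cut_free (e(x := X, y := Y, a := A)) B t L" using t(2) by (rule cut_free_cong) (use a in auto)
      show "a \<in> fv t" using refD(3)[OF t(1)] fn.hyps a by auto
    qed
    ultimately show ?case unfolding plug.simps by blast
  next
    case (tup e A B s t L L')
    have l: "lin (Tup s t)" using tup.hyps cut_free_lin by auto
    have f: "x \<notin> fv s" "x \<notin> fv t" "y \<notin> fv s" "y \<notin> fv t" using tup.prems by auto
    show ?case
    proof (cases "z \<in> fv s")
      case True
      have "\<exists>u. s \<preceq> LetTup x y (Var z) u \<and> cut_free (e(x := X, y := Y)) A u L"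
        by (rule tup.IH(1)) (use True tup.prems f in auto)
      then obtain u where u: "s \<preceq> LetTup x y (Var z) u" "cut_free (e(x := X, y := Y)) A u L"
        by blast
      have "plug (TupL Hole t) s \<preceq> LetTup x y (Var z) (plug (TupL Hole t) u)"
        by (rule ref_comm_let[OF u(1)]) (use l f in auto)
      moreover have "cut_free (e(x := X, y := Y)) (A \<otimes> B) (Tup u t) (L \<union> L')"
      proof (rule cut_free.cut_free_tup[OF u(2)])
        show "cut_free (e(x := X, y := Y)) B t L'" using tup.hyps(2) by (rule cut_free_cong) (use f in auto)
        show "fv u \<inter> fv t = {}" using refD(3)[OF u(1)] f tup.hyps by auto
      qed
      ultimately show ?thesis unfolding plug.simps by blast
    next
      case False
      have "\<exists>u. t \<preceq> LetTup x y (Var z) u \<and> cut_free (e(x := X, y := Y)) B u L'"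
        by (rule tup.IH(2)) (use False tup.prems f in auto)
      then obtain u where u: "t \<preceq> LetTup x y (Var z) u" "cut_free (e(x := X, y := Y)) B u L'"
        by blast
      have "plug (TupR s Hole) t \<preceq> LetTup x y (Var z) (plug (TupR s Hole) u)"
        by (rule ref_comm_let[OF u(1)]) (use l f in auto)
      moreover have "cut_free (e(x := X, y := Y)) (A \<otimes> B) (Tup s u) (L \<union> L')"
      proof (rule cut_free.cut_free_tup[OF _ u(2)])
        show "cut_free (e(x := X, y := Y)) A s L" using tup.hyps(1) by (rule cut_free_cong) (use f in auto)
        show "fv s \<inter> fv u = {}" using refD(3)[OF u(1)] f tup.hyps by auto
      qed
      ultimately show ?thesis unfolding plug.simps by blast
    qed
  next
    case (letc e w V W a b C t L)
    have l: "lin (LetTup a b (Var w) t)" using cut_free_lin[OF letc.hyps(2)] letc.hyps by auto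
    have ne: "a \<noteq> x" "b \<noteq> x" "a \<noteq> y" "b \<noteq> y" "a \<noteq> z" "b \<noteq> z" using letc.hyps by auto
    then have f: "x \<notin> fv t" "y \<notin> fv t" "x \<noteq> w" "y \<noteq> w" using letc.prems by auto
    show ?case
    proof (cases "w = z")
      \<comment> \<open>The elimination is already outermost; only its bound names change.\<close>
      case True
      have d: "{x, y} \<inter> (fv t - {a, b}) = {}" "z \<notin> fv t - {a, b}" using f letc.hyps True by auto
      note r = cut_free_rename2[OF letc.hyps(2,3-5) d(1) \<open>x \<noteq> y\<close> d(2)]
      have "V = X" "W = Y" using True letc.hyps letc.prems by auto
      then show ?thesis using r(1) convD(1)[OF r(5)] True by blast
    next
      case False
      then have "z \<in> fv t" using letc.prems ne by auto
      have "\<exists>u. t \<preceq> LetTup x y (Var z) u \<and> cut_free (e(a := V, b := W, x := X, y := Y)) C u L"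
        by (rule letc.IH) (use \<open>z \<in> fv t\<close> ne f letc.prems in auto)
      then obtain u where u: "t \<preceq> LetTup x y (Var z) u" "cut_free (e(a := V, b := W, x := X, y := Y)) C u L"
        by blast
      have "plug (LetR a b (Var w) Hole) t \<preceq> LetTup x y (Var z) (plug (LetR a b (Var w) Hole) u)"
        by (rule ref_comm_let[OF u(1)]) (use l f ne in auto)
      moreover have "cut_free (e(x := X, y := Y)) C (LetTup a b (Var w) u) L"
      proof (rule cut_free.cut_free_let)
        show "cut_free (e(x := X, y := Y, a := V, b := W)) C u L" using u(2) by (rule cut_free_cong) (use ne in auto)
        show "(e(x := X, y := Y)) w = V \<otimes> W" using letc.hyps f by auto
        show "a \<in> fv u" "b \<in> fv u" "w \<notin> fv u - {a, b}" using refD(3)[OF u(1)] letc.hyps ne f by auto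
      qed (use letc.hyps in auto)
      ultimately show ?thesis unfolding plug.simps by blast
    qed
  next
    case (app e w U R u L y' C t L')
    have l: "lin (App (Fn y' t) (App (Var w) u))"
      using cut_free_lin[OF app.hyps(2)] cut_free_lin[OF app.hyps(3)] app.hyps by auto
    have ne: "y' \<noteq> x" "y' \<noteq> y" "y' \<noteq> z" using app.hyps by auto
    then have f: "x \<notin> fv t" "y \<notin> fv t" "x \<noteq> w" "y \<noteq> w" "x \<notin> fv u" "y \<notin> fv u" using app.prems by auto
    have "w \<noteq> z" using app.hyps app.prems by auto
    then consider "z \<in> fv t" | "z \<in> fv u" using app.prems by auto
    then show ?case
    proof cases
      case 1
      have "\<exists>r. t \<preceq> LetTup x y (Var z) r \<and> cut_free (e(y' := R, x := X, y := Y)) C r L'"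
        by (rule app.IH(2)) (use 1 ne f app.prems in auto)
      then obtain r where r: "t \<preceq> LetTup x y (Var z) r" "cut_free (e(y' := R, x := X, y := Y)) C r L'"
        by blast
      let ?C = "AppL (FnC y' Hole) (App (Var w) u)"
      have "plug ?C t \<preceq> LetTup x y (Var z) (plug ?C r)"
        by (rule ref_comm_let[OF r(1)]) (use l f ne in auto)
      moreover have "cut_free (e(x := X, y := Y)) C (App (Fn y' r) (App (Var w) u)) (L \<union> L')"
      proof (rule cut_free.cut_free_app)
        show "cut_free (e(x := X, y := Y, y' := R)) C r L'" using r(2) by (rule cut_free_cong) (use ne in auto)
        show "cut_free (e(x := X, y := Y)) U u L" using app.hyps(2) by (rule cut_free_cong) (use f in auto)
        show "(e(x := X, y := Y)) w = U \<multimap> R" using app.hyps f by auto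
        show "y' \<in> fv r" "w \<notin> fv r - {y'}" "fv u \<inter> (fv r - {y'}) = {}"
          using refD(3)[OF r(1)] app.hyps ne f by auto
      qed (use app.hyps in auto)
      ultimately show ?thesis unfolding plug.simps by blast
    next
      case 2
      have "\<exists>r. u \<preceq> LetTup x y (Var z) r \<and> cut_free (e(x := X, y := Y)) U r L"
        by (rule app.IH(1)) (use 2 ne f app.prems in auto)
      then obtain r where r: "u \<preceq> LetTup x y (Var z) r" "cut_free (e(x := X, y := Y)) U r L"
        by blast
      let ?C = "AppR (Fn y' t) (AppR (Var w) Hole)"
      have "plug ?C u \<preceq> LetTup x y (Var z) (plug ?C r)"
        by (rule ref_comm_let[OF r(1)]) (use l f ne in auto)
      moreover have "cut_free (e(x := X, y := Y)) C (App (Fn y' t) (App (Var w) r)) (L \<union> L')"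
      proof (rule cut_free.cut_free_app)
        show "cut_free (e(x := X, y := Y, y' := R)) C t L'" using app.hyps(3) by (rule cut_free_cong) (use ne f in auto)
        show "cut_free (e(x := X, y := Y)) U r L" by (rule r(2))
        show "(e(x := X, y := Y)) w = U \<multimap> R" using app.hyps f by auto
        show "w \<notin> fv r" "fv r \<inter> (fv t - {y'}) = {}"
          using refD(3)[OF r(1)] app.hyps ne f by auto
      qed (use app.hyps in auto)
      ultimately show ?thesis unfolding plug.simps by blast
    qed
  qed auto
qed

text \<open>Inversion of the left rule of \<open>\<multimap>\<close> relative to a cut of the labels
  with \<open>U\<close> inside, and \<open>R\<close> and the goal outside. By connectedness the free
  variables of \<open>u\<close> carry labels in \<open>S\<close> and those of \<open>t\<close>
  labels outside; this decides into which of the two a rule met on the way out has to be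
  moved.\<close>

lemma split_app:
  assumes "cut_free e A s L" "e z = U \<multimap> R" "z \<in> fv s" "y \<notin> fv s" "resp S L"
    "labs U \<subseteq> S" "labs R \<inter> S = {}" "labs A \<inter> S = {}" "\<And>x. x \<in> fv s \<Longrightarrow> x \<noteq> z \<Longrightarrow> pure S (e x)"
  shows "\<exists>u t Lu Lt. s \<preceq> App (Fn y t) (App (Var z) u) \<and> cut_free e U u Lu \<and> cut_free (e(y := R)) A t Lt \<and> L = Lu \<union> Lt"
proof -
  have "finite {y, z}" by simp
  from assms(1) this show ?thesis using assms(2-5,8,9)
  proof (induction rule: cut_free_strong_induct)
    case (conv e T s s' L)
    have f: "fv s = fv s'" by (rule conv_fv[OF conv.hyps])
    have "\<exists>u t Lu Lt. s' \<preceq> App (Fn y t) (App (Var z) u) \<and> cut_free e U u Lu \<and> cut_free (e(y := R)) T t Lt \<and> L = Lu \<union> Lt"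
      by (rule conv.IH) (use conv.prems f in auto)
    then show ?case using ref_conv_trans(2)[OF conv.hyps] by blast
  next
    case (fn e a A1 A2 s L)
    then have a: "a \<noteq> y" "a \<noteq> z" "y \<notin> fv s" "z \<in> fv s" by auto
    have p: "pure S ((e(a := A1)) x)" if "x \<in> fv s" "x \<noteq> z" for x
      using fn.prems(5,6) that by (auto simp: pure_def)
    have "\<exists>u t Lu Lt. s \<preceq> App (Fn y t) (App (Var z) u) \<and> cut_free (e(a := A1)) U u Lu \<and> cut_free (e(a := A1, y := R)) A2 t Lt \<and> L = Lu \<union> Lt"
      by (rule fn.IH) (use p a fn.prems in auto)
    then obtain u t Lu Lt where t: "s \<preceq> App (Fn y t) (App (Var z) u)" "cut_free (e(a := A1)) U u Lu" "cut_free (e(a := A1, y := R)) A2 t Lt" "L = Lu \<union> Lt"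
      by blast
    have f: "fv s = fv t - {y} \<union> {z} \<union> fv u" "z \<notin> fv u" using refD[OF t(1)] by auto
    \<comment> \<open>\<open>a\<close> has labels of the goal, hence outside \<open>S\<close>, while
      the free variables of \<open>u\<close> have theirs inside. So \<open>a\<close> stays with
      \<open>t\<close>, and the argument can be moved out of its scope.\<close>
    have au: "a \<notin> fv u"
    proof
      assume "a \<in> fv u"
      then have "labs ((e(a := A1)) a) \<subseteq> S"
      proof (rule cut_free_connected[OF t(2), rotated 4])
        show "pure S ((e(a := A1)) x)" if "x \<in> fv u" for x by (rule p) (use f that in auto)
      qed (use t(4) fn.prems assms in \<open>auto simp: pure_def\<close>)
      then show False using fn.prems(5) not_subset_disjoint[of A1 S] by auto
    qed
    have "plug (FnC a Hole) s \<preceq> App (Fn y (plug (FnC a Hole) t)) (App (Var z) u)"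
      by (rule ref_comm_fn[OF t(1)]) (use fn.hyps cut_free_lin[OF fn.hyps(1)] a au in auto)
    moreover have "cut_free (e(y := R)) (A1 \<multimap> A2) (Fn a t) Lt"
    proof (rule cut_free.cut_free_fn)
      show "cut_free (e(y := R, a := A1)) A2 t Lt" using t(3) by (rule cut_free_cong) (use a in auto)
      show "a \<in> fv t" using f au fn.hyps a by auto
    qed
    moreover have "cut_free e U u Lu" using t(2) by (rule cut_free_cong) (use au in auto)
    ultimately show ?case using t(4) unfolding plug.simps by blast
  next
    case (tup e A B s t L L')
    have l: "lin (Tup s t)" using tup.hyps cut_free_lin by auto
    have r: "resp S L" "resp S L'" "labs A \<inter> S = {}" "labs B \<inter> S = {}" using tup.prems by auto
    show ?case
    proof (cases "z \<in> fv s")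
      case True
      have "\<exists>u a Lu Lt. s \<preceq> App (Fn y a) (App (Var z) u) \<and> cut_free e U u Lu \<and> cut_free (e(y := R)) A a Lt \<and> L = Lu \<union> Lt"
        by (rule tup.IH(1)) (use True tup.prems r in auto)
      then obtain u a Lu Lt where u: "s \<preceq> App (Fn y a) (App (Var z) u)" "cut_free e U u Lu" "cut_free (e(y := R)) A a Lt" "L = Lu \<union> Lt"
        by blast
      have "plug (TupL Hole t) s \<preceq> App (Fn y (plug (TupL Hole t) a)) (App (Var z) u)"
        by (rule ref_comm_fn[OF u(1)]) (use l tup.prems in auto)
      moreover have "cut_free (e(y := R)) (A \<otimes> B) (Tup a t) (Lt \<union> L')"
      proof (rule cut_free.cut_free_tup[OF u(3)])
        show "cut_free (e(y := R)) B t L'" using tup.hyps(2) by (rule cut_free_cong) (use tup.prems in auto)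
        show "fv a \<inter> fv t = {}" using refD(3)[OF u(1)] tup.hyps tup.prems by auto
      qed
      moreover have "L \<union> L' = Lu \<union> (Lt \<union> L')" using u(4) by auto
      ultimately show ?thesis using u(2) unfolding plug.simps by blast
    next
      case False
      have "\<exists>u a Lu Lt. t \<preceq> App (Fn y a) (App (Var z) u) \<and> cut_free e U u Lu \<and> cut_free (e(y := R)) B a Lt \<and> L' = Lu \<union> Lt"
        by (rule tup.IH(2)) (use False tup.prems r in auto)
      then obtain u a Lu Lt where u: "t \<preceq> App (Fn y a) (App (Var z) u)" "cut_free e U u Lu" "cut_free (e(y := R)) B a Lt" "L' = Lu \<union> Lt"
        by blast
      have "plug (TupR s Hole) t \<preceq> App (Fn y (plug (TupR s Hole) a)) (App (Var z) u)"
        by (rule ref_comm_fn[OF u(1)]) (use l tup.prems in auto)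
      moreover have "cut_free (e(y := R)) (A \<otimes> B) (Tup s a) (L \<union> Lt)"
      proof (rule cut_free.cut_free_tup[OF _ u(3)])
        show "cut_free (e(y := R)) A s L" using tup.hyps(1) by (rule cut_free_cong) (use tup.prems in auto)
        show "fv s \<inter> fv a = {}" using refD(3)[OF u(1)] tup.hyps tup.prems by auto
      qed
      moreover have "L \<union> L' = Lu \<union> (L \<union> Lt)" using u(4) by auto
      ultimately show ?thesis using u(2) unfolding plug.simps by blast
    qed
  next
    case (letc e w V W a b C t L)
    have l: "lin (LetTup a b (Var w) t)" using cut_free_lin[OF letc.hyps(2)] letc.hyps by auto
    have ne: "a \<noteq> y" "b \<noteq> y" "a \<noteq> z" "b \<noteq> z" using letc.hyps by auto
    have wz: "w \<noteq> z" using letc.hyps letc.prems by auto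
    then have f: "y \<notin> fv t" "y \<noteq> w" "z \<in> fv t" using letc.prems ne by auto
    have w: "pure S (V \<otimes> W)" using letc.prems(6)[of w] wz letc.hyps(1) by simp
    have p: "pure S ((e(a := V, b := W)) x)" if "x \<in> fv t" "x \<noteq> z" for x
      using letc.prems(6) pure_components(1)[OF w] that by auto
    have "\<exists>u r Lu Lt. t \<preceq> App (Fn y r) (App (Var z) u) \<and> cut_free (e(a := V, b := W)) U u Lu \<and> cut_free (e(a := V, b := W, y := R)) C r Lt \<and> L = Lu \<union> Lt"
      by (rule letc.IH) (use ne f letc.prems p in auto)
    then obtain u r Lu Lt where u: "t \<preceq> App (Fn y r) (App (Var z) u)" "cut_free (e(a := V, b := W)) U u Lu" "cut_free (e(a := V, b := W, y := R)) C r Lt" "L = Lu \<union> Lt"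
      by blast
    have g: "fv t = fv r - {y} \<union> {z} \<union> fv u" "z \<notin> fv u" "z \<notin> fv r - {y}" "fv u \<inter> (fv r - {y}) = {}" "y \<in> fv r"
      using refD[OF u(1)] by auto
    have S1: "labs ((e(a := V, b := W)) v) \<subseteq> S" if "v \<in> fv u" for v
    proof (rule cut_free_connected[OF u(2) _ _ _ _ that])
      show "pure S ((e(a := V, b := W)) x)" if "x \<in> fv u" for x by (rule p) (use g that in auto)
    qed (use u(4) letc.prems assms in \<open>auto simp: pure_def\<close>)
    have S2: "labs ((e(a := V, b := W, y := R)) v) \<inter> S = {}" if "v \<in> fv r" for v
    proof (rule cut_free_disconnected[OF u(3) _ _ _ that])
      show "pure S ((e(a := V, b := W, y := R)) x)" if "x \<in> fv r" for x
        proof (cases "x = y")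
          case True
          then show ?thesis using assms(7) by (simp add: pure_def)
        next
          case False
          then have "x \<in> fv t" "x \<noteq> z" using g that by auto
          then show ?thesis using p[of x] False by simp
        qed
    qed (use u(4) letc.prems assms in \<open>auto simp: pure_def\<close>)
    \<comment> \<open>\<open>a\<close> and \<open>b\<close> lie on one side, and the elimination of
      \<open>w\<close> is moved into \<open>u\<close> or into \<open>r\<close> accordingly.\<close>
    have "labs V \<subseteq> S \<and> labs W \<subseteq> S \<or> labs V \<inter> S = {} \<and> labs W \<inter> S = {}"
      using w unfolding pure_def by auto
    then show ?case
    proof
      assume "labs V \<subseteq> S \<and> labs W \<subseteq> S"
      then have ab: "a \<notin> fv r" "b \<notin> fv r" using S2[of a] S2[of b] ne letc.hyps not_subset_disjoint by auto
      then have ab': "a \<in> fv u" "b \<in> fv u" using g letc.hyps ne by auto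
      have "LetTup a b (Var w) t \<preceq> plug (AppR (Fn y r) (AppR (Var z) Hole)) (LetTup a b (Var w) u)"
        by (rule ref_comm_let') (use u(1) l ab ab' in auto)
      moreover have "cut_free e U (LetTup a b (Var w) u) Lu"
        using letc.hyps(1,5) u(2) ab' g letc.hyps(6) by (intro cut_free.cut_free_let) auto
      moreover have "cut_free (e(y := R)) C r Lt" using u(3) by (rule cut_free_cong) (use ab ne in auto)
      ultimately show ?thesis using u(4) unfolding plug.simps by blast
    next
      assume "labs V \<inter> S = {} \<and> labs W \<inter> S = {}"
      then have ab: "a \<notin> fv u" "b \<notin> fv u" using S1[of a] S1[of b] ne letc.hyps not_subset_disjoint by auto
      then have ab': "a \<in> fv r" "b \<in> fv r" using g letc.hyps ne by auto
      have "LetTup a b (Var w) t \<preceq> plug (AppL (FnC y Hole) (App (Var z) u)) (LetTup a b (Var w) r)"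
        by (rule ref_comm_let') (use u(1) l ab ab' ne f in auto)
      moreover have "cut_free (e(y := R)) C (LetTup a b (Var w) r) Lt"
      proof (rule cut_free.cut_free_let)
        show "cut_free (e(y := R, a := V, b := W)) C r Lt" using u(3) by (rule cut_free_cong) (use ne in auto)
        show "w \<notin> fv r - {a, b}" using g letc.hyps(6) f by auto
      qed (use letc.hyps(1,5) f ab' in auto)
      moreover have "cut_free e U u Lu" using u(2) by (rule cut_free_cong) (use ab in auto)
      ultimately show ?thesis using u(4) unfolding plug.simps by blast
    qed
  next
    case (app e w V W v L y' C t L')
    have l: "lin (App (Fn y' t) (App (Var w) v))"
      using cut_free_lin[OF app.hyps(2)] cut_free_lin[OF app.hyps(3)] app.hyps by auto
    have ne: "y' \<noteq> y" "y' \<noteq> z" using app.hyps by auto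
    then have f: "y \<notin> fv t" "y \<noteq> w" "y \<notin> fv v" using app.prems by auto
    have res: "resp S L" "resp S L'" using app.prems by auto
    show ?case
    proof (cases "w = z")
      case True
      have VW: "V = U" "W = R" using True app.hyps app.prems by auto
      have d: "y \<notin> fv t - {y'}" using f by auto
      note r = cut_free_rename1[OF app.hyps(3,4) d]
      have "App (Fn y' t) (App (Var w) v) \<approx> App (Fn y (subst (Var(y' := Var y)) t)) (App (Var w) v)"
        by (rule conv_App) (use r(4) l in auto)
      then show ?thesis using r(1) app.hyps(2) convD(1) unfolding VW True by blast
    next
      case False
      have w: "pure S (V \<multimap> W)" using app.prems(6)[of w] False app.hyps(1) by simp
      have p: "pure S ((e(y' := W)) x)" if "x \<in> fv t" "x \<noteq> z" for x
        using app.prems(6) pure_components(2)[OF w] that by auto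
      have VW: "labs V \<subseteq> S \<and> labs W \<subseteq> S \<or> labs V \<inter> S = {} \<and> labs W \<inter> S = {}"
        using w unfolding pure_def by auto
      consider "z \<in> fv t" | "z \<in> fv v" "z \<notin> fv t" using app.prems False app.hyps by auto
      then show ?thesis
      proof cases
        case 1
        have "\<exists>u r Lu Lt. t \<preceq> App (Fn y r) (App (Var z) u) \<and> cut_free (e(y' := W)) U u Lu \<and> cut_free (e(y' := W, y := R)) C r Lt \<and> L' = Lu \<union> Lt"
          by (rule app.IH(2)) (use ne f app.prems p res 1 in auto)
        then obtain u r Lu Lt where u: "t \<preceq> App (Fn y r) (App (Var z) u)" "cut_free (e(y' := W)) U u Lu" "cut_free (e(y' := W, y := R)) C r Lt" "L' = Lu \<union> Lt"
          by blast
        have g: "fv t = fv r - {y} \<union> {z} \<union> fv u" "z \<notin> fv u" "z \<notin> fv r - {y}" "fv u \<inter> (fv r - {y}) = {}" "y \<in> fv r"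
          using refD[OF u(1)] by auto
        have S1: "labs ((e(y' := W)) x) \<subseteq> S" if "x \<in> fv u" for x
        proof (rule cut_free_connected[OF u(2) _ _ _ _ that])
          show "pure S ((e(y' := W)) x)" if "x \<in> fv u" for x by (rule p) (use g that in auto)
        qed (use u(4) res assms in \<open>auto simp: pure_def\<close>)
        have S2: "labs ((e(y' := W, y := R)) x) \<inter> S = {}" if "x \<in> fv r" for x
        proof (rule cut_free_disconnected[OF u(3) _ _ _ that])
          show "pure S ((e(y' := W, y := R)) x)" if "x \<in> fv r" for x
            proof (cases "x = y")
              case True
              then show ?thesis using assms(7) by (simp add: pure_def)
            next
              case False
              then have "x \<in> fv t" "x \<noteq> z" using g that by auto
              then show ?thesis using p[of x] False by simp
            qed
        qed (use u(4) res app.prems in \<open>auto simp: pure_def\<close>)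
        from VW show ?thesis
        proof
          assume "labs V \<subseteq> S \<and> labs W \<subseteq> S"
          then have ab: "y' \<notin> fv r" using S2[of y'] ne not_subset_disjoint by auto
          then have ab': "y' \<in> fv u" using g app.hyps ne by auto
          have "App (Fn y' t) (App (Var w) v)
              \<preceq> plug (AppR (Fn y r) (AppR (Var z) Hole)) (App (Fn y' u) (App (Var w) v))"
            by (rule ref_comm_fn') (use u(1) l ab ab' in auto)
          moreover have "cut_free e U (App (Fn y' u) (App (Var w) v)) (L \<union> Lu)"
            using app.hyps u(2) ab' g by (intro cut_free.cut_free_app) auto
          moreover have "cut_free (e(y := R)) C r Lt" using u(3) by (rule cut_free_cong) (use ab ne in auto)
          moreover have "L \<union> L' = L \<union> Lu \<union> Lt" using u(4) by auto
          ultimately show ?thesis unfolding plug.simps by blast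
        next
          assume "labs V \<inter> S = {} \<and> labs W \<inter> S = {}"
          then have ab: "y' \<notin> fv u" using S1[of y'] ne not_subset_disjoint by auto
          then have ab': "y' \<in> fv r" using g app.hyps ne by auto
          have "App (Fn y' t) (App (Var w) v)
              \<preceq> plug (AppL (FnC y Hole) (App (Var z) u)) (App (Fn y' r) (App (Var w) v))"
            by (rule ref_comm_fn') (use u(1) l ab ab' ne f in auto)
          moreover have "cut_free (e(y := R)) C (App (Fn y' r) (App (Var w) v)) (L \<union> Lt)"
          proof (rule cut_free.cut_free_app)
            show "cut_free (e(y := R, y' := W)) C r Lt" using u(3) by (rule cut_free_cong) (use ne in auto)
            show "cut_free (e(y := R)) V v L" using app.hyps(2) by (rule cut_free_cong) (use f in auto)
            show "w \<notin> fv r - {y'}" "fv v \<inter> (fv r - {y'}) = {}" using g app.hyps f by auto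
          qed (use app.hyps f ab' in auto)
          moreover have "cut_free e U u Lu" using u(2) by (rule cut_free_cong) (use ab in auto)
          moreover have "L \<union> L' = Lu \<union> (L \<union> Lt)" using u(4) by auto
          ultimately show ?thesis unfolding plug.simps by blast
        qed
      next
        case 2
        \<comment> \<open>\<open>z\<close> is not in \<open>t\<close>, so the sequent of
          \<open>t\<close> lies wholly outside \<open>S\<close>. Through \<open>y'\<close> this puts
          \<open>W\<close>, and by purity also \<open>V\<close>, outside, and \<open>V\<close>
          becomes an admissible goal for the hypothesis on \<open>v\<close>.\<close>
        have S2: "labs ((e(y' := W)) x) \<inter> S = {}" if "x \<in> fv t" for x
        proof (rule cut_free_disconnected[OF app.hyps(3) _ _ _ that])
          show "pure S ((e(y' := W)) x)" if "x \<in> fv t" for x by (rule p) (use that 2 in auto)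
        qed (use res app.prems in auto)
        then have "labs W \<inter> S = {}" using S2[of y'] app.hyps by auto
        then have V: "labs V \<inter> S = {}" using VW not_subset_disjoint by auto
        have "\<exists>u r Lu Lt. v \<preceq> App (Fn y r) (App (Var z) u) \<and> cut_free e U u Lu \<and> cut_free (e(y := R)) V r Lt \<and> L = Lu \<union> Lt"
          by (rule app.IH(1)) (use f app.prems res 2 V in auto)
        then obtain u r Lu Lt where u: "v \<preceq> App (Fn y r) (App (Var z) u)" "cut_free e U u Lu" "cut_free (e(y := R)) V r Lt" "L = Lu \<union> Lt"
          by blast
        have g: "fv v = fv r - {y} \<union> {z} \<union> fv u" using refD(3)[OF u(1)] by auto
        let ?C = "AppR (Fn y' t) (AppR (Var w) Hole)"
        have "plug ?C v \<preceq> App (Fn y (plug ?C r)) (App (Var z) u)"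
          by (rule ref_comm_fn[OF u(1)]) (use l f in auto)
        moreover have "cut_free (e(y := R)) C (App (Fn y' t) (App (Var w) r)) (Lt \<union> L')"
        proof (rule cut_free.cut_free_app)
          show "cut_free (e(y := R, y' := W)) C t L'" using app.hyps(3) by (rule cut_free_cong) (use ne f in auto)
          show "cut_free (e(y := R)) V r Lt" by (rule u(3))
          show "w \<notin> fv r" "fv r \<inter> (fv t - {y'}) = {}" using g app.hyps f by auto
        qed (use app.hyps f in auto)
        moreover have "L \<union> L' = Lu \<union> (Lt \<union> L')" using u(4) by auto
        ultimately show ?thesis using u(2) unfolding plug.simps by blast
      qed
    qed
  qed auto
qed


definition separated :: "(var \<Rightarrow> ty) \<Rightarrow> var set \<Rightarrow> ty \<Rightarrow> bool" where
  "separated e X A \<longleftrightarrow> distinct_labs A \<and> (\<forall>x\<in>X. distinct_labs (e x) \<and> labs (e x) \<inter> labs A = {}) \<and>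
     (\<forall>x\<in>X. \<forall>y\<in>X. x \<noteq> y \<longrightarrow> labs (e x) \<inter> labs (e y) = {})"

text \<open>Induction on the first proof: its last rule is imposed on the second one, by inversion
  or, for the two branching rules, by splitting along the labels of one premise. Links may join
  different labels, so the terms have a common type only after a substitution \<open>\<rho>\<close>
  that identifies linked labels.\<close>

lemma cut_free_coherent:
  assumes "cut_free e A s1 L" "cut_free e A s2 L" "fv s1 = fv s2" "separated e (fv s1) A"
    "\<And>i j. (i, j) \<in> L \<Longrightarrow> \<rho> i = \<rho> j"
  shows "eqv (tsubst \<rho> \<circ> e) s1 s2 (tsubst \<rho> A)"
proof -
  have "finite {}" by simp
  from assms(1) this show ?thesis using assms(2-5)
  proof (induction arbitrary: s2 rule: cut_free_strong_induct)
    case (conv e A s s' L)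
    have "eqv (tsubst \<rho> \<circ> e) s' s2 (tsubst \<rho> A)"
      by (rule conv.IH) (use conv.prems conv_fv[OF conv.hyps] in auto)
    then show ?case
      using refD(4)[OF convD(1)[OF conv.hyps]] eqv_styp eqv_trans by blast
  next
    case (ax e x i j)
    from ax.prems(1) have "s2 = Var x"
      by cases (use ax in auto)
    then show ?case using ax by (auto intro: eqv_refl)
  next
    case (fn e x A B s L)
    have "x \<notin> fv s2" using fn.prems(2) by auto
    from inv_fn[OF fn.prems(1) refl this]
    obtain t where t: "s2 \<preceq> Fn x t" "cut_free (e(x := A)) B t L" by blast
    have f: "fv s = fv t" using refD(3)[OF t(1)] refD(2)[OF t(1)] fn.prems(2) fn.hyps by auto
    have "separated (e(x := A)) (fv s) B"
      using fn.prems(3) unfolding separated_def by (auto; blast)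
    then have "eqv (tsubst \<rho> \<circ> e(x := A)) s t (tsubst \<rho> B)"
      using t(2) f fn.prems(4) by (intro fn.IH)
    moreover have "tsubst \<rho> \<circ> e(x := A) = (tsubst \<rho> \<circ> e)(x := tsubst \<rho> A)" by auto
    ultimately have *: "eqv (tsubst \<rho> \<circ> e) (Fn x s) (Fn x t) (tsubst \<rho> (A \<multimap> B))"
      using fn.hyps eqv_Fn unfolding tsubst.simps by metis
    then show ?case
      using refD(4)[OF t(1)] eqv_styp eqv_trans eqv_sym by blast
  next
    case (tup e A B s t L L')
    \<comment> \<open>All labels in the sequent of the left premise. Distinctness of the labels puts
      the sequent of the other premise entirely outside.\<close>
    let ?S = "labs A \<union> (\<Union>x\<in>fv s. labs (e x))"
    have sep: "distinct_labs A" "distinct_labs B" "labs A \<inter> labs B = {}"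
      "\<And>x. x \<in> fv s \<union> fv t \<Longrightarrow> distinct_labs (e x) \<and> labs (e x) \<inter> labs A = {} \<and> labs (e x) \<inter> labs B = {}"
      "\<And>x y. x \<in> fv s \<union> fv t \<Longrightarrow> y \<in> fv s \<union> fv t \<Longrightarrow> x \<noteq> y \<Longrightarrow> labs (e x) \<inter> labs (e y) = {}"
      using tup.prems(3) unfolding separated_def by (auto simp: Int_Un_distrib)
    have d: "labs (e x) \<inter> ?S = {}" if "x \<in> fv t" for x
    proof -
      have "labs (e x) \<inter> labs (e y) = {}" if "y \<in> fv s" for y
        using sep(5)[of x y] \<open>x \<in> fv t\<close> that tup.hyps(3) by auto
      then show ?thesis using sep(4)[of x] that by blast
    qed
    have dB: "labs B \<inter> ?S = {}" using sep(3,4) by blast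
    have LS: "L \<subseteq> ?S \<times> ?S" using cut_free_labs[OF tup.hyps(1)] by auto
    have L'S: "L' \<subseteq> (- ?S) \<times> (- ?S)"
    proof
      fix p assume "p \<in> L'"
      then have "{fst p, snd p} \<subseteq> labs B \<union> (\<Union>x\<in>fv t. labs (e x))" using cut_free_labs[OF tup.hyps(2), of "fst p" "snd p"] by simp
      then have "fst p \<notin> ?S" "snd p \<notin> ?S" using d dB by blast+
      then show "p \<in> (- ?S) \<times> (- ?S)" by (auto simp: mem_Times_iff)
    qed
    have "resp ?S (L \<union> L')" using LS L'S unfolding resp_def by auto
    moreover have p: "pure ?S (e x)" if "x \<in> fv s2" for x
    proof (cases "x \<in> fv s")
      case False
      then have "x \<in> fv t" using that tup.prems(2) by auto
      then show ?thesis using d unfolding pure_def by blast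
    qed (auto simp: pure_def)
    ultimately obtain a b L1 L2 where *: "s2 \<preceq> Tup a b" "cut_free e A a L1" "cut_free e B b L2" "L \<union> L' = L1 \<union> L2"
      using split_tup[OF tup.prems(1) refl, of ?S] dB by blast
    have f: "fv s \<union> fv t = fv a \<union> fv b" "fv a \<inter> fv b = {}" using refD[OF *(1)] tup.prems(2) by auto
    have r: "resp ?S L1" "resp ?S L2" using \<open>resp ?S (L \<union> L')\<close> *(4) by auto
    have S1: "labs (e x) \<subseteq> ?S" if "x \<in> fv a" for x
    proof (rule cut_free_connected[OF *(2) r(1) _ _ _ that])
      show "pure ?S (e x)" if "x \<in> fv a" for x by (rule p) (use refD(3)[OF *(1)] that in simp)
      show "pure ?S A" unfolding pure_def by blast
    qed blast
    have S2: "labs (e x) \<inter> ?S = {}" if "x \<in> fv b" for x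
    proof (rule cut_free_disconnected[OF *(3) r(2) _ dB that])
      show "pure ?S (e x)" if "x \<in> fv b" for x by (rule p) (use refD(3)[OF *(1)] that in simp)
    qed
    \<comment> \<open>The labels of a free variable tell its side, so it goes to the same component
      in both proofs.\<close>
    have "fv a \<inter> fv t = {}" using S1 d by (rule disjoint_by_labs)
    moreover have "fv b \<inter> fv s = {}"
    proof -
      have "labs (e x) \<subseteq> ?S" if "x \<in> fv s" for x using that by blast
      then have "fv s \<inter> fv b = {}" using S2 by (rule disjoint_by_labs)
      then show ?thesis by blast
    qed
    ultimately have fab: "fv a = fv s" "fv b = fv t" using f by blast+
    have L1S: "L1 \<subseteq> ?S \<times> ?S" 
    proof
      fix p assume "p \<in> L1"
      then have "{fst p, snd p} \<subseteq> ?S" using cut_free_labs[OF *(2), of "fst p" "snd p"] fab by simp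
      then show "p \<in> ?S \<times> ?S" by (simp add: mem_Times_iff)
    qed
    have L2S: "L2 \<subseteq> (- ?S) \<times> (- ?S)"
    proof
      fix p assume "p \<in> L2"
      then have "{fst p, snd p} \<subseteq> labs B \<union> (\<Union>x\<in>fv t. labs (e x))" using cut_free_labs[OF *(3), of "fst p" "snd p"] fab by simp
      then have "fst p \<notin> ?S" "snd p \<notin> ?S" using d dB by blast+
      then show "p \<in> (- ?S) \<times> (- ?S)" by (auto simp: mem_Times_iff)
    qed
    \<comment> \<open>The cut sorts the links as well, so equal unions have equal parts.\<close>
    have eq: "L1 = L" "L2 = L'" using *(4) LS L'S L1S L2S by blast+
    have "eqv (tsubst \<rho> \<circ> e) s a (tsubst \<rho> A)"
      by (rule tup.IH(1)) (use * eq fab tup.prems(3,4) in \<open>auto simp: separated_def\<close>)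
    moreover have "eqv (tsubst \<rho> \<circ> e) t b (tsubst \<rho> B)"
      by (rule tup.IH(2)) (use * eq fab tup.prems(3,4) in \<open>auto simp: separated_def\<close>)
    ultimately have "eqv (tsubst \<rho> \<circ> e) (Tup s t) (Tup a b) (tsubst \<rho> (A \<otimes> B))"
      using tup.hyps(3) by (simp add: eqv_Tup)
    then show ?case
      using refD(4)[OF *(1)] eqv_styp eqv_trans eqv_sym by blast
  next
    case (letc e z X Y x y C t L)
    have xy: "x \<notin> fv s2" "y \<notin> fv s2" "z \<in> fv s2" using letc.prems(2) letc.hyps by auto
    from inv_let[OF letc.prems(1) letc.hyps(1) xy(3,1,2) letc.hyps(5)]
    obtain t' where t: "s2 \<preceq> LetTup x y (Var z) t'" "cut_free (e(x := X, y := Y)) C t' L" by blast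
    have "insert z (fv t - {x, y}) = insert z (fv t' - {x, y})" "x \<in> fv t'" "y \<in> fv t'" "z \<notin> fv t' - {x, y}"
      using refD(3)[OF t(1)] refD(2)[OF t(1)] letc.prems(2) by auto
    moreover from this have "z \<notin> fv t - {x, y}" using letc.hyps by simp
    ultimately have xy': "x \<in> fv t'" "y \<in> fv t'" "fv t - {x, y} = fv t' - {x, y}" by (simp_all add: insert_ident)
    then have f: "fv t = fv t'" using letc.hyps(3,4) by blast
    have zl: "labs (e z) = labs X \<union> labs Y" "distinct_labs (e z)" "labs (e z) \<inter> labs C = {}" "distinct_labs C"
      using letc.hyps(1) letc.prems(3) unfolding separated_def by auto
    have v: "distinct_labs (e v) \<and> labs (e v) \<inter> labs C = {} \<and> labs (e v) \<inter> labs (e z) = {}" if "v \<in> fv t - {x, y}" for v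
      using letc.prems(3) letc.hyps(6) that unfolding separated_def by auto
    have vw: "labs (e v) \<inter> labs (e w) = {}" if "v \<in> fv t - {x, y}" "w \<in> fv t - {x, y}" "v \<noteq> w" for v w
    proof -
      have "v \<in> fv (LetTup x y (Var z) t)" "w \<in> fv (LetTup x y (Var z) t)" using that by auto
      then show ?thesis using letc.prems(3) that(3) unfolding separated_def by blast
    qed
    have "separated (e(x := X, y := Y)) (fv t) C"
      using zl v vw letc.hyps(1) unfolding separated_def by (simp add: Int_Un_distrib Int_Un_distrib2 Int_commute)
    then have "eqv (tsubst \<rho> \<circ> e(x := X, y := Y)) t t' (tsubst \<rho> C)"
      using t(2) f letc.prems(4) by (intro letc.IH)
    moreover have "tsubst \<rho> \<circ> e(x := X, y := Y) = (tsubst \<rho> \<circ> e)(x := tsubst \<rho> X, y := tsubst \<rho> Y)" by auto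
    moreover have "lin (LetTup x y (Var z) t)" using letc.hyps cut_free_lin by auto
    ultimately have *: "eqv (tsubst \<rho> \<circ> e) (LetTup x y (Var z) t) (LetTup x y (Var z) t') (tsubst \<rho> C)"
      using letc.hyps(1) eqv_LetTup[OF eqv_refl[of "Var z"]] by (metis comp_apply lin.simps(1) styp.simps(1) tsubst.simps(2))
    then show ?case
      using refD(4)[OF t(1)] eqv_styp eqv_trans eqv_sym by blast
  next
    case (app e z U R u L y C t L')
    \<comment> \<open>The cut for this rule: all labels in the sequent of the argument
      \<open>u\<close>, its goal \<open>U\<close> included.\<close>
    let ?S = "labs U \<union> (\<Union>x\<in>fv u. labs (e x))"
    have zl: "labs (e z) = labs U \<union> labs R" "distinct_labs U" "distinct_labs R" "labs U \<inter> labs R = {}"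
       "labs (e z) \<inter> labs C = {}" "distinct_labs C"
      using app.hyps(1) app.prems(3) unfolding separated_def by auto
    have v: "distinct_labs (e v) \<and> labs (e v) \<inter> labs C = {} \<and> labs (e v) \<inter> labs (e z) = {}" if "v \<in> fv u \<union> (fv t - {y})" for v
      using app.prems(3) app.hyps(5,6) that unfolding separated_def by auto
    have vw: "labs (e v) \<inter> labs (e w) = {}" if "v \<in> fv u \<union> (fv t - {y})" "w \<in> fv u \<union> (fv t - {y})" "v \<noteq> w" for v w
    proof -
      have "v \<in> fv (App (Fn y t) (App (Var z) u))" "w \<in> fv (App (Fn y t) (App (Var z) u))" using that by auto
      then show ?thesis using app.prems(3) that(3) unfolding separated_def by blast
    qed
    have d: "labs (e x) \<inter> ?S = {}" if "x \<in> fv t - {y}" for x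
    proof -
      have "labs (e x) \<inter> labs (e w) = {}" if "w \<in> fv u" for w
        using vw[of x w] \<open>x \<in> fv t - {y}\<close> that app.hyps(7) by auto
      then show ?thesis using v[of x] zl(1) that by blast
    qed
    have dR: "labs R \<inter> ?S = {}" using v zl by blast
    have dC: "labs C \<inter> ?S = {}" using v zl by blast
    have d': "labs ((e(y := R)) x) \<inter> ?S = {}" if "x \<in> fv t" for x using d dR that by simp
    have LS: "L \<subseteq> ?S \<times> ?S" using cut_free_labs[OF app.hyps(2)] by auto
    have L'S: "L' \<subseteq> (- ?S) \<times> (- ?S)"
    proof
      fix p assume "p \<in> L'"
      then have "{fst p, snd p} \<subseteq> labs C \<union> (\<Union>x\<in>fv t. labs ((e(y := R)) x))"
        using cut_free_labs[OF app.hyps(3), of "fst p" "snd p"] by simp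
      then have "fst p \<notin> ?S" "snd p \<notin> ?S" using d' dC by blast+
      then show "p \<in> (- ?S) \<times> (- ?S)" by (auto simp: mem_Times_iff)
    qed
    have r0: "resp ?S (L \<union> L')" using LS L'S unfolding resp_def by auto
    have y: "y \<notin> fv s2" "z \<in> fv s2" using app.prems(2) app.hyps by auto
    \<comment> \<open>\<open>z\<close> is excepted, since its type \<open>U \<multimap> R\<close> is
      the one formula that straddles the cut.\<close>
    have p: "pure ?S (e x)" if "x \<in> fv s2" "x \<noteq> z" for x
    proof (cases "x \<in> fv u")
      case False
      then have "x \<in> fv t - {y}" using that app.prems(2) by auto
      then show ?thesis using d unfolding pure_def by blast
    qed (auto simp: pure_def)
    have "\<exists>u' t' Lu Lt. s2 \<preceq> App (Fn y t') (App (Var z) u') \<and> cut_free e U u' Lu \<and> cut_free (e(y := R)) C t' Lt \<and> L \<union> L' = Lu \<union> Lt"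
      by (rule split_app[OF app.prems(1) app.hyps(1) y(2,1) r0]) (use p dR dC in auto)
    then obtain u' t' L1 L2 where *: "s2 \<preceq> App (Fn y t') (App (Var z) u')" "cut_free e U u' L1"
      "cut_free (e(y := R)) C t' L2" "L \<union> L' = L1 \<union> L2" by blast
    have f: "fv s2 = fv t' - {y} \<union> {z} \<union> fv u'" "z \<notin> fv u'" "z \<notin> fv t' - {y}" "fv u' \<inter> (fv t' - {y}) = {}" "y \<in> fv t'"
      using refD[OF *(1)] by auto
    have f2: "fv u \<union> (fv t - {y}) = fv u' \<union> (fv t' - {y})" using f app.prems(2) app.hyps by auto
    have r: "resp ?S L1" "resp ?S L2" using r0 *(4) by auto
    have S1: "labs (e x) \<subseteq> ?S" if "x \<in> fv u'" for x
    proof (rule cut_free_connected[OF *(2) r(1) _ _ _ that])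
      show "pure ?S (e x)" if "x \<in> fv u'" for x by (rule p) (use f that in auto)
    qed (auto simp: pure_def)
    have S2: "labs ((e(y := R)) x) \<inter> ?S = {}" if "x \<in> fv t'" for x
    proof (rule cut_free_disconnected[OF *(3) r(2) _ dC that])
      show "pure ?S ((e(y := R)) x)" if "x \<in> fv t'" for x
        by (cases "x = y") (use p[of x] f that dR in \<open>auto simp: pure_def[of _ R]\<close>)
    qed
    have "fv u' \<inter> (fv t - {y}) = {}" using S1 d by (rule disjoint_by_labs)
    moreover have "(fv t' - {y}) \<inter> fv u = {}"
    proof -
      have "labs (e x) \<subseteq> ?S" if "x \<in> fv u" for x using that by blast
      moreover have "labs (e x) \<inter> ?S = {}" if "x \<in> fv t' - {y}" for x using S2[of x] that by simp
      ultimately have "fv u \<inter> (fv t' - {y}) = {}" by (rule disjoint_by_labs)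
      then show ?thesis by blast
    qed
    ultimately have "fv u' = fv u" "fv t' - {y} = fv t - {y}" using f2 by blast+
    then have fab: "fv u' = fv u" "fv t' = fv t" using f app.hyps by blast+
    have L1S: "L1 \<subseteq> ?S \<times> ?S" 
    proof
      fix p assume "p \<in> L1"
      then have "{fst p, snd p} \<subseteq> ?S" using cut_free_labs[OF *(2), of "fst p" "snd p"] fab by simp
      then show "p \<in> ?S \<times> ?S" by (simp add: mem_Times_iff)
    qed
    have L2S: "L2 \<subseteq> (- ?S) \<times> (- ?S)"
    proof
      fix p assume "p \<in> L2"
      then have "{fst p, snd p} \<subseteq> labs C \<union> (\<Union>x\<in>fv t. labs ((e(y := R)) x))"
        using cut_free_labs[OF *(3), of "fst p" "snd p"] fab by simp
      then have "fst p \<notin> ?S" "snd p \<notin> ?S" using d' dC by blast+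
      then show "p \<in> (- ?S) \<times> (- ?S)" by (auto simp: mem_Times_iff)
    qed
    have eq: "L1 = L" "L2 = L'" using *(4) LS L'S L1S L2S by blast+
    have upd: "tsubst \<rho> \<circ> e(y := R) = (tsubst \<rho> \<circ> e)(y := tsubst \<rho> R)" by auto
    have "separated e (fv u) U"
      using v vw zl unfolding separated_def by auto
    then have 1: "eqv (tsubst \<rho> \<circ> e) u u' (tsubst \<rho> U)"
      by (intro app.IH(1)) (use * eq fab app.prems(4) in auto)
    have "separated (e(y := R)) (fv t) C"
      using v vw zl unfolding separated_def by (simp add: Int_Un_distrib Int_Un_distrib2 Int_commute)
    moreover have "cut_free (e(y := R)) C t' L'" using *(3) eq by simp
    ultimately have "eqv (tsubst \<rho> \<circ> e(y := R)) t t' (tsubst \<rho> C)"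
      using fab(2)[symmetric] app.prems(4) by (intro app.IH(2)) blast+
    then have 2: "eqv (tsubst \<rho> \<circ> e) (Fn y t) (Fn y t') (tsubst \<rho> (R \<multimap> C))"
      unfolding upd using app.hyps(4) unfolding tsubst.simps by (rule eqv_Fn)
    have 3: "eqv (tsubst \<rho> \<circ> e) (App (Var z) u) (App (Var z) u') (tsubst \<rho> R)"
      by (rule eqv_App[OF eqv_refl 1]) (use app.hyps in auto)
    have "eqv (tsubst \<rho> \<circ> e) (App (Fn y t) (App (Var z) u)) (App (Fn y t') (App (Var z) u')) (tsubst \<rho> C)"
      by (rule eqv_App[OF 2[unfolded tsubst.simps] 3]) (use app.hyps in auto)
    then show ?case
      using refD(4)[OF *(1)] eqv_styp eqv_trans eqv_sym by blast
  qed
qed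

subsection \<open>Normalization\<close>

text \<open>Codes of types serve twice: for variables that know their type, and for anti-unification
  variables that know their disagreement.\<close>

instance ty :: countable
  by countable_datatype

text \<open>Every type is assigned to infinitely many variables, so that normalization can take place in
  one fixed environment.\<close>

definition var_ty :: "var \<Rightarrow> ty" where
  "var_ty n = from_nat (fst (prod_decode n))"

lemma var_ty_fresh:
  assumes "finite X"
  obtains x where "x \<notin> X" "var_ty x = A"
proof -
  have "inj (\<lambda>k. prod_encode (to_nat A, k))" by (auto simp: inj_def)
  then have "infinite (range (\<lambda>k. prod_encode (to_nat A, k)))" using finite_imageD infinite_UNIV_nat by blast
  then obtain x where "x \<in> range (\<lambda>k. prod_encode (to_nat A, k))" "x \<notin> X"
    using assms by (meson finite_subset subsetI)
  then show thesis by (intro that) (auto simp: var_ty_def)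
qed

text \<open>The labels are the type variables themselves here, hence the demand
  \<open>L \<subseteq> Id\<close> that axioms join equal atoms, which the rules of
  \<open>cut_free\<close> leave open.\<close>

definition has_cut_free :: "ty \<Rightarrow> trm \<Rightarrow> bool" where
  "has_cut_free A s \<longleftrightarrow> (\<exists>s' L. s \<preceq> s' \<and> cut_free var_ty A s' L \<and> L \<subseteq> Id)"

lemma has_cut_free_lin: "has_cut_free A s \<Longrightarrow> lin s"
  unfolding has_cut_free_def using refD(1) by blast

lemma has_cut_free_ref: "s \<preceq> s' \<Longrightarrow> has_cut_free A s' \<Longrightarrow> has_cut_free A s"
  unfolding has_cut_free_def using ref_trans by blast

lemma has_cut_free_conv: "s \<approx> s' \<Longrightarrow> has_cut_free A s' \<Longrightarrow> has_cut_free A s"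
  using has_cut_free_ref convD(1) by blast

lemma has_cut_free_var: "var_ty x = TVar a \<Longrightarrow> has_cut_free (TVar a) (Var x)"
  unfolding has_cut_free_def by (intro exI[of _ "Var x"] exI[of _ "{(a, a)}"]) (auto intro: cut_free_ax)

lemma has_cut_free_fn:
  assumes "has_cut_free B s" "x \<in> fv s"
  shows "has_cut_free (var_ty x \<multimap> B) (Fn x s)"
proof -
  obtain s' L where s: "s \<preceq> s'" "cut_free var_ty B s' L" "L \<subseteq> Id" using assms(1) unfolding has_cut_free_def by blast
  have "var_ty(x := var_ty x) = var_ty" by simp
  then have "cut_free var_ty (var_ty x \<multimap> B) (Fn x s') L"
    using s refD(3)[OF s(1)] assms(2) by (intro cut_free_fn) simp_all
  then show ?thesis using ref_Fn[OF s(1) assms(2)] s(3) unfolding has_cut_free_def by blast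
qed

lemma has_cut_free_tup:
  assumes "has_cut_free A s" "has_cut_free B t" "fv s \<inter> fv t = {}"
  shows "has_cut_free (A \<otimes> B) (Tup s t)"
proof -
  obtain s' L t' L' where s: "s \<preceq> s'" "cut_free var_ty A s' L" "L \<subseteq> Id" "t \<preceq> t'" "cut_free var_ty B t' L'" "L' \<subseteq> Id"
    using assms(1,2) unfolding has_cut_free_def by blast
  have "cut_free var_ty (A \<otimes> B) (Tup s' t') (L \<union> L')"
    using s refD(3)[OF s(1)] refD(3)[OF s(4)] assms(3) by (intro cut_free_tup) simp_all
  then show ?thesis using ref_Tup[OF s(1,4) assms(3)] s(3,6) unfolding has_cut_free_def by blast
qed

lemma has_cut_free_let:
  assumes "has_cut_free C t" "x \<in> fv t" "y \<in> fv t" "x \<noteq> y" "z \<notin> fv t - {x, y}" "var_ty z = var_ty x \<otimes> var_ty y"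
  shows "has_cut_free C (LetTup x y (Var z) t)"
proof -
  obtain t' L where t: "t \<preceq> t'" "cut_free var_ty C t' L" "L \<subseteq> Id" using assms(1) unfolding has_cut_free_def by blast
  have "var_ty(x := var_ty x, y := var_ty y) = var_ty" by simp
  then have "cut_free var_ty C (LetTup x y (Var z) t') L"
    using t refD(3)[OF t(1)] assms(2-6) by (intro cut_free_let[where X = "var_ty x" and Y = "var_ty y"]) simp_all
  moreover have "LetTup x y (Var z) t \<preceq> LetTup x y (Var z) t'"
    using assms refD(1)[OF t(1)] t(1) by (intro ref_LetTup) auto
  ultimately show ?thesis using t(3) unfolding has_cut_free_def by blast
qed

lemma has_cut_free_app:
  assumes "has_cut_free U u" "has_cut_free C t" "y \<in> fv t" "var_ty z = U \<multimap> var_ty y" "z \<notin> fv u" "z \<notin> fv t - {y}"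
    "fv u \<inter> (fv t - {y}) = {}"
  shows "has_cut_free C (App (Fn y t) (App (Var z) u))"
proof -
  obtain t' L u' L' where t: "t \<preceq> t'" "cut_free var_ty C t' L" "L \<subseteq> Id" "u \<preceq> u'" "cut_free var_ty U u' L'" "L' \<subseteq> Id"
    using assms(1,2) unfolding has_cut_free_def by blast
  have "var_ty(y := var_ty y) = var_ty" by simp
  then have "cut_free var_ty C (App (Fn y t') (App (Var z) u')) (L' \<union> L)"
    using t refD(3)[OF t(1)] refD(3)[OF t(4)] assms(3-7) by (intro cut_free_app[where R = "var_ty y"]) simp_all
  moreover have "App (Fn y t) (App (Var z) u) \<preceq> App (Fn y t') (App (Var z) u')"
    using assms t by (intro ref_App ref_Fn ref_refl) auto
  ultimately show ?thesis using t(3,6) unfolding has_cut_free_def by blast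
qed

text \<open>A cut against a variable: the redex contracts to a renaming, which preserves cut-free
  proofs.\<close>

lemma has_cut_free_rename:
  assumes "has_cut_free C t" "y \<in> fv t" "z \<notin> fv t - {y}" "var_ty z = var_ty y"
  shows "has_cut_free C (App (Fn y t) (Var z))"
proof -
  obtain t' L where t: "t \<preceq> t'" "cut_free var_ty C t' L" "L \<subseteq> Id" using assms(1) unfolding has_cut_free_def by blast
  have f: "fv t = fv t'" by (rule refD(3)[OF t(1)])
  have r: "var_ty(y := var_ty y) = var_ty" "var_ty(z := var_ty y) = var_ty" using assms(4) by (simp_all add: fun_upd_idem)
  have "cut_free var_ty C (subst (Var(y := Var z)) t') L"
    using cut_free_rename1(1)[of var_ty y "var_ty y" C t' L z] t(2) assms(2,3) f unfolding r by simp
  moreover have "App (Fn y t) (Var z) \<preceq> App (Fn y t') (Var z)"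
    using assms t(1) by (intro ref_App ref_Fn ref_refl) auto
  moreover have "App (Fn y t') (Var z) \<approx> subst (Var(y := Var z)) t'"
    using assms(2,3) f refD(2)[OF t(1)] by (intro conv_beta) auto
  ultimately show ?thesis using t(3) ref_conv_trans(1) unfolding has_cut_free_def by blast
qed

text \<open>Application spines headed by a variable, whose arguments already have cut-free forms.
  Tensor eliminations are treated through \<open>let_app\<close> below.\<close>

inductive neutral :: "ty \<Rightarrow> trm \<Rightarrow> bool" where
  neutral_var: "neutral (var_ty z) (Var z)"
| neutral_app: "neutral (A \<multimap> B) n \<Longrightarrow> has_cut_free A u \<Longrightarrow> fv n \<inter> fv u = {} \<Longrightarrow> neutral B (App n u)"

lemma neutral_lin: "neutral A n \<Longrightarrow> lin n"
  by (induction rule: neutral.induct) (auto intro: has_cut_free_lin)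

text \<open>A spine is cut one application at a time: a fresh \<open>z\<close> stands for
  \<open>n\<close>, the left rule of \<open>\<multimap>\<close> treats \<open>App (Var z) u\<close>,
  and the cut of \<open>z\<close> against the shorter spine \<open>n\<close> is left to the
  induction.\<close>

lemma neutral_cut:
  "neutral B n \<Longrightarrow> has_cut_free C t \<Longrightarrow> y \<in> fv t \<Longrightarrow> var_ty y = B \<Longrightarrow> fv n \<inter> (fv t - {y}) = {} \<Longrightarrow> has_cut_free C (App (Fn y t) n)"
proof (induction arbitrary: t y rule: neutral.induct)
  case (neutral_var z)
  then show ?case by (intro has_cut_free_rename) auto
next
  case (neutral_app A B n u)
  obtain z where z: "z \<notin> fv t \<union> fv u \<union> fv n \<union> {y}" "var_ty z = A \<multimap> B"
    by (rule var_ty_fresh[of "fv t \<union> fv u \<union> fv n \<union> {y}"]) auto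
  let ?T = "App (Fn y t) (App (Var z) u)"
  have "has_cut_free C ?T"
    using neutral_app z by (intro has_cut_free_app) auto
  then have "has_cut_free C (App (Fn z ?T) n)"
    using z neutral_app.prems neutral_app.hyps by (intro neutral_app.IH) auto
  moreover have "App (Fn y t) (App n u) \<approx> App (Fn z ?T) n"
  proof -
    have l: "lin n" "lin u" "lin t" using neutral_lin[OF neutral_app.hyps(1)] has_cut_free_lin neutral_app by auto
    have "App (Fn z ?T) n \<approx> subst (Var(z := n)) ?T"
      using l z neutral_app.prems neutral_app.hyps by (intro conv_beta) auto
    also have "\<dots> = App (subst (Var(z := n)) (Fn y t)) (App n (subst (Var(z := n)) u))" by simp
    also have "\<dots> \<approx> App (Fn y t) (App n u)"
    proof (rule conv_App)
      show "subst (Var(z := n)) (Fn y t) \<approx> Fn y t"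
        using l z neutral_app.prems by (intro subst_id) auto
      have u: "subst (Var(z := n)) u \<approx> u" using l z by (intro subst_id) auto
      show "App n (subst (Var(z := n)) u) \<approx> App n u"
        by (rule conv_App[OF conv_refl[OF l(1)] u]) (simp only: conv_fv[OF u] neutral_app.hyps)
      show "fv (subst (Var(z := n)) (Fn y t)) \<inter> fv (App n (subst (Var(z := n)) u)) = {}"
        using conv_lin(2)[OF calculation] by simp
    qed
    finally show ?thesis by (rule conv_sym)
  qed
  ultimately show ?case using has_cut_free_conv by blast
qed

text \<open>Elimination of a tensor with an abstract continuation \<open>K\<close>, which keeps bound names out of the
  argument below.\<close>

definition let_app :: "trm \<Rightarrow> trm \<Rightarrow> trm" where
  "let_app s K = (let x = fresh (fv K); y = fresh (insert x (fv K))
     in LetTup x y s (App (App K (Var x)) (Var y)))"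

text \<open>The binders depend on \<open>K\<close> only through its free variables. Hence the last
  clause, by which related continuations share them.\<close>

lemma let_app_obtain:
  obtains x y where "x \<notin> fv K" "y \<notin> fv K" "x \<noteq> y"
    "\<And>s K'. fv K' = fv K \<Longrightarrow> let_app s K' = LetTup x y s (App (App K' (Var x)) (Var y))"
proof
  let ?x = "fresh (fv K)" and ?y = "fresh (insert (fresh (fv K)) (fv K))"
  show "?x \<notin> fv K" by (rule fresh_notin) simp
  have "?y \<notin> insert ?x (fv K)" by (rule fresh_notin) simp
  then show "?y \<notin> fv K" "?x \<noteq> ?y" by auto
  show "let_app s K' = LetTup ?x ?y s (App (App K' (Var ?x)) (Var ?y))" if "fv K' = fv K" for s K'
    unfolding let_app_def Let_def that ..
qed

lemma fv_let_app [simp]: "fv (let_app s K) = fv s \<union> fv K"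
proof -
  obtain x y where xy: "x \<notin> fv K" "y \<notin> fv K" "x \<noteq> y"
    "\<And>s K'. fv K' = fv K \<Longrightarrow> let_app s K' = LetTup x y s (App (App K' (Var x)) (Var y))"
    using let_app_obtain[of K] by blast
  show ?thesis unfolding xy(4)[OF refl] using xy(1-3) by auto
qed

lemma lin_let_app [simp]: "lin (let_app s K) \<longleftrightarrow> lin s \<and> lin K \<and> fv s \<inter> fv K = {}"
proof -
  obtain x y where xy: "x \<notin> fv K" "y \<notin> fv K" "x \<noteq> y"
    "\<And>s K'. fv K' = fv K \<Longrightarrow> let_app s K' = LetTup x y s (App (App K' (Var x)) (Var y))"
    using let_app_obtain[of K] by blast
  show ?thesis unfolding xy(4)[OF refl] using xy(1-3) by auto
qed

lemma ref_let_app: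
  assumes "s \<preceq> s'" "K \<preceq> K'" "fv s \<inter> fv K = {}"
  shows "let_app s K \<preceq> let_app s' K'"
proof -
  obtain x y where xy: "x \<notin> fv K" "y \<notin> fv K" "x \<noteq> y"
    "\<And>s K'. fv K' = fv K \<Longrightarrow> let_app s K' = LetTup x y s (App (App K' (Var x)) (Var y))"
    using let_app_obtain[of K] by blast
  show ?thesis unfolding xy(4)[OF refl] xy(4)[OF refD(3)[OF assms(2), symmetric]]
    using assms refD(1)[OF assms(1)] refD(1)[OF assms(2)] xy(1-3)
    by (intro ref_LetTup ref_App ref_refl) auto
qed

lemma conv_let_app:
  assumes "s \<approx> s'" "K \<approx> K'" "fv s \<inter> fv K = {}"
  shows "let_app s K \<approx> let_app s' K'"
  using ref_let_app[OF convD(1)[OF assms(1)] convD(1)[OF assms(2)] assms(3)]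
    ref_let_app[OF convD(2)[OF assms(1)] convD(2)[OF assms(2)]] assms(3)
    conv_fv[OF assms(1)] conv_fv[OF assms(2)]
  unfolding conv_def by simp

lemma let_app_alpha:
  assumes "lin s" "lin K" "fv s \<inter> fv K = {}" "a \<noteq> b" "a \<notin> fv K" "b \<notin> fv K"
  shows "let_app s K \<approx> LetTup a b s (App (App K (Var a)) (Var b))"
proof -
  obtain x y where xy: "x \<notin> fv K" "y \<notin> fv K" "x \<noteq> y"
    "\<And>s K'. fv K' = fv K \<Longrightarrow> let_app s K' = LetTup x y s (App (App K' (Var x)) (Var y))"
    using let_app_obtain[of K] by blast
  let ?\<sigma> = "Var(x := Var a, y := Var b)"
  have "LetTup x y s (App (App K (Var x)) (Var y)) \<approx> LetTup a b s (subst ?\<sigma> (App (App K (Var x)) (Var y)))"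
    using assms xy(1-3) by (intro conv_alpha_let) auto
  also have "subst ?\<sigma> (App (App K (Var x)) (Var y)) = App (App (subst ?\<sigma> K) (Var a)) (Var b)"
    using xy(3) by simp
  also have "LetTup a b s (App (App (subst ?\<sigma> K) (Var a)) (Var b)) \<approx> LetTup a b s (App (App K (Var a)) (Var b))"
  proof (rule conv_LetTup)
    have K: "subst ?\<sigma> K \<approx> K" using assms(2) xy(1,2) by (intro subst_id) auto
    show "App (App (subst ?\<sigma> K) (Var a)) (Var b) \<approx> App (App K (Var a)) (Var b)"
      using K conv_fv[OF K] assms by (intro conv_App conv_refl) (auto simp del: fv_subst)
    show "lin (LetTup a b s (App (App (subst ?\<sigma> K) (Var a)) (Var b)))"
      by (rule conv_lin(2)[OF calculation])
  qed (use assms in auto)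
  finally show ?thesis unfolding xy(4)[OF refl] .
qed

lemma let_app_pair:
  assumes "lin (Tup u v)" "lin K" "fv (Tup u v) \<inter> fv K = {}"
  shows "let_app (Tup u v) K \<approx> App (App K u) v"
proof -
  obtain x y where xy: "x \<notin> fv K" "y \<notin> fv K" "x \<noteq> y"
    "\<And>s K'. fv K' = fv K \<Longrightarrow> let_app s K' = LetTup x y s (App (App K' (Var x)) (Var y))"
    using let_app_obtain[of K] by blast
  let ?\<sigma> = "Var(x := u, y := v)"
  have "LetTup x y (Tup u v) (App (App K (Var x)) (Var y)) \<approx> subst ?\<sigma> (App (App K (Var x)) (Var y))"
    using assms xy(1-3) by (intro conv_beta_let) auto
  also have "subst ?\<sigma> (App (App K (Var x)) (Var y)) = App (App (subst ?\<sigma> K) u) v"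
    using xy(3) by simp
  also have "App (App (subst ?\<sigma> K) u) v \<approx> App (App K u) v"
  proof -
    have K: "subst ?\<sigma> K \<approx> K" using assms(2) xy(1,2) by (intro subst_id) auto
    show ?thesis
      using K conv_fv[OF K] assms by (intro conv_App conv_refl) (auto simp del: fv_subst)
  qed
  finally show ?thesis unfolding xy(4)[OF refl] .
qed

lemma conv_beta_subst2:
  assumes "lin (Fn x (Fn y t))" "disjoint_lin (fv t - {x, y}) \<sigma>" "lin u" "lin v" "fv u \<inter> fv v = {}"
    "(fv u \<union> fv v) \<inter> (\<Union>w\<in>fv t - {x, y}. fv (\<sigma> w)) = {}"
  shows "App (App (subst \<sigma> (Fn x (Fn y t))) u) v \<approx> subst (\<sigma>(x := u, y := v)) t"
proof -
  have xy: "x \<in> fv t" "y \<in> fv t" "x \<noteq> y" using assms(1) by auto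
  have "lin (subst \<sigma> (Fn x (Fn y t)))" by (rule lin_subst[OF assms(1)]) (use assms(2) in \<open>auto intro: disjoint_lin_subset\<close>)
  have eq: "fv (Fn y t) - {x} = fv t - {x, y}" by auto
  have 1: "App (subst \<sigma> (Fn x (Fn y t))) u \<approx> subst (\<sigma>(x := u)) (Fn y t)"
    by (rule conv_beta_subst) (use assms eq in auto)
  have "App (App (subst \<sigma> (Fn x (Fn y t))) u) v \<approx> App (subst (\<sigma>(x := u)) (Fn y t)) v"
    by (rule conv_App[OF 1 conv_refl[OF assms(4)]]) (use assms in auto)
  also have "\<dots> \<approx> subst (\<sigma>(x := u, y := v)) t"
  proof (rule conv_beta_subst)
    have disjoint_lin: "disjoint_lin (fv t - {y} - {x}) \<sigma>" using assms(2) by (rule disjoint_lin_subset) auto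
    have eq2: "fv t - {y} - {x} = fv t - {x, y}" by auto
    show "disjoint_lin (fv t - {y}) (\<sigma>(x := u))"
      by (rule disjoint_lin_upd[OF disjoint_lin]) (use assms eq2 in auto)
    show "fv v \<inter> (\<Union>w\<in>fv t - {y}. fv ((\<sigma>(x := u)) w)) = {}"
    proof -
      have "(\<Union>w\<in>fv t - {y}. fv ((\<sigma>(x := u)) w)) \<subseteq> fv u \<union> (\<Union>w\<in>fv t - {x, y}. fv (\<sigma> w))"
        by (auto split: if_splits)
      then show ?thesis using assms(5,6) by blast
    qed
  qed (use assms in auto)
  finally show ?thesis .
qed

text \<open>The bridge from raw \<open>LetTup\<close> to \<open>let_app\<close>: the body,
  abstracted over its two variables, is the continuation.\<close>

lemma subst_let_let_app:
  assumes "lin (LetTup x y s t)" "disjoint_lin (fv (LetTup x y s t)) \<sigma>"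
  shows "subst \<sigma> (LetTup x y s t) \<approx> let_app (subst \<sigma> s) (subst \<sigma> (Fn x (Fn y t)))"
proof -
  let ?K = "subst \<sigma> (Fn x (Fn y t))"
  have disjoint_lin: "disjoint_lin (fv t - {x, y}) \<sigma>" "disjoint_lin (fv s) \<sigma>" using assms(2) by (auto intro: disjoint_lin_subset)
  have fK: "fv ?K = (\<Union>w\<in>fv t - {x, y}. fv (\<sigma> w))" by auto
  obtain a where a: "a \<notin> fv ?K" by (metis ex_new_if_finite finite_fv infinite_UNIV_nat)
  obtain b where "b \<notin> insert a (fv ?K)" by (metis ex_new_if_finite finite_fv finite_insert infinite_UNIV_nat)
  then have b: "b \<notin> fv ?K" "a \<noteq> b" by auto
  have lK: "lin ?K" by (rule lin_subst) (use assms(1) disjoint_lin(1) in \<open>auto intro: disjoint_lin_subset\<close>)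
  have ls: "lin (subst \<sigma> s)" by (rule lin_subst) (use assms(1) disjoint_lin(2) in auto)
  have d: "fv (subst \<sigma> s) \<inter> fv ?K = {}"
    unfolding fK fv_subst using assms(1) by (intro disjoint_lin_disjoint[OF assms(2)]) auto
  have "subst \<sigma> (LetTup x y s t) \<approx> LetTup a b (subst \<sigma> s) (subst (\<sigma>(x := Var a, y := Var b)) t)"
    by (rule conv_subst_let[OF assms]) (use a b fK in auto)
  also have "\<dots> \<approx> LetTup a b (subst \<sigma> s) (App (App ?K (Var a)) (Var b))"
  proof (rule conv_LetTup[OF conv_refl[OF ls] conv_sym conv_lin(2)[OF calculation]])
    show "App (App ?K (Var a)) (Var b) \<approx> subst (\<sigma>(x := Var a, y := Var b)) t"
      by (rule conv_beta_subst2) (use assms(1) disjoint_lin(1) a b fK in auto)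
  qed
  also have "\<dots> \<approx> let_app (subst \<sigma> s) ?K"
    by (rule conv_sym, rule let_app_alpha[OF ls lK d b(2) a b(1)])
  finally show ?thesis .
qed

lemma subst_let_app:
  assumes "lin (let_app s K)" "disjoint_lin (fv (let_app s K)) \<sigma>" "\<And>v. v \<in> fv K \<Longrightarrow> \<sigma> v = Var v"
  shows "subst \<sigma> (let_app s K) \<approx> let_app (subst \<sigma> s) K"
proof -
  obtain x y where xy: "x \<notin> fv K" "y \<notin> fv K" "x \<noteq> y"
    "\<And>s K'. fv K' = fv K \<Longrightarrow> let_app s K' = LetTup x y s (App (App K' (Var x)) (Var y))"
    using let_app_obtain[of K] by blast
  let ?t = "App (App K (Var x)) (Var y)"
  have f: "fv ?t - {x, y} = fv K" using xy by auto
  have fK: "(\<Union>v\<in>fv K. fv (\<sigma> v)) = fv K" using assms(3) by auto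
  have l: "lin (LetTup x y s ?t)" "disjoint_lin (fv (LetTup x y s ?t)) \<sigma>"
    using assms(1,2) unfolding xy(4)[OF refl] .
  have ls: "lin s" "lin K" "fv s \<inter> fv K = {}" using assms(1) by auto
  have "subst \<sigma> (LetTup x y s ?t) \<approx> LetTup x y (subst \<sigma> s) (subst (\<sigma>(x := Var x, y := Var y)) ?t)"
    by (rule conv_subst_let[OF l]) (use xy f fK in auto)
  also have "subst (\<sigma>(x := Var x, y := Var y)) ?t = App (App (subst (\<sigma>(x := Var x, y := Var y)) K) (Var x)) (Var y)"
    by simp
  also have "LetTup x y (subst \<sigma> s) \<dots> \<approx> LetTup x y (subst \<sigma> s) ?t"
  proof (rule conv_LetTup)
    have K: "subst (\<sigma>(x := Var x, y := Var y)) K \<approx> K" using ls(2) assms(3) by (intro subst_id) auto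
    show "App (App (subst (\<sigma>(x := Var x, y := Var y)) K) (Var x)) (Var y) \<approx> ?t"
      using K conv_fv[OF K] xy by (intro conv_App conv_refl) (auto simp del: fv_subst)
    show "subst \<sigma> s \<approx> subst \<sigma> s"
      using l by (intro conv_refl lin_subst) (auto intro: disjoint_lin_subset)
    show "lin (LetTup x y (subst \<sigma> s) (App (App (subst (\<sigma>(x := Var x, y := Var y)) K) (Var x)) (Var y)))"
      by (rule conv_lin(2)[OF calculation])
  qed
  finally show ?thesis unfolding xy(4)[OF refl] .
qed

lemma let_to_let_app:
  assumes "lin (LetTup a b s t)"
  shows "LetTup a b s t \<approx> let_app s (subst Var (Fn a (Fn b t)))"
proof -
  have K: "lin (subst Var (Fn a (Fn b t)))" using assms by (intro lin_subst) auto
  have "LetTup a b s t \<approx> subst Var (LetTup a b s t)" by (rule conv_sym, rule subst_Var[OF assms])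
  also have "\<dots> \<approx> let_app (subst Var s) (subst Var (Fn a (Fn b t)))"
    by (rule subst_let_let_app[OF assms]) simp
  also have "\<dots> \<approx> let_app s (subst Var (Fn a (Fn b t)))"
    using assms K by (intro conv_let_app subst_Var conv_refl) auto
  finally show ?thesis .
qed

text \<open>A commuting conversion in continuation form: the argument is absorbed, \<open>K'\<close>
  being the function that maps \<open>a\<close> and \<open>b\<close> to
  \<open>K a b r\<close>.\<close>

lemma App_let_app:
  assumes "lin (App (let_app s K) r)"
  obtains K' where "lin K'" "fv K' = fv K \<union> fv r" "App (let_app s K) r \<approx> let_app s K'"
    "\<And>u v. lin (App (App (App K u) v) r) \<Longrightarrow> App (App K' u) v \<approx> App (App (App K u) v) r"
proof -
  let ?X = "fv K \<union> fv r"
  obtain a where a: "a \<notin> ?X" by (metis ex_new_if_finite finite_UnI finite_fv infinite_UNIV_nat)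
  obtain b where "b \<notin> insert a ?X" by (metis ex_new_if_finite finite_UnI finite_fv finite_insert infinite_UNIV_nat)
  then have b: "b \<notin> ?X" "a \<noteq> b" by auto
  let ?M = "App (App (App K (Var a)) (Var b)) r"
  \<comment> \<open>The identity substitution brings the abstraction into the form that
    \<open>conv_beta_subst2\<close> contracts.\<close>
  let ?K = "subst Var (Fn a (Fn b ?M))"
  have l: "lin s" "lin K" "lin r" "fv s \<inter> fv K = {}" "fv s \<inter> fv r = {}" "fv K \<inter> fv r = {}" using assms by auto
  have lM: "lin (Fn a (Fn b ?M))" using l a b by auto
  show thesis
  proof
    show "lin ?K" using lM by (intro lin_subst) auto
    show "fv ?K = fv K \<union> fv r" using a b by auto
    have "App (let_app s K) r \<approx> plug (AppL Hole r) (LetTup a b s (App (App K (Var a)) (Var b)))"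
      using a b l by (simp, intro conv_App let_app_alpha conv_refl) auto
    also have "\<dots> \<approx> LetTup a b s (plug (AppL Hole r) (App (App K (Var a)) (Var b)))"
      by (rule conv_comm_let[OF conv_lin(2)[OF calculation]]) (use a b in auto)
    also have "\<dots> \<approx> let_app s ?K"
      using let_to_let_app[OF conv_lin(2)[OF calculation]] by simp
    finally show "App (let_app s K) r \<approx> let_app s ?K" .
    fix u v assume uv: "lin (App (App (App K u) v) r)"
    let ?\<sigma> = "Var(a := u, b := v)"
    have "App (App ?K u) v \<approx> subst ?\<sigma> ?M"
      by (rule conv_beta_subst2) (use lM uv a b in auto)
    also have "\<dots> = App (App (App (subst ?\<sigma> K) u) v) (subst ?\<sigma> r)" using b(2) by simp
    also have "\<dots> \<approx> App (App (App K u) v) r"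
    proof -
      have K: "subst ?\<sigma> K \<approx> K" using l a b by (intro subst_id) auto
      have r: "subst ?\<sigma> r \<approx> r" using l a b by (intro subst_id) auto
      show ?thesis
        using K r conv_fv[OF K] conv_fv[OF r] uv by (intro conv_App conv_refl) (auto simp del: fv_subst)
    qed
    finally show "App (App ?K u) v \<approx> App (App (App K u) v) r" .
  qed
qed

text \<open>The same for an outer tensor elimination: \<open>K'\<close> runs \<open>K\<close> on
  both components and eliminates the result into \<open>K2\<close>.\<close>

lemma let_app_let_app:
  assumes "lin (let_app (let_app s K) K2)"
  obtains K' where "lin K'" "fv K' = fv K \<union> fv K2" "let_app (let_app s K) K2 \<approx> let_app s K'"
    "\<And>u v. lin (let_app (App (App K u) v) K2) \<Longrightarrow> App (App K' u) v \<approx> let_app (App (App K u) v) K2"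
proof -
  obtain x y where xy: "x \<notin> fv K2" "y \<notin> fv K2" "x \<noteq> y"
    "\<And>s K'. fv K' = fv K2 \<Longrightarrow> let_app s K' = LetTup x y s (App (App K' (Var x)) (Var y))"
    using let_app_obtain[of K2] by blast
  let ?X = "fv K \<union> fv K2 \<union> {x, y}"
  obtain a where a: "a \<notin> ?X" by (metis ex_new_if_finite finite_UnI finite_fv infinite_UNIV_nat finite.emptyI finite.insertI)
  obtain b where "b \<notin> insert a ?X" by (metis ex_new_if_finite finite_UnI finite_fv infinite_UNIV_nat finite.emptyI finite.insertI)
  then have b: "b \<notin> ?X" "a \<noteq> b" by auto
  let ?M = "let_app (App (App K (Var a)) (Var b)) K2"
  let ?K = "subst Var (Fn a (Fn b ?M))"
  have l: "lin s" "lin K" "lin K2" "fv s \<inter> fv K = {}" "fv s \<inter> fv K2 = {}" "fv K \<inter> fv K2 = {}" using assms by auto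
  have lM: "lin (Fn a (Fn b ?M))" using l a b by auto
  show thesis
  proof
    show "lin ?K" using lM by (intro lin_subst) auto
    show "fv ?K = fv K \<union> fv K2" using a b by auto
    let ?C = "LetL x y Hole (App (App K2 (Var x)) (Var y))"
    have C: "let_app s' K2 = plug ?C s'" for s' using xy(4)[OF refl, of s'] by simp
    have "let_app (let_app s K) K2 \<approx> let_app (LetTup a b s (App (App K (Var a)) (Var b))) K2"
      using a b l by (intro conv_let_app let_app_alpha conv_refl) auto
    also have "\<dots> = plug ?C (LetTup a b s (App (App K (Var a)) (Var b)))" by (rule C)
    also have "\<dots> \<approx> LetTup a b s (plug ?C (App (App K (Var a)) (Var b)))"
      by (rule conv_comm_let) (use conv_lin(2)[OF calculation] C a b xy in auto)
    also have "plug ?C (App (App K (Var a)) (Var b)) = ?M" by (rule C[symmetric])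
    also have "LetTup a b s ?M \<approx> let_app s ?K"
      by (rule let_to_let_app) (use l a b in auto)
    finally show "let_app (let_app s K) K2 \<approx> let_app s ?K" .
    fix u v assume uv: "lin (let_app (App (App K u) v) K2)"
    let ?\<sigma> = "Var(a := u, b := v)"
    have K: "subst ?\<sigma> K \<approx> K" using l a b by (intro subst_id) auto
    have disjoint_lin: "disjoint_lin (fv ?M) ?\<sigma>" by (rule disjoint_lin_upd2) (use uv a b in auto)
    have "App (App ?K u) v \<approx> subst ?\<sigma> ?M"
      by (rule conv_beta_subst2) (use lM uv a b in auto)
    also have "\<dots> \<approx> let_app (subst ?\<sigma> (App (App K (Var a)) (Var b))) K2"
      by (rule subst_let_app[OF _ disjoint_lin]) (use lM a b in auto)
    also have "subst ?\<sigma> (App (App K (Var a)) (Var b)) = App (App (subst ?\<sigma> K) u) v" using b(2) by simp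
    also have "let_app (App (App (subst ?\<sigma> K) u) v) K2 \<approx> let_app (App (App K u) v) K2"
      using K conv_fv[OF K] uv by (intro conv_let_app conv_App conv_refl) (auto simp del: fv_subst)
    finally show "App (App ?K u) v \<approx> let_app (App (App K u) v) K2" .
  qed
qed

text \<open>Reducibility. In the tensor clause the continuation ranges over all result types, so that
  reducible terms are closed under tensor elimination.\<close>

primrec reducible :: "ty \<Rightarrow> trm \<Rightarrow> bool" where
  "reducible (TVar a) = has_cut_free (TVar a)"
| "reducible (A \<multimap> B) = (\<lambda>s. lin s \<and> (\<forall>u. reducible A u \<longrightarrow> fv s \<inter> fv u = {} \<longrightarrow> reducible B (App s u)))"
| "reducible (A \<otimes> B) = (\<lambda>s. lin s \<and> (\<forall>C K. lin K \<longrightarrow> fv s \<inter> fv K = {} \<longrightarrow>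
     (\<forall>u v. reducible A u \<longrightarrow> reducible B v \<longrightarrow> fv u \<inter> fv v = {} \<longrightarrow> fv K \<inter> (fv u \<union> fv v) = {} \<longrightarrow> has_cut_free C (App (App K u) v))
     \<longrightarrow> has_cut_free C (let_app s K)))"

lemma reducible_lin: "reducible A s \<Longrightarrow> lin s"
  by (cases A) (auto intro: has_cut_free_lin)

text \<open>Inherited from \<open>has_cut_free_ref\<close> at the atoms, since refinement is
  preserved by applying a term and by eliminating it with a continuation.\<close>

lemma reducible_ref: "reducible A s' \<Longrightarrow> s \<preceq> s' \<Longrightarrow> reducible A s"
proof (induction A arbitrary: s s')
  case (TVar a)
  then show ?case using has_cut_free_ref by auto
next
  case (Lolli A B)
  have "reducible B (App s u)" if "reducible A u" "fv s \<inter> fv u = {}" for u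
  proof (rule Lolli.IH(2))
    show "reducible B (App s' u)" using Lolli.prems that refD(3)[OF Lolli.prems(2)] by simp
    show "App s u \<preceq> App s' u" using that Lolli.prems reducible_lin by (intro ref_App ref_refl) auto
  qed
  then show ?case using refD(1)[OF Lolli.prems(2)] by simp
next
  case (Tensor A B)
  have "has_cut_free C (let_app s K)" if "lin K" "fv s \<inter> fv K = {}"
    "\<And>u v. reducible A u \<Longrightarrow> reducible B v \<Longrightarrow> fv u \<inter> fv v = {} \<Longrightarrow> fv K \<inter> (fv u \<union> fv v) = {} \<Longrightarrow> has_cut_free C (App (App K u) v)" for C K
  proof (rule has_cut_free_ref)
    show "let_app s K \<preceq> let_app s' K" using that Tensor.prems by (intro ref_let_app ref_refl) auto
    show "has_cut_free C (let_app s' K)" using Tensor.prems that refD(3)[OF Tensor.prems(2)] by simp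
  qed
  then show ?case using refD(1)[OF Tensor.prems(2)] by simp
qed

lemma reducible_conv: "reducible A s' \<Longrightarrow> s \<approx> s' \<Longrightarrow> reducible A s"
  using reducible_ref convD(1) by blast

text \<open>The tensor clause of \<open>reducible\<close> yields only cut-free forms. Reducible
  results follow by induction on the result type, absorbing an argument or a further continuation
  into \<open>K\<close>.\<close>

lemma reducible_let_app:
  assumes "reducible (A \<otimes> B) s"
  shows "lin K \<Longrightarrow> fv s \<inter> fv K = {} \<Longrightarrow>
     (\<And>u v. reducible A u \<Longrightarrow> reducible B v \<Longrightarrow> fv u \<inter> fv v = {} \<Longrightarrow> fv K \<inter> (fv u \<union> fv v) = {} \<Longrightarrow> reducible C (App (App K u) v))
     \<Longrightarrow> reducible C (let_app s K)"
proof (induction C arbitrary: K)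
  case (TVar a)
  then show ?case using assms by simp
next
  case (Lolli C1 C2)
  have ls: "lin s" using reducible_lin[OF assms] .
  have "reducible C2 (App (let_app s K) r)" if r: "reducible C1 r" "fv (let_app s K) \<inter> fv r = {}" for r
  proof -
    have "lin (App (let_app s K) r)" using ls Lolli.prems r reducible_lin[OF r(1)] by simp
    then obtain K' where K': "lin K'" "fv K' = fv K \<union> fv r" "App (let_app s K) r \<approx> let_app s K'"
      "\<And>u v. lin (App (App (App K u) v) r) \<Longrightarrow> App (App K' u) v \<approx> App (App (App K u) v) r"
      by (rule App_let_app) blast
    have "reducible C2 (let_app s K')"
    proof (rule Lolli.IH(2)[OF K'(1)])
      show "fv s \<inter> fv K' = {}" using K'(2) Lolli.prems(2) r(2) by auto
      fix u v assume uv: "reducible A u" "reducible B v" "fv u \<inter> fv v = {}" "fv K' \<inter> (fv u \<union> fv v) = {}"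
      then have d: "fv K \<inter> (fv u \<union> fv v) = {}" "fv r \<inter> (fv u \<union> fv v) = {}" using K'(2) by auto
      have R: "reducible (C1 \<multimap> C2) (App (App K u) v)" by (rule Lolli.prems(3)) (use uv d in auto)
      have "fv (App (App K u) v) \<inter> fv r = {}" using d r(2) by auto
      then have "reducible C2 (App (App (App K u) v) r)" using R r(1) by simp
      moreover have "App (App K' u) v \<approx> App (App (App K u) v) r"
        by (rule K'(4)) (rule reducible_lin[OF calculation])
      ultimately show "reducible C2 (App (App K' u) v)" by (rule reducible_conv)
    qed
    then show ?thesis using K'(3) by (rule reducible_conv)
  qed
  then show ?case using ls Lolli.prems by simp
next
  case (Tensor C1 C2)
  have ls: "lin s" using reducible_lin[OF assms] .
  have "has_cut_free C (let_app (let_app s K) K2)" if K2: "lin K2" "fv (let_app s K) \<inter> fv K2 = {}"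
    "\<And>u v. reducible C1 u \<Longrightarrow> reducible C2 v \<Longrightarrow> fv u \<inter> fv v = {} \<Longrightarrow> fv K2 \<inter> (fv u \<union> fv v) = {} \<Longrightarrow> has_cut_free C (App (App K2 u) v)" for C K2
  proof -
    have "lin (let_app (let_app s K) K2)" using ls Tensor.prems K2 by simp
    then obtain K' where K': "lin K'" "fv K' = fv K \<union> fv K2" "let_app (let_app s K) K2 \<approx> let_app s K'"
      "\<And>u v. lin (let_app (App (App K u) v) K2) \<Longrightarrow> App (App K' u) v \<approx> let_app (App (App K u) v) K2"
      by (rule let_app_let_app) blast
    have "has_cut_free C (App (App K' u) v)"
      if uv: "reducible A u" "reducible B v" "fv u \<inter> fv v = {}" "fv K' \<inter> (fv u \<union> fv v) = {}" for u v
    proof -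
      have d: "fv K \<inter> (fv u \<union> fv v) = {}" "fv K2 \<inter> (fv u \<union> fv v) = {}" using uv K'(2) by auto
      have R: "reducible (C1 \<otimes> C2) (App (App K u) v)" by (rule Tensor.prems(3)) (use uv d in auto)
      have "fv (App (App K u) v) \<inter> fv K2 = {}" using d K2(2) by auto
      then have "has_cut_free C (let_app (App (App K u) v) K2)" using R K2 by simp
      moreover have "App (App K' u) v \<approx> let_app (App (App K u) v) K2"
        by (rule K'(4)) (rule has_cut_free_lin[OF calculation])
      ultimately show ?thesis using has_cut_free_conv by blast
    qed
    moreover have "fv s \<inter> fv K' = {}" using K'(2) Tensor.prems(2) K2(2) by auto
    ultimately have "has_cut_free C (let_app s K')" using assms K'(1) by simp
    then show ?thesis using K'(3) has_cut_free_conv by blast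
  qed
  then show ?case using ls Tensor.prems by simp
qed

text \<open>Reflection and reification, proved together: reification at
  \<open>A \<multimap> B\<close> uses that variables of type \<open>A\<close> are reducible, which
  is reflection at \<open>A\<close>, and reflection at \<open>A \<multimap> B\<close> uses cut-free
  forms of reducible arguments, which is reification at \<open>A\<close>.\<close>

lemma neutral_reducible: "(\<forall>n. neutral A n \<longrightarrow> reducible A n) \<and> (\<forall>s. reducible A s \<longrightarrow> has_cut_free A s)"
proof (induction A)
  case (TVar a)
  have "has_cut_free (TVar a) n" if n: "neutral (TVar a) n" for n
  proof -
    \<comment> \<open>The neutral term is cut against the axiom on a variable \<open>y\<close> of
      the same atom; the cut contracts to \<open>n\<close> itself.\<close>
    obtain y where y: "var_ty y = TVar a" by (rule var_ty_fresh[of "{}"]) auto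
    have "has_cut_free (TVar a) (App (Fn y (Var y)) n)"
      by (rule neutral_cut[OF n has_cut_free_var[OF y]]) (use y in auto)
    moreover have "App (Fn y (Var y)) n \<approx> subst (Var(y := n)) (Var y)"
      using neutral_lin[OF n] by (intro conv_beta) auto
    ultimately show ?thesis using has_cut_free_conv[OF conv_sym] by simp
  qed
  then show ?case by simp
next
  case (Lolli A B)
  have "reducible (A \<multimap> B) n" if n: "neutral (A \<multimap> B) n" for n
  proof -
    have "reducible B (App n u)" if "reducible A u" "fv n \<inter> fv u = {}" for u
      using Lolli neutral_app[OF n] that by blast
    then show ?thesis using neutral_lin[OF n] by simp
  qed
  moreover have "has_cut_free (A \<multimap> B) s" if s: "reducible (A \<multimap> B) s" for s
  proof -
    obtain x where x: "x \<notin> fv s" "var_ty x = A" by (rule var_ty_fresh[of "fv s"]) auto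
    have "reducible A (Var x)" using Lolli neutral_var[of x] x(2) by simp
    then have "reducible B (App s (Var x))" using s x(1) by simp
    then have "has_cut_free B (App s (Var x))" using Lolli by blast
    then have "has_cut_free (A \<multimap> B) (Fn x (App s (Var x)))" using has_cut_free_fn x(2) by fastforce
    then show ?thesis using ref_eta[OF reducible_lin[OF s] x(1)] has_cut_free_ref by blast
  qed
  ultimately show ?case by blast
next
  case (Tensor A B)
  have "reducible (A \<otimes> B) n" if n: "neutral (A \<otimes> B) n" for n
  proof -
    have "has_cut_free C (let_app n K)" if K: "lin K" "fv n \<inter> fv K = {}"
      "\<And>u v. reducible A u \<Longrightarrow> reducible B v \<Longrightarrow> fv u \<inter> fv v = {} \<Longrightarrow> fv K \<inter> (fv u \<union> fv v) = {} \<Longrightarrow> has_cut_free C (App (App K u) v)" for C K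
    proof -
      \<comment> \<open>\<open>z\<close> stands for \<open>n\<close>, so that the left rule of
        \<open>\<otimes>\<close> applies; \<open>neutral_cut\<close> puts \<open>n\<close> back in
        its place.\<close>
      obtain z where z: "z \<notin> fv K" "var_ty z = A \<otimes> B" by (rule var_ty_fresh[of "fv K"]) auto
      obtain x where x: "x \<notin> insert z (fv K)" "var_ty x = A" by (rule var_ty_fresh[of "insert z (fv K)"]) auto
      obtain y where y: "y \<notin> insert x (insert z (fv K))" "var_ty y = B"
        by (rule var_ty_fresh[of "insert x (insert z (fv K))"]) auto
      have "reducible A (Var x)" "reducible B (Var y)" using Tensor neutral_var[of x] neutral_var[of y] x(2) y(2) by auto
      then have "has_cut_free C (App (App K (Var x)) (Var y))" using x y by (intro K(3)) auto
      then have "has_cut_free C (LetTup x y (Var z) (App (App K (Var x)) (Var y)))"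
        using x y z by (intro has_cut_free_let) auto
      moreover have "let_app (Var z) K \<approx> LetTup x y (Var z) (App (App K (Var x)) (Var y))"
        using x y z K by (intro let_app_alpha) auto
      ultimately have "has_cut_free C (let_app (Var z) K)" using has_cut_free_conv by blast
      then have "has_cut_free C (App (Fn z (let_app (Var z) K)) n)"
        using z K by (intro neutral_cut[OF n]) auto
      moreover have "let_app n K \<approx> App (Fn z (let_app (Var z) K)) n"
      proof -
        have l: "lin (App (Fn z (let_app (Var z) K)) n)" using K z neutral_lin[OF n] by auto
        have "App (Fn z (let_app (Var z) K)) n \<approx> subst (Var(z := n)) (let_app (Var z) K)"
          by (rule conv_beta[OF l])
        also have "\<dots> \<approx> let_app (subst (Var(z := n)) (Var z)) K"
          using K z neutral_lin[OF n] by (intro subst_let_app disjoint_lin_upd) auto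
        finally show ?thesis using conv_sym by simp
      qed
      ultimately show ?thesis using has_cut_free_conv by blast
    qed
    then show ?thesis using neutral_lin[OF n] by simp
  qed
  moreover have "has_cut_free (A \<otimes> B) s" if s: "reducible (A \<otimes> B) s" for s
  proof -
    \<comment> \<open>The pairing continuation: \<open>let_app s ?K\<close> is the eta-expansion of
      \<open>s\<close> up to conversion.\<close>
    let ?K0 = "Fn 0 (Fn 1 (Tup (Var 0) (Var 1)))"
    let ?K = "subst Var ?K0"
    have K: "lin ?K" "fv ?K = {}" by (auto intro!: lin_subst)
    have beta: "App (App ?K u) v \<approx> Tup u v" if "lin (Tup u v)" for u v
      using conv_beta_subst2[of 0 1 "Tup (Var 0) (Var 1)" Var u v] that by simp
    have "has_cut_free (A \<otimes> B) (let_app s ?K)"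
    proof -
      have "has_cut_free (A \<otimes> B) (App (App ?K u) v)" if "reducible A u" "reducible B v" "fv u \<inter> fv v = {}" for u v
      proof -
        have "has_cut_free (A \<otimes> B) (Tup u v)" using that Tensor has_cut_free_tup by blast
        then show ?thesis using beta[OF has_cut_free_lin] has_cut_free_conv by blast
      qed
      then show ?thesis using s K by simp
    qed
    moreover have "s \<preceq> let_app s ?K"
    proof -
      have "s \<preceq> LetTup 0 1 s (Tup (Var 0) (Var 1))" by (rule ref_eta_let[OF reducible_lin[OF s]]) simp
      also have "\<dots> \<approx> LetTup 0 1 s (App (App ?K (Var 0)) (Var 1))"
        by (rule conv_LetTup[OF conv_refl[OF reducible_lin[OF s]] conv_sym[OF beta] refD(2)[OF calculation]]) simp
      also have "\<dots> \<approx> let_app s ?K"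
        by (rule conv_sym, rule let_app_alpha) (use K reducible_lin[OF s] in auto)
      finally show ?thesis .
    qed
    ultimately show ?thesis using has_cut_free_ref by blast
  qed
  ultimately show ?case by blast
qed

text \<open>The fundamental lemma of the logical relation. Tensor elimination is the case that calls
  for \<open>reducible_let_app\<close> at an arbitrary result type.\<close>

lemma reducible_fundamental:
  "lin t \<Longrightarrow> styp e t A \<Longrightarrow> disjoint_lin (fv t) \<sigma> \<Longrightarrow> (\<And>x. x \<in> fv t \<Longrightarrow> reducible (e x) (\<sigma> x)) \<Longrightarrow> reducible A (subst \<sigma> t)"
proof (induction t arbitrary: e A \<sigma>)
  case (Var x)
  then show ?case by auto
next
  case (App t s)
  then obtain B where B: "styp e t (B \<multimap> A)" "styp e s B" by auto
  have "reducible (B \<multimap> A) (subst \<sigma> t)"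
    by (rule App.IH(1)[OF _ B(1)]) (use App.prems in \<open>auto intro: disjoint_lin_subset\<close>)
  moreover have "reducible B (subst \<sigma> s)"
    by (rule App.IH(2)[OF _ B(2)]) (use App.prems in \<open>auto intro: disjoint_lin_subset\<close>)
  moreover have "fv (subst \<sigma> t) \<inter> fv (subst \<sigma> s) = {}"
    using lin_subst[OF App.prems(1,3)] by simp
  ultimately show ?case by simp
next
  case (Fn x t)
  then obtain B C where A: "A = B \<multimap> C" "styp (e(x := B)) t C" by auto
  have l: "lin (subst \<sigma> (Fn x t))" by (rule lin_subst[OF Fn.prems(1,3)])
  have "reducible C (App (subst \<sigma> (Fn x t)) u)" if u: "reducible B u" "fv (subst \<sigma> (Fn x t)) \<inter> fv u = {}" for u
  proof (rule reducible_conv)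
    have d: "disjoint_lin (fv t - {x}) \<sigma>" "lin u" "fv u \<inter> (\<Union>v\<in>fv t - {x}. fv (\<sigma> v)) = {}"
      using Fn.prems(3) reducible_lin[OF u(1)] u(2) by auto
    show "App (subst \<sigma> (Fn x t)) u \<approx> subst (\<sigma>(x := u)) t"
      by (rule conv_beta_subst[OF Fn.prems(1) d])
    show "reducible C (subst (\<sigma>(x := u)) t)"
      by (rule Fn.IH[OF _ A(2) disjoint_lin_upd[OF d]]) (use Fn.prems u in auto)
  qed
  then show ?case using l A(1) by simp
next
  case (Tup t s)
  then obtain B C where A: "A = B \<otimes> C" "styp e t B" "styp e s C" by auto
  have R: "reducible B (subst \<sigma> t)" "reducible C (subst \<sigma> s)"
    by (rule Tup.IH(1)[OF _ A(2)], use Tup.prems in \<open>auto intro: disjoint_lin_subset\<close>)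
      (rule Tup.IH(2)[OF _ A(3)], use Tup.prems in \<open>auto intro: disjoint_lin_subset\<close>)
  have l: "lin (Tup (subst \<sigma> t) (subst \<sigma> s))"
    using lin_subst[OF Tup.prems(1,3)] by simp
  have "has_cut_free D (let_app (Tup (subst \<sigma> t) (subst \<sigma> s)) K)"
    if K: "lin K" "fv (Tup (subst \<sigma> t) (subst \<sigma> s)) \<inter> fv K = {}"
    "\<And>u v. reducible B u \<Longrightarrow> reducible C v \<Longrightarrow> fv u \<inter> fv v = {} \<Longrightarrow> fv K \<inter> (fv u \<union> fv v) = {} \<Longrightarrow> has_cut_free D (App (App K u) v)" for D K
  proof (rule has_cut_free_conv)
    show "let_app (Tup (subst \<sigma> t) (subst \<sigma> s)) K \<approx> App (App K (subst \<sigma> t)) (subst \<sigma> s)"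
      by (rule let_app_pair[OF l K(1,2)])
    show "has_cut_free D (App (App K (subst \<sigma> t)) (subst \<sigma> s))"
      by (rule K(3)[OF R]) (use l K(2) in \<open>auto simp del: fv_subst\<close>)
  qed
  then show ?case using l A(1) by simp
next
  case (LetTup x y s t)
  then obtain B C where B: "styp e s (B \<otimes> C)" "styp (e(x := B, y := C)) t A" by auto
  let ?K = "subst \<sigma> (Fn x (Fn y t))"
  have disjoint_lin: "disjoint_lin (fv t - {x, y}) \<sigma>" using LetTup.prems(3) by (rule disjoint_lin_subset) auto
  have eq: "fv (Fn x (Fn y t)) = fv t - {x, y}" by auto
  have lK: "lin ?K" by (rule lin_subst) (use LetTup.prems disjoint_lin eq in auto)
  have R: "reducible (B \<otimes> C) (subst \<sigma> s)"
    by (rule LetTup.IH(1)[OF _ B(1)]) (use LetTup.prems in \<open>auto intro: disjoint_lin_subset\<close>)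
  have c: "subst \<sigma> (LetTup x y s t) \<approx> let_app (subst \<sigma> s) ?K"
    by (rule subst_let_let_app[OF LetTup.prems(1,3)])
  have "reducible A (let_app (subst \<sigma> s) ?K)"
  proof (rule reducible_let_app[OF R lK])
    show "fv (subst \<sigma> s) \<inter> fv ?K = {}" using conv_lin(2)[OF c] by simp
    fix u v assume uv: "reducible B u" "reducible C v" "fv u \<inter> fv v = {}" "fv ?K \<inter> (fv u \<union> fv v) = {}"
    have fK: "fv ?K = (\<Union>w\<in>fv t - {x, y}. fv (\<sigma> w))" by auto
    note d = disjoint_lin reducible_lin[OF uv(1)] reducible_lin[OF uv(2)]
    show "reducible A (App (App ?K u) v)"
    proof (rule reducible_conv)
      show "App (App ?K u) v \<approx> subst (\<sigma>(x := u, y := v)) t"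
        by (rule conv_beta_subst2[OF _ d uv(3)]) (use LetTup.prems uv(4) fK in auto)
      have d2: "disjoint_lin (fv t) (\<sigma>(x := u, y := v))"
        by (rule disjoint_lin_upd2[OF d]) (use uv(3,4) fK in auto)
      show "reducible A (subst (\<sigma>(x := u, y := v)) t)"
        by (rule LetTup.IH(2)[OF _ B(2) d2]) (use LetTup.prems uv in auto)
    qed
  qed
  then show ?case using c by (rule reducible_conv)
qed

lemma closed_has_cut_free:
  assumes "lin s" "fv s = {}" "styp e s A"
  shows "has_cut_free A s"
proof -
  have "reducible A (subst Var s)" by (rule reducible_fundamental[OF assms(1,3)]) (use assms(2) in auto)
  then have "has_cut_free A (subst Var s)" using neutral_reducible by blast
  then show ?thesis using has_cut_free_conv[OF conv_sym[OF subst_Var[OF assms(1)]]] by blast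
qed

section \<open>Relabelling of atoms, and proofs over distinct labels\<close>

definition relabel :: "(nat \<Rightarrow> nat) \<Rightarrow> ty \<Rightarrow> ty" where
  "relabel r = tsubst (TVar \<circ> r)"

lemma relabel_simps [simp]:
  "relabel r (TVar a) = TVar (r a)"
  "relabel r (A \<otimes> B) = relabel r A \<otimes> relabel r B"
  "relabel r (A \<multimap> B) = relabel r A \<multimap> relabel r B"
  by (simp_all add: relabel_def)

text \<open>The rules inspect types only through their constructors, which \<open>relabel\<close>
  preserves. So a proof can be replayed over any labelling of its sequent, and an axiom on equal
  atoms becomes a link between labels with the same image under \<open>r\<close>.\<close>

lemma cut_free_lift:
  "cut_free e A s L \<Longrightarrow> L \<subseteq> Id \<Longrightarrow> A = relabel r A' \<Longrightarrow> (\<And>x. x \<in> fv s \<Longrightarrow> e x = relabel r (e' x))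
    \<Longrightarrow> \<exists>L'. cut_free e' A' s L' \<and> (\<forall>(i, j)\<in>L'. r i = r j)"
proof (induction arbitrary: A' e' rule: cut_free.induct)
  case (cut_free_ax e x i j)
  obtain a where a: "A' = TVar a" "r a = j" using cut_free_ax.prems(2) by (cases A') auto
  obtain b where b: "e' x = TVar b" "r b = i" using cut_free_ax.prems(3) cut_free_ax.hyps by (cases "e' x") auto
  have "cut_free e' A' (Var x) {(b, a)}" unfolding a(1) using cut_free.cut_free_ax b(1) by blast
  then show ?case using a b cut_free_ax.prems(1) by (intro exI[of _ "{(b, a)}"]) auto
next
  case (cut_free_fn e x A B s L)
  obtain A1 B1 where A': "A' = A1 \<multimap> B1" "A = relabel r A1" "B = relabel r B1"
    using cut_free_fn.prems(2) by (cases A') auto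
  have "\<exists>L'. cut_free (e'(x := A1)) B1 s L' \<and> (\<forall>(i, j)\<in>L'. r i = r j)"
    by (rule cut_free_fn.IH) (use cut_free_fn.prems A' in auto)
  then show ?case using cut_free.cut_free_fn cut_free_fn.hyps(2) A'(1) by blast
next
  case (cut_free_tup e A s L B t L')
  obtain A1 B1 where A': "A' = A1 \<otimes> B1" "A = relabel r A1" "B = relabel r B1"
    using cut_free_tup.prems(2) by (cases A') auto
  have "\<exists>L'. cut_free e' A1 s L' \<and> (\<forall>(i, j)\<in>L'. r i = r j)"
    by (rule cut_free_tup.IH) (use cut_free_tup.prems A' in auto)
  moreover have "\<exists>L'. cut_free e' B1 t L' \<and> (\<forall>(i, j)\<in>L'. r i = r j)"
    by (rule cut_free_tup.IH) (use cut_free_tup.prems A' in auto)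
  ultimately obtain L1 L2 where *: "cut_free e' A1 s L1" "\<forall>(i, j)\<in>L1. r i = r j" "cut_free e' B1 t L2" "\<forall>(i, j)\<in>L2. r i = r j"
    by blast
  have "cut_free e' A' (Tup s t) (L1 \<union> L2)" unfolding A'(1) by (rule cut_free.cut_free_tup[OF *(1,3) cut_free_tup.hyps(3)])
  then show ?case using *(2,4) by blast
next
  case (cut_free_let e z X Y x y C t L)
  obtain X1 Y1 where z: "e' z = X1 \<otimes> Y1" "X = relabel r X1" "Y = relabel r Y1"
    using cut_free_let.prems(3)[of z] cut_free_let.hyps(1) by (cases "e' z") auto
  have "\<exists>L'. cut_free (e'(x := X1, y := Y1)) A' t L' \<and> (\<forall>(i, j)\<in>L'. r i = r j)"
    by (rule cut_free_let.IH) (use cut_free_let.prems z in auto)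
  then show ?case using cut_free.cut_free_let[of e' z, OF z(1)] cut_free_let.hyps(3-6) by blast
next
  case (cut_free_app e z U R u L y C t L')
  obtain U1 R1 where z: "e' z = U1 \<multimap> R1" "U = relabel r U1" "R = relabel r R1"
    using cut_free_app.prems(3)[of z] cut_free_app.hyps(1) by (cases "e' z") auto
  have "\<exists>L'. cut_free e' U1 u L' \<and> (\<forall>(i, j)\<in>L'. r i = r j)"
    by (rule cut_free_app.IH) (use cut_free_app.prems z in auto)
  moreover have "\<exists>L'. cut_free (e'(y := R1)) A' t L' \<and> (\<forall>(i, j)\<in>L'. r i = r j)"
    by (rule cut_free_app.IH) (use cut_free_app.prems z in auto)
  ultimately obtain L1 L2 where *: "cut_free e' U1 u L1" "\<forall>(i, j)\<in>L1. r i = r j"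
    "cut_free (e'(y := R1)) A' t L2" "\<forall>(i, j)\<in>L2. r i = r j"
    by blast
  have "cut_free e' A' (App (Fn y t) (App (Var z) u)) (L1 \<union> L2)"
    by (rule cut_free.cut_free_app[of e' z, OF z(1) *(1,3) cut_free_app.hyps(4-7)])
  then show ?case using *(2,4) by blast
qed

lemma relabel_relabel: "relabel f (relabel g A) = relabel (\<lambda>a. f (g a)) A"
  by (induction A) auto

lemma relabel_cong: "(\<And>a. f a = g a) \<Longrightarrow> relabel f A = relabel g A"
  by (induction A) auto

lemma labs_rename: "labs (relabel f A) = f ` labs A"
  by (induction A) auto

lemma distinct_labs_rename: "inj f \<Longrightarrow> distinct_labs (relabel f A) = distinct_labs A"
  by (induction A) (auto simp: labs_rename image_Int[symmetric])

lemma separate_labels: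
  assumes "distinct_labs A" "distinct_labs B"
  obtains A' B' r where "distinct_labs A'" "distinct_labs B'" "labs A' \<inter> labs B' = {}"
    "relabel r A' = relabel f A" "relabel r B' = relabel g B"
proof
  \<comment> \<open>Even and odd numbers keep the label sets apart; halving recovers the old label,
    and parity tells which of \<open>f\<close> and \<open>g\<close> to use.\<close>
  let ?A = "relabel (\<lambda>n. 2 * n) A" and ?B = "relabel (\<lambda>n. 2 * n + 1) B"
  let ?r = "\<lambda>n. if even n then f (n div 2) else g (n div 2)"
  show "distinct_labs ?A" "distinct_labs ?B" using assms by (simp_all add: distinct_labs_rename inj_def)
  show "labs ?A \<inter> labs ?B = {}" unfolding labs_rename by (auto; presburger)
  show "relabel ?r ?A = relabel f A"
    unfolding relabel_relabel by (rule relabel_cong) simp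
  show "relabel ?r ?B = relabel g B"
    unfolding relabel_relabel by (rule relabel_cong) simp
qed

lemma linear_labelling: "\<exists>A' r. distinct_labs A' \<and> relabel r A' = A"
proof (induction A)
  case (TVar a)
  show ?case by (intro exI[of _ "TVar 0"] exI[of _ "\<lambda>_. a"]) simp
next
  case (Tensor A B)
  then obtain A' f B' g where *: "distinct_labs A'" "relabel f A' = A" "distinct_labs B'" "relabel g B' = B" by blast
  from separate_labels[OF *(1,3), of f g] obtain A2 B2 r where "distinct_labs A2" "distinct_labs B2" "labs A2 \<inter> labs B2 = {}"
    "relabel r A2 = A" "relabel r B2 = B" using *(2,4) by metis
  then show ?case by (intro exI[of _ "A2 \<otimes> B2"] exI[of _ r]) simp
next
  case (Lolli A B)
  then obtain A' f B' g where *: "distinct_labs A'" "relabel f A' = A" "distinct_labs B'" "relabel g B' = B" by blast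
  from separate_labels[OF *(1,3), of f g] obtain A2 B2 r where "distinct_labs A2" "distinct_labs B2" "labs A2 \<inter> labs B2 = {}"
    "relabel r A2 = A" "relabel r B2 = B" using *(2,4) by metis
  then show ?case by (intro exI[of _ "A2 \<multimap> B2"] exI[of _ r]) simp
qed

text \<open>The condition on the links is the hypothesis of \<open>cut_free_coherent\<close> for
  \<open>TVar \<circ> r\<close>. The environment can be chosen at will because \<open>s'\<close> is
  closed.\<close>

lemma normal_form:
  assumes "[] \<turnstile> s \<Colon> relabel r A"
  shows "\<exists>s' L. s \<preceq> s' \<and> cut_free e A s' L \<and> (\<forall>(i, j)\<in>L. r i = r j)"
proof -
  have "fv s = {}" using typing_fv[OF assms] by (simp add: vars_of_def)
  moreover have "styp e s (relabel r A)" using typing_styp[OF assms] by simp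
  ultimately have "has_cut_free (relabel r A) s" using closed_has_cut_free typing_lin[OF assms] by blast
  then obtain s' L where s: "s \<preceq> s'" "cut_free var_ty (relabel r A) s' L" "L \<subseteq> Id"
    unfolding has_cut_free_def by blast
  have "fv s' = {}" using refD(3)[OF s(1)] \<open>fv s = {}\<close> by simp
  then show ?thesis using cut_free_lift[OF s(2,3) refl, of e] s(1) by blast
qed

subsection \<open>Words\<close>

abbreviation closed :: "trm \<Rightarrow> bool" where
  "closed t \<equiv> lin t \<and> fv t = {}"

definition marks :: "(nat \<Rightarrow> trm) \<Rightarrow> bool" where
  "marks c \<longleftrightarrow> (\<forall>i. closed (c i))"

lemma marksD: "marks c \<Longrightarrow> closed (c i)"
  by (simp add: marks_def)

abbreviation Id_trm :: trm where
  "Id_trm \<equiv> Fn 0 (Var 0)"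

lemma conv_beta2:
  assumes "lin (Fn x (Fn y t))" "fv (Fn x (Fn y t)) = {}" "closed u" "closed v"
  shows "App (App (Fn x (Fn y t)) u) v \<approx> subst (Var(x := u, y := v)) t"
proof -
  have f: "fv t - {x, y} = {}" using assms(2) by auto
  have "App (App (Fn x (Fn y t)) u) v \<approx> App (App (subst Var (Fn x (Fn y t))) u) v"
    using assms by (intro conv_App conv_refl conv_sym[OF subst_Var]) auto
  also have "\<dots> \<approx> subst (Var(x := u, y := v)) t"
    by (rule conv_beta_subst2) (use assms f in auto)
  finally show ?thesis .
qed

lemma subst_closed: "closed t \<Longrightarrow> subst \<sigma> t \<approx> t"
  by (rule subst_id) auto

lemma closed_ref: "s \<preceq> t \<Longrightarrow> closed t \<Longrightarrow> closed s"
  using refD by simp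

text \<open>\<open>consumer c A\<close> feeds a term of type \<open>A\<close> with producers and composes what comes out;
  \<open>producer c A\<close> makes a term of type \<open>A\<close> that carries along a word given as argument. Each label \<open>i\<close>
  is marked by the function \<open>c i\<close>, so that a term is mapped to the composition of these functions
  in an order in which linked labels are adjacent.\<close>

fun consumer :: "(nat \<Rightarrow> trm) \<Rightarrow> ty \<Rightarrow> trm" and producer :: "(nat \<Rightarrow> trm) \<Rightarrow> ty \<Rightarrow> trm" where
  "consumer c (TVar j) = Fn 0 (Fn 1 (App (c j) (App (Var 0) (Var 1))))"
| "consumer c (A \<multimap> B) = Fn 0 (App (consumer c B) (App (Var 0) (App (producer c A) Id_trm)))"
| "consumer c (A \<otimes> B) = Fn 0 (Fn 1 (LetTup 2 3 (Var 0)
     (App (App (consumer c A) (Var 2)) (App (App (consumer c B) (Var 3)) (Var 1)))))"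
| "producer c (TVar i) = Fn 0 (Fn 1 (App (c i) (App (Var 0) (Var 1))))"
| "producer c (A \<multimap> B) = Fn 0 (Fn 1 (App (producer c B)
     (Fn 2 (App (App (consumer c A) (Var 1)) (App (Var 0) (Var 2))))))"
| "producer c (A \<otimes> B) = Fn 0 (Tup (App (producer c A) (Var 0)) (App (producer c B) Id_trm))"

lemma closed_consumer_producer:
  assumes "marks c"
  shows "closed (consumer c A) \<and> closed (producer c A)"
  by (induction A) (use assms in \<open>auto simp: marks_def\<close>)

lemma consumer_TVar:
  assumes "marks c" "closed s" "closed k"
  shows "App (App (consumer c (TVar j)) s) k \<approx> App (c j) (App s k)"
    and "App (App (producer c (TVar j)) s) k \<approx> App (c j) (App s k)"
proof -
  have "App (App (consumer c (TVar j)) s) k \<approx> subst (Var(0 := s, 1 := k)) (App (c j) (App (Var 0) (Var 1)))"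
    unfolding consumer.simps by (rule conv_beta2) (use assms marksD[of c j] in auto)
  also have "\<dots> = App (subst (Var(0 := s, 1 := k)) (c j)) (App s k)" by simp
  also have "\<dots> \<approx> App (c j) (App s k)"
    using assms marksD[of c j] by (intro conv_App conv_refl subst_closed) auto
  finally show "App (App (consumer c (TVar j)) s) k \<approx> App (c j) (App s k)" .
  then show "App (App (producer c (TVar j)) s) k \<approx> App (c j) (App s k)" by simp
qed

lemma consumer_Lolli:
  assumes "marks c" "closed s"
  shows "App (consumer c (A \<multimap> B)) s \<approx> App (consumer c B) (App s (App (producer c A) Id_trm))"
proof -
  note cl = closed_consumer_producer[of c, OF assms(1)]
  let ?\<sigma> = "Var(0 := s)"
  have "App (consumer c (A \<multimap> B)) s \<approx> subst ?\<sigma> (App (consumer c B) (App (Var 0) (App (producer c A) Id_trm)))"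
    unfolding consumer.simps by (rule conv_beta) (use assms(2) cl in auto)
  also have "\<dots> = App (subst ?\<sigma> (consumer c B)) (App s (subst ?\<sigma> (App (producer c A) Id_trm)))" by simp
  also have "\<dots> \<approx> App (consumer c B) (App s (App (producer c A) Id_trm))"
    using assms(2) cl by (intro conv_App conv_refl subst_closed) (auto simp del: subst.simps)
  finally show ?thesis .
qed

lemma consumer_Tensor:
  assumes "marks c" "closed s" "closed t" "closed k"
  shows "App (App (consumer c (A \<otimes> B)) (Tup s t)) k
     \<preceq> App (App (consumer c A) s) (App (App (consumer c B) t) k)"
proof -
  note cl = closed_consumer_producer[of c, OF assms(1)]
  let ?M = "App (App (consumer c A) (Var 2)) (App (App (consumer c B) (Var 3)) (Var 1))"
  let ?\<sigma> = "Var(0 := Tup s t, 1 := k)"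
  have lM: "lin (LetTup 2 3 (Var 0) ?M)" "fv (LetTup 2 3 (Var 0) ?M) = {0, 1}" using cl by auto
  have "App (App (consumer c (A \<otimes> B)) (Tup s t)) k \<approx> subst ?\<sigma> (LetTup 2 3 (Var 0) ?M)"
    unfolding consumer.simps by (rule conv_beta2) (use assms(2-4) lM in auto)
  also have "\<dots> \<preceq> subst (?\<sigma>(2 := s, 3 := t)) ?M"
    by (rule ref_beta_let_subst[OF lM(1)]) (use assms(2-4) lM(2) in \<open>auto simp: disjoint_lin_def\<close>)
  also have "subst (?\<sigma>(2 := s, 3 := t)) ?M = App (App (subst (?\<sigma>(2 := s, 3 := t)) (consumer c A)) s)
      (App (App (subst (?\<sigma>(2 := s, 3 := t)) (consumer c B)) t) k)" by simp
  also have "\<dots> \<approx> App (App (consumer c A) s) (App (App (consumer c B) t) k)"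
    using assms(2-4) cl by (intro conv_App conv_refl subst_closed) (auto simp del: subst.simps)
  finally show ?thesis .
qed

lemma producer_Tensor:
  assumes "marks c" "closed w"
  shows "App (producer c (A \<otimes> B)) w \<approx> Tup (App (producer c A) w) (App (producer c B) Id_trm)"
proof -
  note cl = closed_consumer_producer[of c, OF assms(1)]
  let ?\<sigma> = "Var(0 := w)"
  have "App (producer c (A \<otimes> B)) w \<approx> subst ?\<sigma> (Tup (App (producer c A) (Var 0)) (App (producer c B) Id_trm))"
    unfolding producer.simps by (rule conv_beta) (use assms(2) cl in auto)
  also have "\<dots> = Tup (App (subst ?\<sigma> (producer c A)) w) (subst ?\<sigma> (App (producer c B) Id_trm))" by simp
  also have "\<dots> \<approx> Tup (App (producer c A) w) (App (producer c B) Id_trm)"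
    using assms(2) cl by (intro conv_Tup conv_App conv_refl subst_closed) (auto simp del: subst.simps)
  finally show ?thesis .
qed

text \<open>\<open>w'\<close> is the word carried on by the result: it runs the old word
  \<open>w\<close> and, outside it, what the argument \<open>u\<close> contributes. It is described
  by its behaviour on closed terms, which is all that later steps use.\<close>

lemma producer_Lolli:
  assumes "marks c" "closed w" "closed u"
  obtains w' where "closed w'" "App (App (producer c (A \<multimap> B)) w) u \<approx> App (producer c B) w'"
    "\<And>k. closed k \<Longrightarrow> App w' k \<approx> App (App (consumer c A) u) (App w k)"
proof
  note cl = closed_consumer_producer[of c, OF assms(1)]
  let ?M = "App (App (consumer c A) (Var 1)) (App (Var 0) (Var 2))"
  let ?\<sigma> = "Var(0 := w, 1 := u)"
  let ?w = "subst ?\<sigma> (Fn 2 ?M)"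
  have lM: "lin (Fn 2 ?M)" "fv (Fn 2 ?M) = {0, 1}" using cl by auto
  have disjoint_lin: "disjoint_lin {0, 1} ?\<sigma>" using assms(2,3) by (auto simp: disjoint_lin_def)
  have "lin ?w" using lM disjoint_lin by (intro lin_subst) auto
  moreover have "fv ?w = {}" using assms(2,3) unfolding fv_subst lM(2) by simp
  ultimately show w: "closed ?w" by simp
  have "App (App (producer c (A \<multimap> B)) w) u \<approx> subst ?\<sigma> (App (producer c B) (Fn 2 ?M))"
    unfolding producer.simps by (rule conv_beta2) (use assms(2,3) cl lM in auto)
  also have "\<dots> = App (subst ?\<sigma> (producer c B)) ?w" by simp
  also have "\<dots> \<approx> App (producer c B) ?w"
    using w cl by (intro conv_App conv_refl subst_closed) (auto simp del: subst.simps fv_subst)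
  finally show "App (App (producer c (A \<multimap> B)) w) u \<approx> App (producer c B) ?w" .
  fix k assume k: "closed k"
  have f: "fv ?M - {2} = {0, 1}" using lM(2) by simp
  have "App ?w k \<approx> subst (?\<sigma>(2 := k)) ?M"
    by (rule conv_beta_subst[OF lM(1)]) (use k disjoint_lin f in auto)
  also have "\<dots> = App (App (subst (?\<sigma>(2 := k)) (consumer c A)) u) (App w k)" by simp
  also have "\<dots> \<approx> App (App (consumer c A) u) (App w k)"
    using assms(2,3) k cl by (intro conv_App conv_refl subst_closed) (auto simp del: subst.simps)
  finally show "App ?w k \<approx> App (App (consumer c A) u) (App w k)" .
qed

text \<open>In a link the mark of the positive label is the outer one: at an axiom the consumer of
  the positive atom encloses the producer of the negative one.\<close>

primrec act :: "(nat \<Rightarrow> trm) \<Rightarrow> (nat \<times> nat) list \<Rightarrow> trm \<Rightarrow> trm" where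
  "act c [] k = k"
| "act c (p # W) k = App (c (snd p)) (App (c (fst p)) (act c W k))"

lemma act_append: "act c (V @ W) k = act c V (act c W k)"
  by (induction V) auto

lemma closed_act: "marks c \<Longrightarrow> closed k \<Longrightarrow> closed (act c W k)"
  by (induction W) (auto simp: marks_def)

lemma act_mono:
  assumes "marks c" "k \<preceq> k'" "closed k'"
  shows "act c W k \<preceq> act c W k'"
proof (induction W)
  case Nil
  then show ?case using assms by simp
next
  case (Cons p W)
  have "closed (act c W k)" using closed_act[OF assms(1) closed_ref[OF assms(2,3)]] by simp
  then show ?case using Cons assms(1) by (auto intro!: ref_App simp: marks_def)
qed

text \<open>Multiplicities are kept in order to count that a word uses each label occurrence exactly
  once.\<close>

primrec mlabs :: "ty \<Rightarrow> nat multiset" where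
  "mlabs (TVar a) = {#a#}"
| "mlabs (A \<otimes> B) = mlabs A + mlabs B"
| "mlabs (A \<multimap> B) = mlabs A + mlabs B"

text \<open>The labels in the order in which \<open>act\<close> nests their marks, outermost
  first.\<close>

definition flat :: "(nat \<times> nat) list \<Rightarrow> nat list" where
  "flat W = concat (map (\<lambda>(i, j). [j, i]) W)"

lemma flat_simps [simp]: "flat [] = []" "flat ((i, j) # W) = j # i # flat W" "flat (V @ W) = flat V @ flat W"
  by (simp_all add: flat_def)

text \<open>The contribution of the variables to the label count: the labels of their types, which
  the producers emit, and the labels in the words that they already carry.\<close>

definition weight :: "(var \<Rightarrow> ty) \<Rightarrow> (var \<Rightarrow> (nat \<times> nat) list) \<Rightarrow> var set \<Rightarrow> nat multiset" where
  "weight e \<omega> X = (\<Sum>x\<in>X. mlabs (e x) + mset (flat (\<omega> x)))"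

lemma weight_upd:
  assumes "finite X" "x \<in> X"
  shows "weight (e(x := A)) (\<omega>(x := l)) X = mlabs A + mset (flat l) + weight e \<omega> (X - {x})"
proof -
  have "weight (e(x := A)) (\<omega>(x := l)) X = mlabs A + mset (flat l) + weight (e(x := A)) (\<omega>(x := l)) (X - {x})"
    unfolding weight_def using sum.remove[OF assms, of "\<lambda>v. mlabs ((e(x := A)) v) + mset (flat ((\<omega>(x := l)) v))"] by simp
  also have "weight (e(x := A)) (\<omega>(x := l)) (X - {x}) = weight e \<omega> (X - {x})"
    unfolding weight_def by (rule sum.cong) auto
  finally show ?thesis .
qed

lemma weight_Un: "finite X \<Longrightarrow> finite Y \<Longrightarrow> X \<inter> Y = {} \<Longrightarrow> weight e \<omega> (X \<union> Y) = weight e \<omega> X + weight e \<omega> Y"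
  unfolding weight_def by (rule sum.union_disjoint)

lemma weight_insert: "finite X \<Longrightarrow> x \<notin> X \<Longrightarrow> weight e \<omega> (insert x X) = mlabs (e x) + mset (flat (\<omega> x)) + weight e \<omega> X"
  unfolding weight_def by simp

lemma Union_upd: "x \<in> X \<Longrightarrow> (\<Union>v\<in>X. set ((\<omega>(x := l)) v)) = set l \<union> (\<Union>v\<in>X - {x}. set (\<omega> v))"
  by (auto split: if_splits)

definition words_ok :: "(nat \<Rightarrow> trm) \<Rightarrow> (var \<Rightarrow> (nat \<times> nat) list) \<Rightarrow> (var \<Rightarrow> trm) \<Rightarrow> var set \<Rightarrow> bool" where
  "words_ok c \<omega> w X \<longleftrightarrow> (\<forall>x\<in>X. closed (w x) \<and> (\<forall>k. closed k \<longrightarrow> App (w x) k \<preceq> act c (\<omega> x) k))"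

definition env :: "(nat \<Rightarrow> trm) \<Rightarrow> (var \<Rightarrow> ty) \<Rightarrow> (var \<Rightarrow> trm) \<Rightarrow> var \<Rightarrow> trm" where
  "env c e w x = App (producer c (e x)) (w x)"

lemma env_upd: "env c (e(x := A)) (w(x := u)) = (env c e w)(x := App (producer c A) u)"
  by (auto simp: env_def)

lemma env_closed: "marks c \<Longrightarrow> words_ok c \<omega> w X \<Longrightarrow> x \<in> X \<Longrightarrow> closed (env c e w x)"
  unfolding env_def words_ok_def using closed_consumer_producer by auto

lemma env_disjoint_lin: "marks c \<Longrightarrow> words_ok c \<omega> w X \<Longrightarrow> disjoint_lin X (env c e w)"
  using env_closed unfolding disjoint_lin_def by auto

lemma closed_subst_env:
  "marks c \<Longrightarrow> words_ok c \<omega> w (fv s) \<Longrightarrow> lin s \<Longrightarrow> closed (subst (env c e w) s)"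
  using env_closed[of c \<omega> w "fv s" _ e] env_disjoint_lin[of c \<omega> w "fv s" e] by (auto intro: lin_subst)

lemma words_ok_subset: "words_ok c \<omega> w X \<Longrightarrow> Y \<subseteq> X \<Longrightarrow> words_ok c \<omega> w Y"
  unfolding words_ok_def by blast

lemma words_ok_upd:
  assumes "words_ok c \<omega> w (X - {x})" "closed u" "\<And>k. closed k \<Longrightarrow> App u k \<preceq> act c l k"
  shows "words_ok c (\<omega>(x := l)) (w(x := u)) X"
  using assms unfolding words_ok_def by auto

lemma Id_trm_beta: "closed k \<Longrightarrow> App Id_trm k \<preceq> k"
  using convD(1)[OF conv_beta[of 0 "Var 0" k]] by simp

text \<open>The word is fixed ahead of the marks: \<open>c\<close> is quantified inside, so that
  marks can later be chosen in dependence on the words.\<close>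

definition realizes :: "(var \<Rightarrow> ty) \<Rightarrow> (var \<Rightarrow> (nat \<times> nat) list) \<Rightarrow> ty \<Rightarrow> trm \<Rightarrow> (nat \<times> nat) list \<Rightarrow> bool" where
  "realizes e \<omega> A s W \<longleftrightarrow> (\<forall>c w k. marks c \<longrightarrow> words_ok c \<omega> w (fv s) \<longrightarrow> closed k
     \<longrightarrow> App (App (consumer c A) (subst (env c e w) s)) k \<preceq> act c W k)"

lemma realizesI:
  "(\<And>c w k. marks c \<Longrightarrow> words_ok c \<omega> w (fv s) \<Longrightarrow> closed k
     \<Longrightarrow> App (App (consumer c A) (subst (env c e w) s)) k \<preceq> act c W k) \<Longrightarrow> realizes e \<omega> A s W"
  unfolding realizes_def by blast

lemma realizesD:
  "realizes e \<omega> A s W \<Longrightarrow> marks c \<Longrightarrow> words_ok c \<omega> w (fv s) \<Longrightarrow> closed k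
     \<Longrightarrow> App (App (consumer c A) (subst (env c e w) s)) k \<preceq> act c W k"
  unfolding realizes_def by blast

lemma ref_App_left: "t \<preceq> t' \<Longrightarrow> closed t' \<Longrightarrow> closed s \<Longrightarrow> App t s \<preceq> App t' s"
  by (rule ref_App) (use refD in auto)

lemma ref_App_right: "s \<preceq> s' \<Longrightarrow> closed s' \<Longrightarrow> closed t \<Longrightarrow> App t s \<preceq> App t s'"
  by (rule ref_App) (use refD in auto)

text \<open>Each rule acts on words by prefixing or concatenation, so links are collected and never
  broken up. The multiset equation records that no label is lost or repeated.\<close>

lemma cut_free_word:
  "cut_free e A s L \<Longrightarrow> \<exists>W. set W = L \<union> (\<Union>x\<in>fv s. set (\<omega> x)) \<and> mset (flat W) = mlabs A + weight e \<omega> (fv s)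
     \<and> realizes e \<omega> A s W"
proof (induction arbitrary: \<omega> rule: cut_free.induct)
  case (cut_free_ax e x i j)
  show ?case
  proof (intro exI conjI)
    \<comment> \<open>An axiom prefixes its link to the word carried by the variable.\<close>
    show "set ((i, j) # \<omega> x) = {(i, j)} \<union> (\<Union>x\<in>fv (Var x). set (\<omega> x))" by simp
    show "mset (flat ((i, j) # \<omega> x)) = mlabs (TVar j) + weight e \<omega> (fv (Var x))"
      by (simp add: weight_def cut_free_ax)
    show "realizes e \<omega> (TVar j) (Var x) ((i, j) # \<omega> x)"
    proof (rule realizesI)
      fix c w k assume c: "marks c" and w: "words_ok c \<omega> w (fv (Var x))" and k: "closed k"
      have wx: "closed (w x)" "App (w x) k \<preceq> act c (\<omega> x) k" using w k unfolding words_ok_def by auto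
      note cl = closed_consumer_producer[of c, OF c]
      have a: "closed (act c (\<omega> x) k)" by (rule closed_act[OF c k])
      have "App (App (consumer c (TVar j)) (App (producer c (TVar i)) (w x))) k
         \<approx> App (c j) (App (App (producer c (TVar i)) (w x)) k)"
        by (rule consumer_TVar) (use c wx k cl[of "TVar i"] in auto)
      also have "\<dots> \<preceq> App (c j) (App (c i) (act c (\<omega> x) k))"
      proof (rule ref_App_right)
        have "App (App (producer c (TVar i)) (w x)) k \<approx> App (c i) (App (w x) k)"
          by (rule consumer_TVar) (use c wx k in auto)
        also have "\<dots> \<preceq> App (c i) (act c (\<omega> x) k)" by (rule ref_App_right[OF wx(2) a marksD[OF c]])
        finally show "App (App (producer c (TVar i)) (w x)) k \<preceq> App (c i) (act c (\<omega> x) k)" .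
      qed (use a marksD[OF c] in auto)
      finally show "App (App (consumer c (TVar j)) (subst (env c e w) (Var x))) k \<preceq> act c ((i, j) # \<omega> x) k"
        by (simp add: env_def cut_free_ax)
    qed
  qed
next
  case (cut_free_fn e x A B s L)
  \<comment> \<open>The bound variable starts with the empty word, because the consumer at
    \<open>\<multimap>\<close> feeds the producer with \<open>Id_trm\<close>.\<close>
  from cut_free_fn.IH[of "\<omega>(x := [])"] obtain W where W:
    "set W = L \<union> (\<Union>v\<in>fv s. set ((\<omega>(x := [])) v))"
    "mset (flat W) = mlabs B + weight (e(x := A)) (\<omega>(x := [])) (fv s)"
    "realizes (e(x := A)) (\<omega>(x := [])) B s W" by blast
  have ls: "lin s" using cut_free_lin[OF cut_free_fn.hyps(1)] .
  show ?case
  proof (intro exI conjI)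
    show "set W = L \<union> (\<Union>x\<in>fv (Fn x s). set (\<omega> x))"
      unfolding W(1) Union_upd[OF cut_free_fn.hyps(2)] by simp
    show "mset (flat W) = mlabs (A \<multimap> B) + weight e \<omega> (fv (Fn x s))"
      unfolding W(2) weight_upd[OF finite_fv cut_free_fn.hyps(2)] by simp
    show "realizes e \<omega> (A \<multimap> B) (Fn x s) W"
    proof (rule realizesI)
      fix c w k assume c: "marks c" and w: "words_ok c \<omega> w (fv (Fn x s))" and k: "closed k"
      note cl = closed_consumer_producer[of c, OF c]
      have p: "closed (App (producer c A) Id_trm)" using cl by auto
      have l: "lin (Fn x s)" using ls cut_free_fn.hyps(2) by simp
      have s: "closed (subst (env c e w) (Fn x s))" by (rule closed_subst_env[OF c w l])
      have w': "words_ok c (\<omega>(x := [])) (w(x := Id_trm)) (fv s)"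
        by (rule words_ok_upd) (use w Id_trm_beta in auto)
      have t: "closed (subst (env c (e(x := A)) (w(x := Id_trm))) s)" by (rule closed_subst_env[OF c w' ls])
      have "App (App (consumer c (A \<multimap> B)) (subst (env c e w) (Fn x s))) k
         \<approx> App (App (consumer c B) (App (subst (env c e w) (Fn x s)) (App (producer c A) Id_trm))) k"
        by (rule conv_App[OF consumer_Lolli[OF c s] conv_refl]) (use k in auto)
      also have "\<dots> \<preceq> App (App (consumer c B) (subst (env c (e(x := A)) (w(x := Id_trm))) s)) k"
      proof -
        have "App (subst (env c e w) (Fn x s)) (App (producer c A) Id_trm)
            \<approx> subst ((env c e w)(x := App (producer c A) Id_trm)) s"
          by (rule conv_beta_subst[OF l]) (use env_disjoint_lin[OF c w, of e] p in auto)
        then have "App (subst (env c e w) (Fn x s)) (App (producer c A) Id_trm)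
            \<preceq> subst (env c (e(x := A)) (w(x := Id_trm))) s" unfolding env_upd by (rule convD)
        then have "App (consumer c B) (App (subst (env c e w) (Fn x s)) (App (producer c A) Id_trm))
            \<preceq> App (consumer c B) (subst (env c (e(x := A)) (w(x := Id_trm))) s)"
          using t cl[of B] by (intro ref_App_right) blast+
        then show ?thesis
          by (rule ref_App_left[OF _ _ k]) (use t cl[of B] in simp)
      qed
      also have "\<dots> \<preceq> act c W k" by (rule realizesD[OF W(3) c w' k])
      finally show "App (App (consumer c (A \<multimap> B)) (subst (env c e w) (Fn x s))) k \<preceq> act c W k" .
    qed
  qed
next
  case (cut_free_tup e A s L B t L')
  from cut_free_tup.IH(1)[of \<omega>] obtain V where V:
    "set V = L \<union> (\<Union>v\<in>fv s. set (\<omega> v))" "mset (flat V) = mlabs A + weight e \<omega> (fv s)"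
    "realizes e \<omega> A s V" by blast
  from cut_free_tup.IH(2)[of \<omega>] obtain W where W:
    "set W = L' \<union> (\<Union>v\<in>fv t. set (\<omega> v))" "mset (flat W) = mlabs B + weight e \<omega> (fv t)"
    "realizes e \<omega> B t W" by blast
  show ?case
  proof (intro exI conjI)
    show "set (V @ W) = L \<union> L' \<union> (\<Union>x\<in>fv (Tup s t). set (\<omega> x))" using V(1) W(1) by auto
    show "mset (flat (V @ W)) = mlabs (A \<otimes> B) + weight e \<omega> (fv (Tup s t))"
      using V(2) W(2) weight_Un[OF _ _ cut_free_tup.hyps(3), of e \<omega>] by simp
    show "realizes e \<omega> (A \<otimes> B) (Tup s t) (V @ W)"
    proof (rule realizesI)
      fix c w k assume c: "marks c" and w: "words_ok c \<omega> w (fv (Tup s t))" and k: "closed k"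
      note cl = closed_consumer_producer[of c, OF c]
      have w': "words_ok c \<omega> w (fv s)" "words_ok c \<omega> w (fv t)" using w by (auto elim: words_ok_subset)
      let ?s = "subst (env c e w) s" and ?t = "subst (env c e w) t"
      have s: "closed ?s" "closed ?t"
        using closed_subst_env[OF c w'(1) cut_free_lin[OF cut_free_tup.hyps(1)]]
          closed_subst_env[OF c w'(2) cut_free_lin[OF cut_free_tup.hyps(2)]] by blast+
      have "App (App (consumer c (A \<otimes> B)) (subst (env c e w) (Tup s t))) k
         \<preceq> App (App (consumer c A) ?s) (App (App (consumer c B) ?t) k)"
        using consumer_Tensor[OF c s k] by simp
      also have "\<dots> \<preceq> App (App (consumer c A) ?s) (act c W k)"
        by (rule ref_App_right[OF realizesD[OF W(3) c w'(2) k] closed_act[OF c k]]) (use s cl[of A] in \<open>auto simp del: fv_subst\<close>)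
      also have "\<dots> \<preceq> act c V (act c W k)"
        by (rule realizesD[OF V(3) c w'(1) closed_act[OF c k]])
      finally show "App (App (consumer c (A \<otimes> B)) (subst (env c e w) (Tup s t))) k \<preceq> act c (V @ W) k"
        by (simp add: act_append)
    qed
  qed
next
  case (cut_free_let e z X Y x y C t L)
  \<comment> \<open>The word of the pair goes to the first component and the second starts empty, as
    in the tensor clause of \<open>producer\<close>.\<close>
  let ?e = "e(x := X, y := Y)" and ?\<omega> = "\<omega>(x := \<omega> z, y := [])"
  from cut_free_let.IH[of ?\<omega>] obtain W where W:
    "set W = L \<union> (\<Union>v\<in>fv t. set (?\<omega> v))" "mset (flat W) = mlabs C + weight ?e ?\<omega> (fv t)"
    "realizes ?e ?\<omega> C t W" by blast
  have x: "x \<in> fv t - {y}" "y \<in> fv t" using cut_free_let.hyps by auto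
  have eq: "fv t - {y} - {x} = fv t - {x, y}" "fv (LetTup x y (Var z) t) = insert z (fv t - {x, y})" by auto
  have lt: "lin t" "lin (LetTup x y (Var z) t)" using cut_free_lin[OF cut_free_let.hyps(2)] cut_free_let.hyps by auto
  show ?case
  proof (intro exI conjI)
    show "set W = L \<union> (\<Union>x\<in>fv (LetTup x y (Var z) t). set (\<omega> x))"
      unfolding W(1) Union_upd[OF x(2)] Union_upd[OF x(1)] eq by simp
    show "mset (flat W) = mlabs C + weight e \<omega> (fv (LetTup x y (Var z) t))"
      unfolding W(2) weight_upd[OF finite_fv x(2)] weight_upd[OF finite_Diff[OF finite_fv] x(1)] eq
        weight_insert[OF finite_Diff[OF finite_fv] cut_free_let.hyps(6)]
      using cut_free_let.hyps(1) by simp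
    show "realizes e \<omega> C (LetTup x y (Var z) t) W"
    proof (rule realizesI)
      fix c w k assume c: "marks c" and w: "words_ok c \<omega> w (fv (LetTup x y (Var z) t))" and k: "closed k"
      note cl = closed_consumer_producer[of c, OF c]
      have wz: "closed (w z)" "\<And>k. closed k \<Longrightarrow> App (w z) k \<preceq> act c (\<omega> z) k"
        using w unfolding words_ok_def by auto
      let ?w = "w(x := w z, y := Id_trm)"
      have "words_ok c \<omega> w (fv t - {y} - {x})" using w by (rule words_ok_subset) auto
      then have "words_ok c (\<omega>(x := \<omega> z)) (w(x := w z)) (fv t - {y})"
        by (rule words_ok_upd[OF _ wz])
      then have w': "words_ok c ?\<omega> ?w (fv t)"
        by (rule words_ok_upd) (use Id_trm_beta in auto)
      have "subst (env c e w) (LetTup x y (Var z) t)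
          \<preceq> subst ((env c e w)(x := App (producer c X) (w z), y := App (producer c Y) Id_trm)) t"
        by (rule ref_beta_let_subst[OF lt(2) env_disjoint_lin[OF c w]])
          (use convD(1)[OF producer_Tensor[OF c wz(1), of X Y]] cut_free_let.hyps(1) in \<open>simp add: env_def\<close>)
      then have r: "subst (env c e w) (LetTup x y (Var z) t) \<preceq> subst (env c ?e ?w) t"
        unfolding env_upd .
      have cs: "closed (subst (env c ?e ?w) t)" by (rule closed_subst_env[OF c w' lt(1)])
      have "App (consumer c C) (subst (env c e w) (LetTup x y (Var z) t)) \<preceq> App (consumer c C) (subst (env c ?e ?w) t)"
        by (rule ref_App_right[OF r cs]) (use cl in blast)
      then have "App (App (consumer c C) (subst (env c e w) (LetTup x y (Var z) t))) k
         \<preceq> App (App (consumer c C) (subst (env c ?e ?w) t)) k"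
        by (rule ref_App_left[OF _ _ k]) (use cs cl[of C] in simp)
      also have "\<dots> \<preceq> act c W k" by (rule realizesD[OF W(3) c w' k])
      finally show "App (App (consumer c C) (subst (env c e w) (LetTup x y (Var z) t))) k \<preceq> act c W k" .
    qed
  qed
next
  case (cut_free_app e z U R u L y C t L')
  from cut_free_app.IH(1)[of \<omega>] obtain V where V:
    "set V = L \<union> (\<Union>v\<in>fv u. set (\<omega> v))" "mset (flat V) = mlabs U + weight e \<omega> (fv u)"
    "realizes e \<omega> U u V" by blast
  \<comment> \<open>The result of an application carries the word of the argument followed by that
    of the function; this is the behaviour of \<open>w'\<close> in
    \<open>producer_Lolli\<close>.\<close>
  let ?e = "e(y := R)" and ?\<omega> = "\<omega>(y := V @ \<omega> z)"
  from cut_free_app.IH(2)[of ?\<omega>] obtain W where W: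
    "set W = L' \<union> (\<Union>v\<in>fv t. set (?\<omega> v))" "mset (flat W) = mlabs C + weight ?e ?\<omega> (fv t)"
    "realizes ?e ?\<omega> C t W" by blast
  have eq: "fv (App (Fn y t) (App (Var z) u)) = insert z ((fv t - {y}) \<union> fv u)" by auto
  have d: "z \<notin> (fv t - {y}) \<union> fv u" "(fv t - {y}) \<inter> fv u = {}" using cut_free_app.hyps by auto
  have lt: "lin t" "lin (Fn y t)" "lin u" using cut_free_lin[OF cut_free_app.hyps(2)] cut_free_lin[OF cut_free_app.hyps(3)] cut_free_app.hyps by auto
  show ?case
  proof (intro exI conjI)
    show "set W = L \<union> L' \<union> (\<Union>x\<in>fv (App (Fn y t) (App (Var z) u)). set (\<omega> x))"
      unfolding W(1) Union_upd[OF cut_free_app.hyps(4)] eq using V(1) by auto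
    show "mset (flat W) = mlabs C + weight e \<omega> (fv (App (Fn y t) (App (Var z) u)))"
      unfolding W(2) weight_upd[OF finite_fv cut_free_app.hyps(4)] eq
        weight_insert[OF finite_UnI[OF finite_Diff[OF finite_fv] finite_fv] d(1)]
        weight_Un[OF finite_Diff[OF finite_fv] finite_fv d(2)]
      using cut_free_app.hyps(1) V(2) by simp
    show "realizes e \<omega> C (App (Fn y t) (App (Var z) u)) W"
    proof (rule realizesI)
      fix c w k assume c: "marks c"
        and w: "words_ok c \<omega> w (fv (App (Fn y t) (App (Var z) u)))" and k: "closed k"
      note cl = closed_consumer_producer[of c, OF c]
      have wz: "closed (w z)" "\<And>k. closed k \<Longrightarrow> App (w z) k \<preceq> act c (\<omega> z) k"
        using w unfolding words_ok_def by auto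
      have wu: "words_ok c \<omega> w (fv u)" using w by (rule words_ok_subset) auto
      let ?u = "subst (env c e w) u"
      have u: "closed ?u" by (rule closed_subst_env[OF c wu lt(3)])
      obtain w' where w': "closed w'" "App (App (producer c (U \<multimap> R)) (w z)) ?u \<approx> App (producer c R) w'"
        "\<And>k. closed k \<Longrightarrow> App w' k \<approx> App (App (consumer c U) ?u) (App (w z) k)"
        using producer_Lolli[OF c wz(1) u] by metis
      have wt: "words_ok c ?\<omega> (w(y := w')) (fv t)"
      proof (rule words_ok_upd[OF _ w'(1)])
        show "words_ok c \<omega> w (fv t - {y})" using w by (rule words_ok_subset) auto
        fix k assume k: "closed k"
        have "closed (App (w z) k)" using wz(1) k by simp
        have "App w' k \<approx> App (App (consumer c U) ?u) (App (w z) k)" by (rule w'(3)[OF k])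
        also have "\<dots> \<preceq> act c V (App (w z) k)" by (rule realizesD[OF V(3) c wu \<open>closed (App (w z) k)\<close>])
        also have "\<dots> \<preceq> act c V (act c (\<omega> z) k)" by (rule act_mono[OF c wz(2)[OF k] closed_act[OF c k]])
        finally show "App w' k \<preceq> act c (V @ \<omega> z) k" by (simp add: act_append)
      qed
      have cs: "closed (subst (env c ?e (w(y := w'))) t)" by (rule closed_subst_env[OF c wt lt(1)])
      have p: "closed (App (producer c R) w')" using cl[of R] w'(1) by simp
      have wF: "words_ok c \<omega> w (fv (Fn y t))" using w by (rule words_ok_subset) auto
      have F: "closed (subst (env c e w) (Fn y t))" by (rule closed_subst_env[OF c wF lt(2)])
      have "subst (env c e w) (App (Fn y t) (App (Var z) u))
          = App (subst (env c e w) (Fn y t)) (App (App (producer c (U \<multimap> R)) (w z)) ?u)"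
        by (simp add: env_def cut_free_app.hyps(1))
      also have "\<dots> \<preceq> App (subst (env c e w) (Fn y t)) (App (producer c R) w')"
        by (rule ref_App_right[OF convD(1)[OF w'(2)] p F])
      also have "\<dots> \<approx> subst ((env c e w)(y := App (producer c R) w')) t"
        by (rule conv_beta_subst[OF lt(2)]) (use env_disjoint_lin[OF c wF, of e] p in auto)
      finally have r: "subst (env c e w) (App (Fn y t) (App (Var z) u)) \<preceq> subst (env c ?e (w(y := w'))) t"
        unfolding env_upd .
      have "App (consumer c C) (subst (env c e w) (App (Fn y t) (App (Var z) u)))
          \<preceq> App (consumer c C) (subst (env c ?e (w(y := w'))) t)"
        by (rule ref_App_right[OF r cs]) (use cl in blast)
      then have "App (App (consumer c C) (subst (env c e w) (App (Fn y t) (App (Var z) u)))) k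
         \<preceq> App (App (consumer c C) (subst (env c ?e (w(y := w'))) t)) k"
        by (rule ref_App_left[OF _ _ k]) (use cs cl[of C] in simp)
      also have "\<dots> \<preceq> act c W k" by (rule realizesD[OF W(3) c wt k])
      finally show "App (App (consumer c C) (subst (env c e w) (App (Fn y t) (App (Var z) u)))) k \<preceq> act c W k" .
    qed
  qed
qed

lemma closed_cut_free_word:
  assumes "cut_free e A s L" "fv s = {}"
  obtains W where "set W = L" "mset (flat W) = mlabs A"
    "\<And>c k. marks c \<Longrightarrow> closed k \<Longrightarrow> App (App (consumer c A) s) k \<preceq> act c W k"
proof -
  obtain W where W: "set W = L" "mset (flat W) = mlabs A" "realizes e (\<lambda>_. []) A s W"
    using cut_free_word[OF assms(1), of "\<lambda>_. []"] assms(2) by (auto simp: weight_def)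
  have "App (App (consumer c A) s) k \<preceq> act c W k" if c: "marks c" and k: "closed k" for c k
  proof -
    have s: "closed s" using cut_free_lin[OF assms(1)] assms(2) by simp
    have "App (App (consumer c A) s) k \<approx> App (App (consumer c A) (subst (env c e Var) s)) k"
      using s k closed_consumer_producer[of c A, OF c] conv_sym[OF subst_closed[OF s]]
      by (intro conv_App conv_refl) auto
    also have "\<dots> \<preceq> act c W k"
      by (rule realizesD[OF W(3) c _ k]) (use s in \<open>simp add: words_ok_def\<close>)
    finally show ?thesis .
  qed
  then show thesis using that W(1,2) by blast
qed

subsection \<open>Principal types\<close>

definition unpair :: "nat \<Rightarrow> ty \<times> ty" where
  "unpair = from_nat"

text \<open>Least general generalization. The variable for a disagreement is the code of the
  disagreeing pair, so equal disagreements share a variable, and both instances are obtained by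
  decoding.\<close>

fun lgg :: "ty \<Rightarrow> ty \<Rightarrow> ty" where
  "lgg (A \<otimes> B) (A' \<otimes> B') = lgg A A' \<otimes> lgg B B'"
| "lgg (A \<multimap> B) (A' \<multimap> B') = lgg A A' \<multimap> lgg B B'"
| "lgg A A' = TVar (to_nat (A, A'))"

lemma lgg_instance: "tsubst (\<lambda>n. fst (unpair n)) (lgg A B) = A" "tsubst (\<lambda>n. snd (unpair n)) (lgg A B) = B"
  by (induction A B rule: lgg.induct) (auto simp: unpair_def)

text \<open>Typability is preserved by anti-unification, as all typing rules merely match constructors.\<close>

lemma styp_lgg: "styp e t A \<Longrightarrow> styp e' t A' \<Longrightarrow> styp (\<lambda>x. lgg (e x) (e' x)) t (lgg A A')"
proof (induction t arbitrary: e e' A A')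
  case (Fn x t)
  obtain B C B' C' where *: "A = B \<multimap> C" "styp (e(x := B)) t C" "A' = B' \<multimap> C'" "styp (e'(x := B')) t C'"
    using Fn.prems by auto
  have "(\<lambda>v. lgg ((e(x := B)) v) ((e'(x := B')) v)) = (\<lambda>v. lgg (e v) (e' v))(x := lgg B B')" by auto
  then have "styp ((\<lambda>v. lgg (e v) (e' v))(x := lgg B B')) t (lgg C C')" using Fn.IH[OF *(2,4)] by simp
  then show ?case unfolding *(1,3) lgg.simps styp.simps by blast
next
  case (LetTup x y s t)
  obtain B C B' C' where *: "styp e s (B \<otimes> C)" "styp (e(x := B, y := C)) t A"
    "styp e' s (B' \<otimes> C')" "styp (e'(x := B', y := C')) t A'"
    using LetTup.prems by auto
  have "(\<lambda>v. lgg ((e(x := B, y := C)) v) ((e'(x := B', y := C')) v))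
      = (\<lambda>v. lgg (e v) (e' v))(x := lgg B B', y := lgg C C')" by auto
  then have "styp ((\<lambda>v. lgg (e v) (e' v))(x := lgg B B', y := lgg C C')) t (lgg A A')"
    using LetTup.IH(2)[OF *(2,4)] by simp
  moreover have "styp (\<lambda>v. lgg (e v) (e' v)) s (lgg B B' \<otimes> lgg C C')"
    using LetTup.IH(1)[OF *(1,3)] by simp
  ultimately show ?case unfolding styp.simps by blast
next
  case (App t s)
  obtain B B' where *: "styp e t (B \<multimap> A)" "styp e s B" "styp e' t (B' \<multimap> A')" "styp e' s B'"
    using App.prems by auto
  show ?case using App.IH(1)[OF *(1,3)] App.IH(2)[OF *(2,4)] by auto
next
  case (Tup t s)
  then show ?case by auto
qed auto

lemma styp_tsubst: "styp e t A \<Longrightarrow> styp (tsubst \<theta> \<circ> e) t (tsubst \<theta> A)"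
proof (induction t arbitrary: e A)
  case (Fn x t)
  obtain B C where *: "A = B \<multimap> C" "styp (e(x := B)) t C" using Fn.prems by auto
  have "tsubst \<theta> \<circ> e(x := B) = (tsubst \<theta> \<circ> e)(x := tsubst \<theta> B)" by auto
  then have "styp ((tsubst \<theta> \<circ> e)(x := tsubst \<theta> B)) t (tsubst \<theta> C)" using Fn.IH[OF *(2)] by metis
  then show ?case unfolding *(1) tsubst.simps styp.simps by blast
next
  case (LetTup x y s t)
  obtain B C where *: "styp e s (B \<otimes> C)" "styp (e(x := B, y := C)) t A" using LetTup.prems by auto
  have "tsubst \<theta> \<circ> e(x := B, y := C) = (tsubst \<theta> \<circ> e)(x := tsubst \<theta> B, y := tsubst \<theta> C)" by auto
  then have "styp ((tsubst \<theta> \<circ> e)(x := tsubst \<theta> B, y := tsubst \<theta> C)) t (tsubst \<theta> A)"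
    using LetTup.IH(2)[OF *(2)] by metis
  moreover have "styp (tsubst \<theta> \<circ> e) s (tsubst \<theta> B \<otimes> tsubst \<theta> C)" using LetTup.IH(1)[OF *(1)] by (simp only: tsubst.simps)
  ultimately show ?case unfolding styp.simps by blast
next
  case (App t s)
  obtain B where *: "styp e t (B \<multimap> A)" "styp e s B" using App.prems by auto
  show ?case using App.IH(1)[OF *(1)] App.IH(2)[OF *(2)] unfolding tsubst.simps styp.simps by blast
next
  case (Tup t s)
  obtain B C where *: "A = B \<otimes> C" "styp e t B" "styp e s C" using Tup.prems by auto
  show ?case using Tup.IH(1)[OF *(2)] Tup.IH(2)[OF *(3)] unfolding *(1) tsubst.simps styp.simps by blast
qed auto

section \<open>Most general members of classes of types\<close>

lemma size_tsubst: "size A \<le> size (tsubst \<theta> A)"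
  by (induction A) auto

text \<open>\<open>size\<close> counts the connectives, a variable having size 0; so a substitution
  that preserves the size replaces each occurring label by a variable.\<close>

lemma size_tsubst_eq: "size (tsubst \<theta> A) = size A \<Longrightarrow> a \<in> labs A \<Longrightarrow> size (\<theta> a) = 0"
proof (induction A)
  case (Tensor A B)
  then show ?case using size_tsubst[of A \<theta>] size_tsubst[of B \<theta>] by auto
next
  case (Lolli A B)
  then show ?case using size_tsubst[of A \<theta>] size_tsubst[of B \<theta>] by auto
qed auto

lemma finite_labs [simp]: "finite (labs A)"
  by (induction A) auto

text \<open>A type with \<open>n\<close> connectives has \<open>n + 1\<close> leaves. The bound
  makes the maximum in \<open>most_general\<close> exist.\<close>

lemma card_labs: "card (labs A) \<le> Suc (size A)"
proof (induction A)
  case (Tensor A B)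
  then show ?case using card_Un_le[of "labs A" "labs B"] by simp
next
  case (Lolli A B)
  then show ?case using card_Un_le[of "labs A" "labs B"] by simp
qed auto

lemma tsubst_relabel: "tsubst \<theta> (relabel f A) = tsubst (\<lambda>a. \<theta> (f a)) A"
  by (induction A) auto

lemma tsubst_cong: "(\<And>a. a \<in> labs A \<Longrightarrow> \<theta> a = \<tau> a) \<Longrightarrow> tsubst \<theta> A = tsubst \<tau> A"
  by (induction A) auto

text \<open>Take a member \<open>P\<close> of least size and, among those, with the most variables.
  The generalization of \<open>P\<close> and \<open>B\<close> is again a member and has
  \<open>P\<close> as an instance, so it has the same size and the instance is a renaming. The
  choice of \<open>P\<close> makes this renaming injective; it can be undone, and \<open>B\<close>
  is reached from there.\<close>

lemma most_general:
  assumes "A \<in> S" "\<And>A B. A \<in> S \<Longrightarrow> B \<in> S \<Longrightarrow> lgg A B \<in> S"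
  obtains P where "P \<in> S" "\<And>B. B \<in> S \<Longrightarrow> \<exists>\<theta>. B = tsubst \<theta> P"
proof -
  obtain A0 where A0: "A0 \<in> S" "\<And>B. B \<in> S \<Longrightarrow> size A0 \<le> size B"
    using ex_has_least_nat[of "\<lambda>A. A \<in> S" A size] assms(1) by blast
  let ?M = "\<lambda>A. A \<in> S \<and> size A = size A0"
  have "\<forall>A. ?M A \<longrightarrow> card (labs A) < Suc (Suc (size A0))"
    using card_labs by (metis le_imp_less_Suc)
  then obtain P where P: "?M P" "\<And>B. ?M B \<Longrightarrow> card (labs B) \<le> card (labs P)"
    using ex_has_greatest_nat[of ?M A0 "\<lambda>A. card (labs A)"] A0(1) by (metis (mono_tags, lifting) less_imp_le)
  have "\<exists>\<theta>. B = tsubst \<theta> P" if B: "B \<in> S" for B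
  proof -
    let ?G = "lgg P B" and ?\<theta> = "\<lambda>n. fst (unpair n)"
    have G: "?G \<in> S" using assms(2) P(1) B by blast
    have PG: "tsubst ?\<theta> ?G = P" by (rule lgg_instance)
    then have "size ?G \<le> size P" using size_tsubst[of ?G ?\<theta>] by simp
    then have sz: "size ?G = size P" using A0(2)[OF G] P(1) by simp
    have "\<exists>b. ?\<theta> a = TVar b" if "a \<in> labs ?G" for a
      using size_tsubst_eq[of ?\<theta> ?G a] PG sz that by (cases "?\<theta> a") auto
    then obtain f where f: "\<And>a. a \<in> labs ?G \<Longrightarrow> ?\<theta> a = TVar (f a)" by metis
    have "P = tsubst (TVar \<circ> f) ?G" using PG tsubst_cong[of ?G ?\<theta> "TVar \<circ> f"] f by simp
    then have Pf: "P = relabel f ?G" by (simp add: relabel_def)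
    \<comment> \<open>\<open>?G\<close> has the size of \<open>P\<close> and hence at most as many
      variables, so the renaming onto \<open>P\<close> cannot merge any of them.\<close>
    have "card (f ` labs ?G) = card (labs ?G)"
    proof (rule antisym)
      have "labs P = f ` labs ?G" by (subst Pf) (rule labs_rename)
      then show "card (labs ?G) \<le> card (f ` labs ?G)" using P(2)[of ?G] G sz P(1) by simp
    qed (rule card_image_le, simp)
    then have inj: "inj_on f (labs ?G)" by (intro eq_card_imp_inj_on) auto
    \<comment> \<open>Undoing the renaming and taking the second component of each disagreement
      leads from \<open>P\<close> to \<open>B\<close>.\<close>
    define g where "g = inv_into (labs ?G) f"
    have "tsubst (\<lambda>a. snd (unpair (g a))) P = tsubst (\<lambda>a. snd (unpair (g (f a)))) ?G"
      by (subst Pf) (rule tsubst_relabel)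
    also have "\<dots> = tsubst (\<lambda>a. snd (unpair a)) ?G"
      by (rule tsubst_cong) (simp add: g_def inv_into_f_f[OF inj])
    also have "\<dots> = B" by (rule lgg_instance)
    finally show ?thesis by blast
  qed
  then show thesis using that P(1) by blast
qed

lemma closed_typing_iff:
  assumes "fv t = {}" "lin t"
  shows "\<Gamma> \<turnstile> t \<Colon> A \<longleftrightarrow> \<Gamma> = [] \<and> styp e t A"
proof
  assume t: "\<Gamma> \<turnstile> t \<Colon> A"
  then have "\<Gamma> = []" using typing_fv[OF t] assms(1) by (simp add: vars_of_def)
  then show "\<Gamma> = [] \<and> styp e t A" using typing_styp[OF t] by simp
next
  assume "\<Gamma> = [] \<and> styp e t A"
  then show "\<Gamma> \<turnstile> t \<Colon> A" using styp_typing[OF assms(2), of e A] assms(1) by simp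
qed

lemma principal_type_closed_iff:
  assumes "fv t = {}" "lin t"
  shows "principal_type t P \<longleftrightarrow> styp e t P \<and> (\<forall>A. styp e t A \<longrightarrow> (\<exists>\<theta>. A = tsubst \<theta> P))"
  unfolding principal_type_def closed_typing_iff[OF assms, of _ _ e] by auto

lemma principal_type_exists:
  assumes "fv t = {}" "lin t" "styp e t A"
  obtains P where "principal_type t P"
proof -
  have c: "styp e' t B = styp e t B" for e' B by (rule styp_cong) (simp add: assms(1))
  obtain P where "P \<in> {A. styp e t A}" "\<And>B. B \<in> {A. styp e t A} \<Longrightarrow> \<exists>\<theta>. B = tsubst \<theta> P"
  proof (rule most_general[of A "{A. styp e t A}"])
    show "lgg A B \<in> {A. styp e t A}" if "A \<in> {A. styp e t A}" "B \<in> {A. styp e t A}" for A B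
      using styp_lgg[of e t A e B] that c by blast
  qed (use assms(3) in auto)
  then show thesis using that principal_type_closed_iff[OF assms(1,2), of P e] by simp
qed

text \<open>Provides representatives with variables apart; an inverse of \<open>f\<close> undoes the
  renaming in every instance.\<close>

lemma principal_type_relabel:
  assumes "fv t = {}" "lin t" "principal_type t P" "inj f"
  shows "principal_type t (relabel f P)"
proof -
  let ?e = "\<lambda>_. TVar 0"
  note p = principal_type_closed_iff[OF assms(1,2), of _ ?e]
  have P: "styp ?e t P" "\<And>A. styp ?e t A \<Longrightarrow> \<exists>\<theta>. A = tsubst \<theta> P" using assms(3) unfolding p by auto
  have "styp (tsubst (TVar \<circ> f) \<circ> ?e) t (relabel f P)"
    unfolding relabel_def by (rule styp_tsubst[OF P(1)])
  then have "styp ?e t (relabel f P)" using styp_cong[of t] assms(1) by blast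
  moreover have "\<exists>\<theta>. A = tsubst \<theta> (relabel f P)" if A: "styp ?e t A" for A
  proof -
    obtain \<theta> where "A = tsubst \<theta> P" using P(2)[OF A] by blast
    then have "A = tsubst (\<lambda>a. \<theta> (inv f a)) (relabel f P)"
      unfolding tsubst_relabel by (simp add: inv_f_f[OF assms(4)])
    then show ?thesis by blast
  qed
  ultimately show ?thesis unfolding p by blast
qed

text \<open>\<open>A'\<close> is the common instance at which the principal types of
  \<open>t\<close> and \<open>s\<close> meet, and it may differ from \<open>A\<close>. This gap is
  the freedom that poly-typability grants.\<close>

lemma poly_typableI:
  assumes "[] \<turnstile> t \<Colon> A' \<multimap> B" "[] \<turnstile> s \<Colon> A'" "[] \<turnstile> s \<Colon> A"
  shows "poly_typable t [A] B [s]"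
proof -
  have c: "fv t = {}" "lin t" "fv s = {}" "lin s"
    using typing_fv[OF assms(1)] typing_fv[OF assms(2)] typing_lin[OF assms(1)] typing_lin[OF assms(2)]
    by (auto simp: vars_of_def)
  obtain P where P: "principal_type t P"
    using principal_type_exists[OF c(1,2)] assms(1) closed_typing_iff[OF c(1,2)] by metis
  obtain Q where Q: "principal_type s Q"
    using principal_type_exists[OF c(3,4)] assms(2) closed_typing_iff[OF c(3,4)] by metis
  obtain \<theta> where \<theta>: "A' \<multimap> B = tsubst \<theta> P" using P assms(1) unfolding principal_type_def by blast
  obtain \<tau> where \<tau>: "A' = tsubst \<tau> Q" using Q assms(2) unfolding principal_type_def by blast
  \<comment> \<open>Even and odd variables keep the representatives apart, so that
    \<open>\<theta>\<close> and \<open>\<tau>\<close> combine into one substitution.\<close>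
  let ?P = "relabel (\<lambda>n. 2 * n) P" and ?Q = "relabel (\<lambda>n. 2 * n + 1) Q"
  let ?\<theta> = "\<lambda>n. if even n then \<theta> (n div 2) else \<tau> (n div 2)"
  have "principal_type t ?P" by (rule principal_type_relabel[OF c(1,2) P]) (simp add: inj_def)
  moreover have "principal_type s ?Q" by (rule principal_type_relabel[OF c(3,4) Q]) (simp add: inj_def)
  moreover have "tsubst ?\<theta> ?P = tsubst ?\<theta> ?Q \<multimap> B"
    unfolding tsubst_relabel using \<theta> \<tau> by simp
  ultimately have "\<exists>P Ps \<theta>. principal_type t P \<and> list_all2 principal_type [s] Ps \<and>
       tsubst \<theta> P = lollis (map (tsubst \<theta>) Ps) B"
    by (intro exI[of _ ?P] exI[of _ "[?Q]"] exI[of _ ?\<theta>]) (simp add: lollis_def)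
  moreover have "\<exists>As' B'. length As' = length [A] \<and> [] \<turnstile> t \<Colon> lollis As' B'"
    using assms(1) by (intro exI[of _ "[A']"] exI[of _ B]) (simp add: lollis_def)
  ultimately show ?thesis using assms(3) unfolding poly_typable_def by simp
qed

subsection \<open>Separation\<close>

lemma flat_inject: "flat V = flat W \<Longrightarrow> V = W"
proof (induction V arbitrary: W)
  case Nil
  then show ?case by (cases W) (auto simp: flat_def)
next
  case (Cons p V)
  then show ?case by (cases W; cases p) (auto simp: flat_def)
qed

lemma set_mlabs: "set_mset (mlabs A) = labs A"
  by (induction A) auto

lemma mlabs_distinct_labs: "distinct_labs A \<Longrightarrow> mlabs A = mset_set (labs A)"
  by (induction A) (auto simp: mset_set_Union)

text \<open>At the first position where the lists differ, each of the two entries must come up later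
  in the other list, which gives a pair in opposite orders.\<close>

lemma distinct_inversion:
  "distinct xs \<Longrightarrow> mset xs = mset ys \<Longrightarrow> xs \<noteq> ys
    \<Longrightarrow> \<exists>i j a b c a' b' c'. i \<noteq> j \<and> xs = a @ i # b @ j # c \<and> ys = a' @ j # b' @ i # c'"
proof (induction xs arbitrary: ys)
  case Nil
  then show ?case by simp
next
  case (Cons x xs)
  then obtain y ys' where ys: "ys = y # ys'" by (cases ys) auto
  show ?case
  proof (cases "x = y")
    case True
    then have "\<exists>i j a b c a' b' c'. i \<noteq> j \<and> xs = a @ i # b @ j # c \<and> ys' = a' @ j # b' @ i # c'"
      using Cons ys by (intro Cons.IH) auto
    then obtain i j a b c a' b' c' where "i \<noteq> j" "xs = a @ i # b @ j # c" "ys' = a' @ j # b' @ i # c'" by blast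
    then have "i \<noteq> j \<and> x # xs = (x # a) @ i # b @ j # c \<and> ys = (y # a') @ j # b' @ i # c'" using ys by simp
    then show ?thesis by blast
  next
    case False
    have "set (x # xs) = set ys" using Cons.prems(2) by (metis set_mset_mset)
    then have "x \<in> set ys'" "y \<in> set xs" using False ys by auto
    then obtain b c b' c' where "ys' = b' @ x # c'" "xs = b @ y # c" by (meson split_list)
    then have "x \<noteq> y \<and> x # xs = [] @ x # b @ y # c \<and> ys = [] @ y # b' @ x # c'" using ys False by simp
    then show ?thesis by blast
  qed
qed

definition apply_word :: "(nat \<Rightarrow> trm) \<Rightarrow> nat list \<Rightarrow> trm \<Rightarrow> trm" where
  "apply_word c xs k = foldr (\<lambda>a. App (c a)) xs k"

lemma apply_word_simps [simp]: "apply_word c [] k = k" "apply_word c (a # xs) k = App (c a) (apply_word c xs k)"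
  "apply_word c (xs @ ys) k = apply_word c xs (apply_word c ys k)"
  by (simp_all add: apply_word_def)

lemma act_apply_word: "act c W k = apply_word c (flat W) k"
  by (induction W) auto

lemma apply_word_skip: "(\<And>a. a \<in> set xs \<Longrightarrow> c a = Id_trm) \<Longrightarrow> k0 \<preceq> k \<Longrightarrow> closed k \<Longrightarrow> apply_word c xs k0 \<preceq> k"
proof (induction xs)
  case (Cons a xs)
  then have "apply_word c xs k0 \<preceq> k" by simp
  then have "App Id_trm (apply_word c xs k0) \<preceq> App Id_trm k" using Cons.prems by (intro ref_App_right) auto
  also have "\<dots> \<preceq> k" by (rule Id_trm_beta[OF Cons.prems(3)])
  finally show ?case using Cons.prems(1)[of a] by simp
qed auto

lemma apply_arg:
  assumes "closed k" "closed u"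
  shows "App (Fn 0 (App (Var 0) u)) k \<preceq> App k u"
proof -
  have "App (Fn 0 (App (Var 0) u)) k \<approx> subst (Var(0 := k)) (App (Var 0) u)"
    by (rule conv_beta) (use assms in auto)
  also have "\<dots> = App k (subst (Var(0 := k)) u)" by simp
  also have "\<dots> \<approx> App k u" using assms by (intro conv_App conv_refl subst_closed) (auto simp del: subst.simps)
  finally show ?thesis by (rule convD)
qed

definition separator :: "nat \<Rightarrow> nat \<Rightarrow> trm \<Rightarrow> trm \<Rightarrow> nat \<Rightarrow> trm" where
  "separator i j u v a = (if a = i then Fn 0 (App (Var 0) u) else if a = j then Fn 0 (App (Var 0) v) else Id_trm)"

lemma separator_marks: "closed u \<Longrightarrow> closed v \<Longrightarrow> marks (separator i j u v)"
  by (auto simp: marks_def separator_def)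

text \<open>The innermost mark meets \<open>k\<close> first, so of the two labels the one that comes
  later in \<open>xs\<close> supplies the first argument. All other marks drop out as
  identities.\<close>

lemma apply_word_separator:
  assumes "distinct xs" "closed k" "closed u" "closed v" "i \<noteq> j"
  shows "xs = a @ i # b @ j # d \<Longrightarrow> apply_word (separator i j u v) xs k \<preceq> App (App k v) u"
    and "xs = a @ j # b @ i # d \<Longrightarrow> apply_word (separator i j u v) xs k \<preceq> App (App k u) v"
proof -
  \<comment> \<open>One argument for both orders: \<open>p\<close> is the outer and \<open>q\<close>
    the inner of the two labels.\<close>
  have *: "apply_word (separator i j u v) (a @ p # b @ q # d) k \<preceq> App (App k uq) up"
    if "distinct (a @ p # b @ q # d)" "{p, q} = {i, j}" "closed up" "closed uq"
      "separator i j u v p = Fn 0 (App (Var 0) up)" "separator i j u v q = Fn 0 (App (Var 0) uq)" for p q up uq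
  proof -
    let ?c = "separator i j u v"
    have c: "?c x = Id_trm" if "x \<in> set a \<union> set b \<union> set d" for x
    proof -
      have "x \<notin> {p, q}" using that \<open>distinct (a @ p # b @ q # d)\<close> by auto
      then show ?thesis using \<open>{p, q} = {i, j}\<close> by (simp add: separator_def)
    qed
    have "apply_word ?c d k \<preceq> k" by (rule apply_word_skip) (use that(1) assms(2) c in auto)
    then have "App (?c q) (apply_word ?c d k) \<preceq> App (?c q) k"
      using that(4,6) assms(2) by (intro ref_App_right) auto
    also have "\<dots> \<preceq> App k uq" unfolding that(6) by (rule apply_arg[OF assms(2) that(4)])
    finally have "apply_word ?c b (App (?c q) (apply_word ?c d k)) \<preceq> App k uq"
      by (intro apply_word_skip) (use that(1,4) assms(2) c in auto)
    then have "App (?c p) (apply_word ?c b (App (?c q) (apply_word ?c d k))) \<preceq> App (?c p) (App k uq)"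
      using that(3,4,5) assms(2) by (intro ref_App_right) auto
    also have "\<dots> \<preceq> App (App k uq) up" unfolding that(5) by (rule apply_arg) (use that(3,4) assms(2) in auto)
    finally have "apply_word ?c a (App (?c p) (apply_word ?c b (App (?c q) (apply_word ?c d k)))) \<preceq> App (App k uq) up"
      by (intro apply_word_skip) (use that(1,3,4) assms(2) c in auto)
    then show ?thesis by simp
  qed
  show "xs = a @ i # b @ j # d \<Longrightarrow> apply_word (separator i j u v) xs k \<preceq> App (App k v) u"
    using *[of i j u v] assms by (simp add: separator_def)
  show "xs = a @ j # b @ i # d \<Longrightarrow> apply_word (separator i j u v) xs k \<preceq> App (App k u) v"
    using *[of j i v u] assms by (simp add: separator_def insert_commute)
qed

section \<open>Closed typed terms and the separating test\<close>

lemma typed_closed: "[] \<turnstile> s \<Colon> A \<Longrightarrow> closed s"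
  using typing_lin typing_fv by (fastforce simp: vars_of_def)

lemma eraser:
  assumes "[] \<turnstile> u \<Colon> relabel r A" "closed k"
  shows "App (App (consumer (\<lambda>_. Id_trm) A) u) k \<preceq> k"
proof -
  have m: "marks (\<lambda>_. Id_trm)" by (simp add: marks_def)
  obtain u' L where u': "u \<preceq> u'" "cut_free (\<lambda>_. TVar 0) A u' L" using normal_form[OF assms(1)] by blast
  have cu: "closed u'" using typed_closed[OF assms(1)] refD[OF u'(1)] by auto
  obtain W where W: "\<And>c k. marks c \<Longrightarrow> closed k \<Longrightarrow> App (App (consumer c A) u') k \<preceq> act c W k"
    using closed_cut_free_word[OF u'(2)] cu by metis
  have "App (consumer (\<lambda>_. Id_trm) A) u \<preceq> App (consumer (\<lambda>_. Id_trm) A) u'"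
    using closed_consumer_producer[OF m] by (intro ref_App_right[OF u'(1) cu]) blast
  then have "App (App (consumer (\<lambda>_. Id_trm) A) u) k \<preceq> App (App (consumer (\<lambda>_. Id_trm) A) u') k"
    by (rule ref_App_left[OF _ _ assms(2)]) (use cu closed_consumer_producer[OF m, of A] in simp)
  also have "\<dots> \<preceq> act (\<lambda>_. Id_trm) W k" by (rule W[OF m assms(2)])
  also have "\<dots> \<preceq> k" unfolding act_apply_word by (rule apply_word_skip) (use assms(2) in auto)
  finally show ?thesis .
qed

text \<open>Only \<open>t\<close> comes with a type: this is where typability travels backwards
  along a whole computation.\<close>

lemma ref_closed_eq:
  assumes "s \<preceq> t" "[] \<turnstile> t \<Colon> A"
  shows "[] \<turnstile> s \<simeq> t \<Colon> A"
proof -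
  have "styp (\<lambda>_. TVar 0) t A" using typing_styp[OF assms(2)] by simp
  then have "eqv (\<lambda>_. TVar 0) s t A" by (rule refD(4)[OF assms(1)])
  moreover have "fv s = {}" using refD(3)[OF assms(1)] typed_closed[OF assms(2)] by simp
  ultimately show ?thesis unfolding eqv_def by simp
qed

lemma App_closed_typed:
  assumes "[] \<turnstile> App t s \<Colon> B"
  obtains A where "[] \<turnstile> t \<Colon> A \<multimap> B" "[] \<turnstile> s \<Colon> A"
proof -
  have c: "fv t = {}" "lin t" "fv s = {}" "lin s" using typed_closed[OF assms] by auto
  obtain A where "styp (\<lambda>_. TVar 0) t (A \<multimap> B)" "styp (\<lambda>_. TVar 0) s A"
    using typing_styp[OF assms, of "\<lambda>_. TVar 0"] by auto
  then show thesis using that closed_typing_iff c by blast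
qed

text \<open>The link sets differ by coherence, and a word determines its links as the set of its
  members. Since every label of \<open>A\<close> is used once, the flattened words are two different
  permutations of the same labels.\<close>

lemma distinct_words:
  assumes "[] \<turnstile> s1 \<Colon> relabel r A" "[] \<turnstile> s2 \<Colon> relabel r A" "\<not> [] \<turnstile> s1 \<simeq> s2 \<Colon> relabel r A" "distinct_labs A"
  obtains xs ys where "distinct xs" "distinct ys" "mset xs = mset ys" "xs \<noteq> ys"
    "\<And>c k. marks c \<Longrightarrow> closed k \<Longrightarrow> App (App (consumer c A) s1) k \<preceq> apply_word c xs k"
    "\<And>c k. marks c \<Longrightarrow> closed k \<Longrightarrow> App (App (consumer c A) s2) k \<preceq> apply_word c ys k"
proof -
  let ?e = "\<lambda>_. TVar 0"
  obtain t1 L1 where t1: "s1 \<preceq> t1" "cut_free ?e A t1 L1" "\<forall>(i, j)\<in>L1. r i = r j" using normal_form[OF assms(1)] by blast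
  obtain t2 L2 where t2: "s2 \<preceq> t2" "cut_free ?e A t2 L2" "\<forall>(i, j)\<in>L2. r i = r j" using normal_form[OF assms(2)] by blast
  have c: "fv s1 = {}" "fv s2 = {}" using typed_closed assms(1,2) by auto
  then have f: "fv t1 = {}" "fv t2 = {}" using refD(3)[OF t1(1)] refD(3)[OF t2(1)] by auto
  \<comment> \<open>Equal links would make the normal forms equal after applying
    \<open>TVar \<circ> r\<close>, which turns the labelled type back into the given one, and
    refinement would carry this over to \<open>s1\<close> and \<open>s2\<close>.\<close>
  have "L1 \<noteq> L2"
  proof
    assume "L1 = L2"
    let ?e' = "tsubst (TVar \<circ> r) \<circ> ?e"
    have "eqv ?e' t1 t2 (tsubst (TVar \<circ> r) A)"
      by (rule cut_free_coherent[OF t1(2)]) (use t2(2) \<open>L1 = L2\<close> f t1(3) assms(4) in \<open>auto simp: separated_def\<close>)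
    then have e: "eqv ?e' t1 t2 (relabel r A)" by (simp add: relabel_def)
    have "eqv ?e' s1 t1 (relabel r A)" "eqv ?e' s2 t2 (relabel r A)"
      using refD(4)[OF t1(1)] refD(4)[OF t2(1)] eqv_styp[OF e] by auto
    then have "eqv ?e' s1 s2 (relabel r A)" using e eqv_trans eqv_sym by blast
    then show False using assms(3) c unfolding eqv_def by simp
  qed
  obtain W1 where W1: "set W1 = L1" "mset (flat W1) = mlabs A"
    "\<And>c k. marks c \<Longrightarrow> closed k \<Longrightarrow> App (App (consumer c A) t1) k \<preceq> act c W1 k"
    using closed_cut_free_word[OF t1(2) f(1)] by metis
  obtain W2 where W2: "set W2 = L2" "mset (flat W2) = mlabs A"
    "\<And>c k. marks c \<Longrightarrow> closed k \<Longrightarrow> App (App (consumer c A) t2) k \<preceq> act c W2 k"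
    using closed_cut_free_word[OF t2(2) f(2)] by metis
  \<comment> \<open>The labels of \<open>A\<close> are pairwise distinct, so a list of exactly these
    labels has no repetition.\<close>
  have d: "distinct xs" if "mset xs = mlabs A" for xs
  proof -
    have "set xs = labs A" using that set_mlabs by (metis set_mset_mset)
    then have "mset xs = mset_set (set xs)" using that mlabs_distinct_labs[OF assms(4)] by simp
    then show ?thesis by (metis count_mset_set(1) distinct_count_atmost_1 finite_set count_mset_set(3))
  qed
  have step: "App (App (consumer c A) s) k \<preceq> apply_word c (flat W) k"
    if "s \<preceq> t" "fv s = {}" "marks c" "closed k" "App (App (consumer c A) t) k \<preceq> act c W k" for s t c k W
  proof -
    have ct: "closed t" using refD[OF that(1)] that(2) by simp
    have "App (consumer c A) s \<preceq> App (consumer c A) t"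
      using closed_consumer_producer[OF that(3)] by (intro ref_App_right[OF that(1) ct]) blast
    then have "App (App (consumer c A) s) k \<preceq> App (App (consumer c A) t) k"
      by (rule ref_App_left[OF _ _ that(4)]) (use ct closed_consumer_producer[OF that(3), of A] in simp)
    then show ?thesis using that(5) ref_trans unfolding act_apply_word by blast
  qed
  show thesis
  proof (rule that[of "flat W1" "flat W2"])
    show "flat W1 \<noteq> flat W2" using \<open>L1 \<noteq> L2\<close> W1(1) W2(1) flat_inject by blast
  qed (use d W1(2) W2(2) step[OF t1(1) c(1) _ _ W1(3)] step[OF t2(1) c(2) _ _ W2(3)] in auto)
qed

theorem theorem1:
  fixes A B :: ty and s1 s2 u1 u2 :: trm
  assumes "[] \<turnstile> s1 \<Colon> A" and "[] \<turnstile> s2 \<Colon> A"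
    and "\<not> [] \<turnstile> s1 \<simeq> s2 \<Colon> A"
    and "[] \<turnstile> u1 \<Colon> B" and "[] \<turnstile> u2 \<Colon> B"
  shows "\<exists>t. poly_typable t [A] B [s1] \<and> poly_typable t [A] B [s2] \<and>
             [] \<turnstile> App t s1 \<simeq> u1 \<Colon> B \<and> [] \<turnstile> App t s2 \<simeq> u2 \<Colon> B"
proof -
  obtain A' r where A: "distinct_labs A'" "relabel r A' = A" using linear_labelling by blast
  \<comment> \<open>Puts \<open>B\<close> into the shape that \<open>eraser\<close> expects.\<close>
  obtain B' q where B: "relabel q B' = B" using linear_labelling by blast
  have u: "closed u1" "closed u2" and s: "closed s1" "closed s2" using assms typed_closed by blast+
  obtain xs ys where w: "distinct xs" "distinct ys" "mset xs = mset ys" "xs \<noteq> ys"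
    "\<And>c k. marks c \<Longrightarrow> closed k \<Longrightarrow> App (App (consumer c A') s1) k \<preceq> apply_word c xs k"
    "\<And>c k. marks c \<Longrightarrow> closed k \<Longrightarrow> App (App (consumer c A') s2) k \<preceq> apply_word c ys k"
    using distinct_words[of s1 r A' s2] assms(1-3) A by metis
  obtain i j a b d a' b' d' where ij: "i \<noteq> j" "xs = a @ i # b @ j # d" "ys = a' @ j # b' @ i # d'"
    using distinct_inversion[OF w(1,3,4)] by blast
  let ?c = "separator i j u1 u2"
  let ?E = "consumer (\<lambda>_. Id_trm) B'"
  let ?k = "Fn 0 (Fn 1 (App (App ?E (Var 0)) (Var 1)))"
  let ?t = "Fn 0 (App (App (consumer ?c A') (Var 0)) ?k)"
  have m: "marks ?c" by (rule separator_marks[OF u])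
  have E: "closed ?E" using closed_consumer_producer[of "\<lambda>_. Id_trm"] by (simp add: marks_def)
  have T: "closed (consumer ?c A')" using closed_consumer_producer[OF m] by blast
  have k: "closed ?k" using E by auto
  have erase: "App (App ?k v) u \<preceq> u" if "closed u" "[] \<turnstile> v \<Colon> B" for u v
  proof -
    let ?\<sigma> = "Var(0 := v, 1 := u)"
    note v = typed_closed[OF that(2)]
    have "App (App ?k v) u \<approx> subst ?\<sigma> (App (App ?E (Var 0)) (Var 1))"
      by (rule conv_beta2) (use k v that(1) in auto)
    also have "\<dots> = App (App (subst ?\<sigma> ?E) v) u" by simp
    also have "\<dots> \<approx> App (App ?E v) u"
      using E v that(1) by (intro conv_App conv_refl subst_closed) (auto simp del: subst.simps)
    also have "\<dots> \<preceq> u" by (rule eraser[of v q]) (use that B in auto)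
    finally show ?thesis .
  qed
  have beta: "App ?t s \<preceq> App (App (consumer ?c A') s) ?k" if "closed s" for s
  proof -
    let ?\<sigma> = "Var(0 := s)"
    have "App ?t s \<approx> subst ?\<sigma> (App (App (consumer ?c A') (Var 0)) ?k)"
      by (rule conv_beta) (use that T k in auto)
    also have "\<dots> = App (App (subst ?\<sigma> (consumer ?c A')) s) (subst ?\<sigma> ?k)" by simp
    also have "\<dots> \<approx> App (App (consumer ?c A') s) ?k"
      using that T k by (intro conv_App conv_refl subst_closed) (auto simp del: subst.simps)
    finally show ?thesis by (rule convD)
  qed
  have r1: "App ?t s1 \<preceq> u1"
  proof -
    note beta[OF s(1)]
    also note w(5)[OF m k]
    \<comment> \<open>\<open>i\<close> precedes \<open>j\<close> in \<open>xs\<close>, so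
      \<open>?k\<close> meets \<open>u2\<close> first; having type \<open>B\<close>,
      \<open>u2\<close> is erased and \<open>u1\<close> remains.\<close>
    also note apply_word_separator(1)[OF w(1) k u ij(1,2)]
    also note erase[OF u(1) assms(5)]
    finally show ?thesis .
  qed
  have r2: "App ?t s2 \<preceq> u2"
  proof -
    note beta[OF s(2)]
    also note w(6)[OF m k]
    also note apply_word_separator(2)[OF w(2) k u ij(1,3)]
    also note erase[OF u(2) assms(4)]
    finally show ?thesis .
  qed
  have e: "[] \<turnstile> App ?t s1 \<simeq> u1 \<Colon> B" "[] \<turnstile> App ?t s2 \<simeq> u2 \<Colon> B"
    using ref_closed_eq r1 r2 assms(4,5) by blast+
  \<comment> \<open>The argument types are read off from the two typed equations and may differ from
    each other and from \<open>A\<close>; \<open>poly_typableI\<close> allows for this.\<close>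
  obtain A1 where A1: "[] \<turnstile> ?t \<Colon> A1 \<multimap> B" "[] \<turnstile> s1 \<Colon> A1"
    using eq_bec_typed[OF e(1)] App_closed_typed by blast
  obtain A2 where A2: "[] \<turnstile> ?t \<Colon> A2 \<multimap> B" "[] \<turnstile> s2 \<Colon> A2"
    using eq_bec_typed[OF e(2)] App_closed_typed by blast
  show ?thesis
    using e poly_typableI[OF A1 assms(1)] poly_typableI[OF A2 assms(2)] by blast
qed

end
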